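(* There exists an absolute constant $C<\infty$ such that the following holds. Let $s,m,n\in\mathbb{Z}_+$, $\varkappa\ge 0$, $\bar\varrho>1$, and $\sigma>0$. Suppose that $x\in\mathcal{X}_{m,n}(s,\varkappa)$ and that $\varphi\in\mathbb{C}_m(\mathbb{Z})$ is a filter satisfying $\|F_m[\varphi]\|_1\le \bar\varrho/\sqrt{2m+1}$. Let $\widehat\varphi_{\rm con}$ be an optimal solution to $$\min_{\phi\in\mathbb{C}_m(\mathbb{Z})}\ \|y-\phi*y\|_{n,2}^2\quad\text{subject to}\quad \|F_m[\phi]\|_1\le\frac{\bar\varrho}{\sqrt{2m+1}},$$ and let $\widehat x_{\rm con}=\widehat\varphi_{\rm con}*y$. Then for any $\alpha\in(0,1)$, with probability at least $1-\alpha$, $$\|x-\widehat x_{\rm con}\|_{n,2}\le\|x-\varphi*y\|_{n,2}+C\sigma\Big(\bar\varrho(\kappa_{m,n}^2+1)\log[(m+n)/\alpha]+\bar\varrho\,\varkappa\sqrt{\log[1/\alpha]}+s\Big)^{1/2},$$ where $\kappa_{m,n}=\sqrt{\frac{2n+1}{2m+1}}$.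
   Context: $\mathbb{Z}_+$ is the set of nonnegative integers. $\mathbb{C}(\mathbb{Z})$ is the space of two-sided complex sequences; $\mathbb{C}_m(\mathbb{Z})$ is the subspace of sequences vanishing outside $\{-m,\dots,m\}$ (its elements are called filters). Convolution: $[\varphi*y]_t=\sum_{\tau\in\mathbb{Z}}\varphi_\tau y_{t-\tau}$. Shift: $[\Delta x]_t=x_{t-1}$, with inverse $\Delta^{-1}$. Semi-norm: $\|x\|_{n,2}=\big(\sum_{|\tau|\le n}|x_\tau|^2\big)^{1/2}$. The unitary DFT $F_m:\mathbb{C}_m(\mathbb{Z})\to\mathbb{C}^{2m+1}$ is $(F_m[x])_k=\frac{1}{\sqrt{2m+1}}\sum_{|\tau|\le m}\exp\big(-\frac{2\pi i k\tau}{2m+1}\big)x_\tau$, $1\le k\le 2m+1$, and $\|\cdot\|_1$ on $\mathbb{C}^{2m+1}$ is the $\ell_1$-norm. Observations: $y_\tau=x_\tau+\sigma\zeta_\tau$ for $|\tau|\le m+n$, where $x\in\mathbb{C}(\mathbb{Z})$ is an unknown signal and the $\zeta_\tau$ are independent of $x$ and i.i.d. standard complex Gaussian, i.e. $\zeta_\tau=\zeta_\tau^1+i\zeta_\tau^2$ with $\zeta^1_\tau,\zeta^2_\tau$ i.i.d. $\mathcal{N}(0,1)$. Class $\mathcal{X}_{m,n}(s,\varkappa)$: the set of $x\in\mathbb{C}(\mathbb{Z})$ admitting a decomposition $x=x^{\mathcal S}+\varepsilon$, where $x^{\mathcal S}\in\mathcal S$ for some (unknown) shift-invariant linear subspace $\mathcal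 S$ of $\mathbb{C}(\mathbb{Z})$ (i.e. $\Delta\mathcal S\subseteq\mathcal S$) with $s=\dim\mathcal S\le 2n+1$, and $\|\Delta^{-\tau}\varepsilon\|_{n,2}\le\varkappa\sigma$ for all $|\tau|\le m$.
   Formalization: One C for all α in (0,1) is impossible (m=0, n=1, x=0, s=ϰ=0, φ=0, α→1), so C here may depend on α₀<1 and serves all α ≤ α₀; m+n>0 is required since log(0/α) is undefined; the sample space ranges over one arbitrary type fixed before C. *)

theory Defs
  imports "HOL-Probability.Probability" "HOL-Library.Function_Algebras"
begin

text \<open>Two-sided complex sequences are functions \<^typ>\<open>int \<Rightarrow> complex\<close>, with the pointwise
  addition of Function_Algebras and the following scalar multiplication.\<close>

definition seq_scale :: "complex \<Rightarrow> (int \<Rightarrow> complex) \<Rightarrow> int \<Rightarrow> complex" where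
  "seq_scale c x = (\<lambda>t. c * x t)"

global_interpretation seq: vector_space seq_scale
  defines seq_subspace = seq.subspace
    and seq_span = seq.span
    and seq_dim = seq.dim
  by unfold_locales (auto simp: seq_scale_def plus_fun_def algebra_simps)

definition filters :: "nat \<Rightarrow> (int \<Rightarrow> complex) set" where
  "filters m = {\<phi>. \<forall>\<tau>. \<bar>\<tau>\<bar> > int m \<longrightarrow> \<phi> \<tau> = 0}"

definition seq_conv :: "(int \<Rightarrow> complex) \<Rightarrow> (int \<Rightarrow> complex) \<Rightarrow> int \<Rightarrow> complex" where
  "seq_conv \<phi> y = (\<lambda>t. \<Sum>\<^sub>\<infinity>\<tau>. \<phi> \<tau> * y (t - \<tau>))"

text \<open>The (possibly negative) power \<open>\<Delta>\<^sup>k\<close> of the shift; \<open>\<Delta>\<close> itself is \<open>seq_shift 1\<close>.\<close>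

definition seq_shift :: "int \<Rightarrow> (int \<Rightarrow> complex) \<Rightarrow> int \<Rightarrow> complex" where
  "seq_shift k x = (\<lambda>t. x (t - k))"

definition seminorm2 :: "nat \<Rightarrow> (int \<Rightarrow> complex) \<Rightarrow> real" where
  "seminorm2 n x = L2_set (\<lambda>\<tau>. cmod (x \<tau>)) {- int n..int n}"

definition dft :: "nat \<Rightarrow> (int \<Rightarrow> complex) \<Rightarrow> nat \<Rightarrow> complex" where
  "dft m x k = complex_of_real (1 / sqrt (2 * real m + 1)) *
     (\<Sum>\<tau> = - int m..int m.
        exp (- (2 * complex_of_real pi * \<i> * of_nat k * of_int \<tau> / (2 * of_nat m + 1))) * x \<tau>)"

definition dft_norm1 :: "nat \<Rightarrow> (int \<Rightarrow> complex) \<Rightarrow> real" where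
  "dft_norm1 m x = (\<Sum>k = 1..2 * m + 1. cmod (dft m x k))"

text \<open>The inclusion in the span of a finite set makes \<open>S\<close> finite-dimensional; this is not implied
  by the equation for \<open>seq_dim\<close>, which is 0 on infinite-dimensional spaces.\<close>

definition signal_class ::
    "nat \<Rightarrow> nat \<Rightarrow> real \<Rightarrow> nat \<Rightarrow> real \<Rightarrow> (int \<Rightarrow> complex) set" where
  "signal_class m n \<sigma> s \<kappa> =
     {x. \<exists>S xS \<epsilon>. x = xS + \<epsilon> \<and> xS \<in> S \<and>
           seq_subspace S \<and> seq_shift 1 ` S \<subseteq> S \<and>
           (\<exists>B. finite B \<and> S \<subseteq> seq_span B) \<and> s = seq_dim S \<and> s \<le> 2 * n + 1 \<and>
           (\<forall>\<tau>. \<bar>\<tau>\<bar> \<le> int m \<longrightarrow> seminorm2 n (seq_shift (- \<tau>) \<epsilon>) \<le> \<kappa> * \<sigma>)}"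

text \<open>The variables \<open>\<zeta>\<^sub>\<tau>\<close>, \<open>\<tau> \<in> I\<close>, are i.i.d. standard complex Gaussian in the convention
  under which the real and the imaginary part each have variance 1. The index set
  \<open>I \<times> UNIV\<close> runs over all real parts (\<open>True\<close>) and imaginary parts (\<open>False\<close>).\<close>

definition iid_std_complex_gaussian :: "'w measure \<Rightarrow> int set \<Rightarrow> (int \<Rightarrow> 'w \<Rightarrow> complex) \<Rightarrow> bool" where
  "iid_std_complex_gaussian M I \<zeta> \<longleftrightarrow>
     prob_space.indep_vars M (\<lambda>_. borel)
       (\<lambda>(\<tau>, re) \<omega>. if re then Re (\<zeta> \<tau> \<omega>) else Im (\<zeta> \<tau> \<omega>)) (I \<times> (UNIV :: bool set)) \<and>
     (\<forall>\<tau>\<in>I. distributed M lborel (\<lambda>\<omega>. Re (\<zeta> \<tau> \<omega>)) std_normal_density \<and>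
            distributed M lborel (\<lambda>\<omega>. Im (\<zeta> \<tau> \<omega>)) std_normal_density)"

definition con_feasible :: "nat \<Rightarrow> real \<Rightarrow> (int \<Rightarrow> complex) \<Rightarrow> bool" where
  "con_feasible m \<rho> \<phi> \<longleftrightarrow> \<phi> \<in> filters m \<and> dft_norm1 m \<phi> \<le> \<rho> / sqrt (2 * real m + 1)"

definition con_optimal :: "nat \<Rightarrow> nat \<Rightarrow> real \<Rightarrow> (int \<Rightarrow> complex) \<Rightarrow> (int \<Rightarrow> complex) \<Rightarrow> bool" where
  "con_optimal m n \<rho> y \<phi> \<longleftrightarrow>
     is_arg_min (\<lambda>\<psi>. (seminorm2 n (y - seq_conv \<psi> y))\<^sup>2) (con_feasible m \<rho>) \<phi>"

definition kappa_ratio :: "nat \<Rightarrow> nat \<Rightarrow> real" where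
  "kappa_ratio m n = sqrt ((2 * real n + 1) / (2 * real m + 1))"

text \<open>\<open>P\<close> holds with probability at least \<open>p\<close>, as an inner probability: an optimal solution need
  not be unique and may be selected non-measurably, so \<open>{\<omega>. P \<omega>}\<close> need not be an event. If it is
  one, this just says that its probability is at least \<open>p\<close>.\<close>

definition with_prob_ge :: "'w measure \<Rightarrow> real \<Rightarrow> ('w \<Rightarrow> bool) \<Rightarrow> bool" where
  "with_prob_ge M p P \<longleftrightarrow> (\<exists>A\<in>sets M. (\<forall>\<omega>\<in>A. P \<omega>) \<and> p \<le> measure M A)"

text \<open>For a bound that holds with probability at least \<open>1 - \<alpha>\<close> for every \<open>\<alpha> \<in> (0, 1)\<close> and involves
  \<open>ln (1 / \<alpha>)\<close>, a constant uniform up to \<open>\<alpha> \<rightarrow> 1\<close> may be impossible because \<open>ln (1 / \<alpha>)\<close> vanishes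
  there. For the oracle inequality it is impossible: take \<open>m = 2 * n + 1\<close>, \<open>s = 0\<close>, \<open>\<rho> = 2\<close>,
  \<open>\<phi> = 0\<close>, \<open>x = \<sigma> * m^3\<close> at time \<open>n + 1\<close> and 0 elsewhere, \<open>\<kappa> = m^3\<close>, and \<open>ln (1 / \<alpha>) = 1 / \<kappa>\<^sup>2\<close>.
  Outside an event whose probability is exponentially small in \<open>n\<close>, some feasible filter reproduces \<open>y\<close>
  exactly on \<open>{-n..n}\<close>, so the loss is the norm of the noise there, of order \<open>\<sigma> * sqrt n\<close>,
  while the bound is of order \<open>\<sigma> * sqrt (ln n)\<close> and \<open>1 - \<alpha>\<close> is of order \<open>n^(-6)\<close>. The constant is
  therefore uniform over \<open>0 < \<alpha> \<le> \<alpha>0\<close>, for every \<open>\<alpha>0 < 1\<close>.\<close>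

end

theory Submission
  imports Defs
begin

text \<open>Comparing the objective at the optimal filter \<open>\<psi>\<close> and at \<open>\<phi>\<close> leaves cross terms between the noise
  \<open>\<zeta>\<close> and the two residuals. A feasible filter is a combination, with coefficients of total mass at most
  \<open>\<rho>\<close>, of \<open>2 * m + 1\<close> modulated moving averages, so the terms quadratic in the noise reduce to
  \<open>O(m)\<close> fixed quadratic forms, which the Hanson-Wright inequality controls up to a logarithm. In the term
  linear in the noise let \<open>\<Pi>\<close> be the orthogonal projection onto the restriction of the shift-invariant space
  to the window. The projected noise has norm of order \<open>sqrt s\<close> up to a logarithm and meets the residual
  \<open>x - \<psi> * y\<close>, which is absorbed into the left-hand side, up to one more quadratic form in the noise. The
  complementary part sees only \<open>\<epsilon> - \<psi> * \<epsilon>\<close>; by Parseval the moving averages of \<open>\<epsilon>\<close> are jointly no larger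
  than \<open>\<epsilon>\<close> itself, so no union bound is needed there and the factor is \<open>sqrt (ln (1 / \<alpha>))\<close>.\<close>

section \<open>Gaussian quadratic forms\<close>

text \<open>The optimal filter depends on the noise, so no tail bound may mention it. Every random
  quantity is bounded for filters fixed in advance; the passage to the optimal filter is linear
  algebra at a single outcome, so even a non-measurable selection is harmless. The projection too
  can be fixed beforehand, because one space contains the residual of the structured part of the
  signal for all filters at once. Tail bounds have the shape "constant + ln (1 / \<delta>)", and
  union bounds add further constants. A multiple of ln (1 / \<alpha>) absorbs them only if ln (1 /
  \<alpha>) stays away from 0: if it is at least \<open>l0\<close>, then
  \<open>v + 7 \<le> (1 + 7 / l0) * v\<close> for every \<open>v \<ge> l0\<close>. This factor
  \<open>K\<close> is the only place where \<alpha>0 enters the final constant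
  \<open>30 * (1 + 7 / l0)\<close>. The coefficient 1 in front of the oracle loss survives because
  the two losses \<open>a\<close> and \<open>b\<close> are compared by completing squares: linear
  terms in \<open>a\<close> and \<open>b\<close> shift the squares and leave only an additive
  error.\<close>

abbreviation (input) std_gauss :: "real measure" where
  "std_gauss \<equiv> density lborel (\<lambda>x. ennreal (std_normal_density x))"

lemma prob_space_std_gauss: "prob_space std_gauss"
  by (rule prob_space_normal_density) simp

text \<open>Completing the square: with \<open>p = 1 - 2 * b\<close>, the tilted Gaussian density is
  a constant multiple of the normal density with mean \<open>g / p\<close> and variance
  \<open>1 / p\<close>.\<close>

lemma nn_integral_exp_quadratic:
  fixes b g :: real
  assumes "b < 1/2"
  shows "(\<integral>\<^sup>+x. ennreal (exp (b * x\<^sup>2 + g * x)) \<partial>std_gauss)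
    = ennreal (exp (g\<^sup>2 / (2 * (1 - 2 * b))) / sqrt (1 - 2 * b))"
proof -
  define p where "p = 1 - 2 * b"
  have p: "p > 0" using assms by (simp add: p_def)
  have eq: "std_normal_density x * exp (b * x\<^sup>2 + g * x)
      = exp (g\<^sup>2 / (2 * p)) / sqrt p * normal_density (g / p) (1 / sqrt p) x" for x
  proof -
    have e: "b * x\<^sup>2 + g * x - x\<^sup>2 / 2 = g\<^sup>2 / (2 * p) - (x - g / p)\<^sup>2 / (2 * (1 / sqrt p)\<^sup>2)"
    proof -
      have b: "b = (1 - p) / 2" by (simp add: p_def)
      show ?thesis unfolding b using p by (simp add: power_divide power2_eq_square field_simps)
    qed
    have "std_normal_density x * exp (b * x\<^sup>2 + g * x)
        = exp (b * x\<^sup>2 + g * x - x\<^sup>2 / 2) / sqrt (2 * pi)"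
      by (simp add: std_normal_density_def mult_exp_exp algebra_simps)
    also have "\<dots> = exp (g\<^sup>2 / (2 * p)) * exp (- (x - g / p)\<^sup>2 / (2 * (1 / sqrt p)\<^sup>2)) / sqrt (2 * pi)"
      unfolding e exp_add[symmetric] by simp
    also have "\<dots> = exp (g\<^sup>2 / (2 * p)) / sqrt p * normal_density (g / p) (1 / sqrt p) x"
      using p by (simp add: normal_density_def real_sqrt_divide power_divide real_sqrt_mult)
    finally show ?thesis .
  qed
  have "(\<integral>\<^sup>+x. ennreal (exp (b * x\<^sup>2 + g * x)) \<partial>std_gauss)
      = (\<integral>\<^sup>+x. ennreal (std_normal_density x) * ennreal (exp (b * x\<^sup>2 + g * x)) \<partial>lborel)"
    by (subst nn_integral_density) auto
  also have "\<dots> = (\<integral>\<^sup>+x. ennreal (exp (g\<^sup>2 / (2 * p)) / sqrt p) *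
      ennreal (normal_density (g / p) (1 / sqrt p) x) \<partial>lborel)"
    using p by (intro nn_integral_cong) (simp add: ennreal_mult[symmetric] eq)
  also have "\<dots> = ennreal (exp (g\<^sup>2 / (2 * p)) / sqrt p) *
      (\<integral>\<^sup>+x. ennreal (normal_density (g / p) (1 / sqrt p) x) \<partial>lborel)"
    by (rule nn_integral_cmult) auto
  also have "(\<integral>\<^sup>+x. ennreal (normal_density (g / p) (1 / sqrt p) x) \<partial>lborel) = 1"
    using p by (subst nn_integral_eq_integral) (auto intro!: integrable_normal_density)
  finally show ?thesis by (simp add: p_def)
qed

lemma quadratic_form_insert:
  fixes b :: "'i \<Rightarrow> 'i \<Rightarrow> real"
  assumes "finite J" "i \<notin> J"
  shows "(\<Sum>j\<in>insert i J. \<Sum>k\<in>insert i J. b j k * (x(i := a)) j * (x(i := a)) k)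
    = b i i * a\<^sup>2 + (\<Sum>j\<in>J. (b i j + b j i) * x j) * a + (\<Sum>j\<in>J. \<Sum>k\<in>J. b j k * x j * x k)"
proof -
  have n: "j \<noteq> i" if "j \<in> J" for j using that assms by auto
  have "(\<Sum>j\<in>insert i J. \<Sum>k\<in>insert i J. b j k * (x(i := a)) j * (x(i := a)) k)
      = b i i * a * a + (\<Sum>k\<in>J. b i k * a * x k) + (\<Sum>j\<in>J. b j i * x j * a + (\<Sum>k\<in>J. b j k * x j * x k))"
    using assms n by (simp cong: sum.cong)
  then show ?thesis
    by (simp add: sum.distrib sum_distrib_left sum_distrib_right power2_eq_square algebra_simps)
qed

text \<open>The matrix need not be symmetric, and integrating out \<open>i\<close> only sees the
  sums \<open>b i j + b j i\<close>. The factor 1/2 comes from (p + q)^2 / 2 \<le> p^2 +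
  q^2.\<close>

lemma frobenius_insert:
  fixes b :: "'i \<Rightarrow> 'i \<Rightarrow> real"
  assumes "finite J" "i \<notin> J"
  shows "(\<Sum>j\<in>insert i J. \<Sum>k\<in>insert i J. (b j k)\<^sup>2)
    \<ge> (b i i)\<^sup>2 + (\<Sum>j\<in>J. (b i j + b j i)\<^sup>2) / 2 + (\<Sum>j\<in>J. \<Sum>k\<in>J. (b j k)\<^sup>2)"
proof -
  have "(\<Sum>j\<in>J. (b i j + b j i)\<^sup>2) / 2 = (\<Sum>j\<in>J. (b i j + b j i)\<^sup>2 / 2)"
    by (simp add: sum_divide_distrib)
  also have "\<dots> \<le> (\<Sum>j\<in>J. (b i j)\<^sup>2 + (b j i)\<^sup>2)"
  proof (rule sum_mono)
    fix j
    have "0 \<le> (b i j - b j i)\<^sup>2" by simp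
    then show "(b i j + b j i)\<^sup>2 / 2 \<le> (b i j)\<^sup>2 + (b j i)\<^sup>2"
      by (simp add: power2_eq_square field_simps)
  qed
  finally show ?thesis using assms by (simp add: sum.distrib)
qed

text \<open>Integrating out the coordinate \<open>i\<close> replaces the form on the remaining coordinates by its Schur
  complement \<open>b + g g\<^sup>T / (2 (1 - 2 b\<^sub>i\<^sub>i))\<close>, which is again bounded by \<open>1/16\<close>.\<close>

lemma nn_integral_exp_quadratic_form:
  fixes b :: "'i \<Rightarrow> 'i \<Rightarrow> real"
  assumes "finite J"
    and "\<And>x. \<bar>\<Sum>j\<in>J. \<Sum>k\<in>J. b j k * x j * x k\<bar> \<le> (\<Sum>j\<in>J. (x j)\<^sup>2) / 16"
  shows "(\<integral>\<^sup>+x. ennreal (exp (\<Sum>j\<in>J. \<Sum>k\<in>J. b j k * x j * x k)) \<partial>Pi\<^sub>M J (\<lambda>_. std_gauss))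
    \<le> ennreal (exp ((\<Sum>j\<in>J. b j j) + 4 * (\<Sum>j\<in>J. \<Sum>k\<in>J. (b j k)\<^sup>2)))"
  using assms
proof (induction J arbitrary: b rule: finite_induct)
  case empty
  interpret prob_space "Pi\<^sub>M {} (\<lambda>_::'i. std_gauss)"
    by (intro prob_space_PiM prob_space_std_gauss)
  show ?case using emeasure_space_1 by simp
next
  case (insert i J)
  interpret product_sigma_finite "\<lambda>_. std_gauss"
    unfolding product_sigma_finite_def
    using prob_space_std_gauss prob_space_imp_sigma_finite by blast
  define g where "g j = b i j + b j i" for j
  define Q where "Q x = (\<Sum>j\<in>J. \<Sum>k\<in>J. b j k * x j * x k)" for x
  define r2 where "r2 = (\<Sum>j\<in>J. (g j)\<^sup>2)"
  define p where "p = 1 - 2 * b i i"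
  define c where "c = 1 / (2 * p)"
  define b' where "b' j k = b j k + c * g j * g k" for j k
  have bound: "\<bar>b i i * a\<^sup>2 + (\<Sum>j\<in>J. g j * x j) * a + Q x\<bar> \<le> (a\<^sup>2 + (\<Sum>j\<in>J. (x j)\<^sup>2)) / 16" for x a
  proof -
    have s: "(\<Sum>j\<in>insert i J. ((x(i := a)) j)\<^sup>2) = a\<^sup>2 + (\<Sum>j\<in>J. (x j)\<^sup>2)"
    proof -
      have "j \<noteq> i" if "j \<in> J" for j using that insert by auto
      then show ?thesis using insert by (simp cong: sum.cong)
    qed
    show ?thesis
      using insert.prems[of "x(i := a)"] insert.hyps
      unfolding quadratic_form_insert[OF insert.hyps] s Q_def g_def by simp
  qed
  have bii: "\<bar>b i i\<bar> \<le> 1/16" using bound[of 1 "\<lambda>_. 0"] by (simp add: Q_def)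
  have p: "7/8 \<le> p" "p \<le> 9/8" using bii by (auto simp: p_def)
  have c: "0 < c" "c \<le> 4/7" using p by (auto simp: c_def field_simps)
  have Qbd: "\<bar>Q x\<bar> \<le> (\<Sum>j\<in>J. (x j)\<^sup>2) / 16" for x using bound[of 0 x] by simp
  have r2_nonneg: "r2 \<ge> 0" by (simp add: r2_def sum_nonneg)
  have r2: "r2 \<le> 1/16"
  proof -
    define r where "r = sqrt r2"
    have r: "r \<ge> 0" "r\<^sup>2 = r2" using r2_nonneg by (auto simp: r_def)
    have "r2 * r \<le> (r\<^sup>2 + r2) / 16 - b i i * r\<^sup>2 - Q g"
      using bound[of r g] unfolding r2_def power2_eq_square abs_le_iff by linarith
    also have "\<dots> \<le> (r\<^sup>2 + r2) / 16 + r\<^sup>2 / 16 + r2 / 16"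
    proof -
      have "- b i i * r\<^sup>2 \<le> 1/16 * r\<^sup>2" by (rule mult_right_mono) (use bii in auto)
      moreover have "- Q g \<le> r2 / 16" using Qbd[of g] by (simp add: r2_def)
      ultimately show ?thesis by simp
    qed
    finally have "r\<^sup>2 * r \<le> r\<^sup>2 * (1/4)" using r by simp
    then have "r \<le> 1/4" using r by (cases "r = 0") (auto simp: mult_le_cancel_left)
    then have "r\<^sup>2 \<le> (1/4)\<^sup>2" using r by (intro power_mono) auto
    then show ?thesis using r by (simp add: power2_eq_square)
  qed
  have Q': "(\<Sum>j\<in>J. \<Sum>k\<in>J. b' j k * x j * x k) = Q x + c * (\<Sum>j\<in>J. g j * x j)\<^sup>2" for x
    by (simp add: b'_def Q_def power2_eq_square sum_product sum_distrib_left sum.distrib[symmetric] algebra_simps)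
  have "\<bar>\<Sum>j\<in>J. \<Sum>k\<in>J. b' j k * x j * x k\<bar> \<le> (\<Sum>j\<in>J. (x j)\<^sup>2) / 16" for x
  proof -
    define u where "u = (\<Sum>j\<in>J. g j * x j)"
    \<comment> \<open>This is the mean of the tilted Gaussian, that is, the maximizer of b a^2 + u a
      - a^2 / 2 for \<open>b = b i i\<close>. At this point the form exceeds the Schur complement by
      \<open>a\<^sup>2 / 2\<close>, which more than pays for the \<open>a\<^sup>2 / 16\<close> on
      the right, so the bound 1/16 does not deteriorate along the induction.\<close>
    define a where "a = u / p"
    have "b i i * a\<^sup>2 + u * a + Q x \<le> (a\<^sup>2 + (\<Sum>j\<in>J. (x j)\<^sup>2)) / 16"
      using bound[of a x] unfolding u_def abs_le_iff by linarith
    moreover have "b i i * a\<^sup>2 + u * a = c * u\<^sup>2 + a\<^sup>2 / 2"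
    proof -
      have b: "b i i = (1 - p) / 2" by (simp add: p_def)
      show ?thesis unfolding b a_def c_def using p by (simp add: field_simps power2_eq_square)
    qed
    moreover have "a\<^sup>2 \<ge> 0" "c * u\<^sup>2 \<ge> 0" using c by auto
    moreover have "- ((\<Sum>j\<in>J. (x j)\<^sup>2) / 16) \<le> Q x" using Qbd[of x] by auto
    ultimately have "Q x + c * u\<^sup>2 \<le> (\<Sum>j\<in>J. (x j)\<^sup>2) / 16"
      and "- ((\<Sum>j\<in>J. (x j)\<^sup>2) / 16) \<le> Q x + c * u\<^sup>2" by argo+
    then show ?thesis unfolding Q' u_def[symmetric] by linarith
  qed
  note IH = insert.IH[OF this]
  define F2 where "F2 = (\<Sum>j\<in>J. \<Sum>k\<in>J. (b j k)\<^sup>2)"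
  have F': "(\<Sum>j\<in>J. \<Sum>k\<in>J. (b' j k)\<^sup>2) \<le> F2 + r2 / 10"
  proof -
    have "(\<Sum>j\<in>J. \<Sum>k\<in>J. (b' j k)\<^sup>2) = F2 + 2 * c * Q g + c\<^sup>2 * r2 * r2"
      unfolding b'_def F2_def Q_def r2_def
      by (simp add: power2_eq_square sum_product sum_distrib_left sum.distrib[symmetric] algebra_simps)
    moreover have "2 * c * Q g \<le> 2 * (4/7) * (r2 / 16)"
    proof -
      have "2 * c * Q g \<le> 2 * c * (r2 / 16)" using Qbd[of g] c by (intro mult_left_mono) (auto simp: r2_def)
      also have "\<dots> \<le> 2 * (4/7) * (r2 / 16)" using c r2_nonneg by (intro mult_right_mono) auto
      finally show ?thesis .
    qed
    moreover have "c\<^sup>2 * r2 * r2 \<le> (4/7)\<^sup>2 * (1/16) * r2"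
      using c r2 r2_nonneg by (intro mult_right_mono mult_mono power_mono) auto
    ultimately show ?thesis using r2_nonneg by (simp add: power2_eq_square)
  qed
  have tr': "(\<Sum>j\<in>J. b' j j) = (\<Sum>j\<in>J. b j j) + c * r2"
    by (simp add: b'_def r2_def sum.distrib sum_distrib_left power2_eq_square mult.assoc)
  have lnp: "- ln p / 2 \<le> b i i + 4 * (b i i)\<^sup>2"
  proof -
    have "\<bar>ln (1 + (- 2 * b i i)) - (- 2 * b i i)\<bar> \<le> 2 * (- 2 * b i i)\<^sup>2"
      using bii by (intro abs_ln_one_plus_x_minus_x_bound) auto
    then show ?thesis by (simp add: p_def power2_eq_square abs_le_iff)
  qed
  have sq: "1 / sqrt p = exp (- ln p / 2)"
    using p by (simp add: exp_minus ln_sqrt[symmetric] inverse_eq_divide)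
  \<comment> \<open>The factor 4 in the exponent closes the induction. The new diagonal entry
    supplies \<open>4 * (b i i)\<^sup>2\<close>, which covers the second-order part of
    \<open>- ln p / 2\<close>. The new off-diagonal entries supply \<open>2 * r2\<close>, while the
    Schur complement costs at most \<open>4/10 * r2\<close> in the Frobenius norm and
    \<open>4/7 * r2\<close> in the trace.\<close>
  have fin: "(\<Sum>j\<in>J. b' j j) + 4 * (\<Sum>j\<in>J. \<Sum>k\<in>J. (b' j k)\<^sup>2) - ln p / 2
      \<le> (\<Sum>j\<in>insert i J. b j j) + 4 * (\<Sum>j\<in>insert i J. \<Sum>k\<in>insert i J. (b j k)\<^sup>2)"
  proof -
    have "c * r2 \<le> 4/7 * r2" using c r2_nonneg by (intro mult_right_mono) auto
    moreover have "(\<Sum>j\<in>insert i J. b j j) = b i i + (\<Sum>j\<in>J. b j j)" using insert by simp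
    ultimately show ?thesis
      using F' tr' lnp frobenius_insert[OF insert.hyps, of b] r2_nonneg
      unfolding F2_def[symmetric] r2_def[symmetric] g_def[symmetric] by linarith
  qed
  have meas[measurable]: "(\<lambda>x. ennreal (exp (\<Sum>j\<in>insert i J. \<Sum>k\<in>insert i J. b j k * x j * x k)))
     \<in> borel_measurable (Pi\<^sub>M (insert i J) (\<lambda>_. std_gauss))"
    by measurable
  have "(\<integral>\<^sup>+x. ennreal (exp (\<Sum>j\<in>insert i J. \<Sum>k\<in>insert i J. b j k * x j * x k)) \<partial>Pi\<^sub>M (insert i J) (\<lambda>_. std_gauss))
     = (\<integral>\<^sup>+x. (\<integral>\<^sup>+a. ennreal (exp (\<Sum>j\<in>insert i J. \<Sum>k\<in>insert i J. b j k * (x(i := a)) j * (x(i := a)) k))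
         \<partial>std_gauss) \<partial>Pi\<^sub>M J (\<lambda>_. std_gauss))"
    by (rule product_nn_integral_insert[OF insert.hyps meas])
  also have "\<dots> = (\<integral>\<^sup>+x. ennreal (exp (\<Sum>j\<in>J. \<Sum>k\<in>J. b' j k * x j * x k)) * ennreal (1 / sqrt p) \<partial>Pi\<^sub>M J (\<lambda>_. std_gauss))"
  proof (rule nn_integral_cong)
    fix x
    define u where "u = (\<Sum>j\<in>J. g j * x j)"
    have "(\<integral>\<^sup>+a. ennreal (exp (\<Sum>j\<in>insert i J. \<Sum>k\<in>insert i J. b j k * (x(i := a)) j * (x(i := a)) k)) \<partial>std_gauss)
       = (\<integral>\<^sup>+a. ennreal (exp (Q x)) * ennreal (exp (b i i * a\<^sup>2 + u * a)) \<partial>std_gauss)"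
      unfolding quadratic_form_insert[OF insert.hyps] g_def[symmetric] Q_def[symmetric] u_def[symmetric]
      by (intro nn_integral_cong) (simp add: ennreal_mult[symmetric] exp_add[symmetric] add.commute)
    also have "\<dots> = ennreal (exp (Q x)) * ennreal (exp (u\<^sup>2 / (2 * p)) / sqrt p)"
      using bii by (subst nn_integral_cmult) (auto simp: nn_integral_exp_quadratic p_def)
    also have "\<dots> = ennreal (exp (\<Sum>j\<in>J. \<Sum>k\<in>J. b' j k * x j * x k)) * ennreal (1 / sqrt p)"
      using p unfolding Q' u_def[symmetric]
      by (simp add: ennreal_mult[symmetric] exp_add c_def)
    finally show "(\<integral>\<^sup>+a. ennreal (exp (\<Sum>j\<in>insert i J. \<Sum>k\<in>insert i J. b j k * (x(i := a)) j * (x(i := a)) k)) \<partial>std_gauss)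
       = ennreal (exp (\<Sum>j\<in>J. \<Sum>k\<in>J. b' j k * x j * x k)) * ennreal (1 / sqrt p)" .
  qed
  also have "\<dots> = (\<integral>\<^sup>+x. ennreal (exp (\<Sum>j\<in>J. \<Sum>k\<in>J. b' j k * x j * x k)) \<partial>Pi\<^sub>M J (\<lambda>_. std_gauss)) * ennreal (1 / sqrt p)"
    by (rule nn_integral_multc) measurable
  also have "\<dots> \<le> ennreal (exp ((\<Sum>j\<in>J. b' j j) + 4 * (\<Sum>j\<in>J. \<Sum>k\<in>J. (b' j k)\<^sup>2))) * ennreal (1 / sqrt p)"
    by (rule mult_right_mono[OF IH]) simp
  also have "\<dots> = ennreal (exp ((\<Sum>j\<in>J. b' j j) + 4 * (\<Sum>j\<in>J. \<Sum>k\<in>J. (b' j k)\<^sup>2) - ln p / 2))"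
    using p unfolding sq by (simp add: ennreal_mult[symmetric] exp_add[symmetric])
  also have "\<dots> \<le> ennreal (exp ((\<Sum>j\<in>insert i J. b j j) + 4 * (\<Sum>j\<in>insert i J. \<Sum>k\<in>insert i J. (b j k)\<^sup>2)))"
    using fin by (intro ennreal_leI) simp
  finally show ?case .
qed

section \<open>Union bounds for inner probabilities, and tail bounds for real and complex Gaussian
  forms\<close>

lemma with_prob_ge_mono:
  assumes "with_prob_ge M p P" "q \<le> p" "\<And>\<omega>. \<omega> \<in> space M \<Longrightarrow> P \<omega> \<Longrightarrow> Q \<omega>"
  shows "with_prob_ge M q Q"
  using assms unfolding with_prob_ge_def by (meson order_trans sets.sets_into_space subsetD)

lemma (in prob_space) with_prob_ge_conj:
  assumes "with_prob_ge M (1 - a) P" "with_prob_ge M (1 - b) Q"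
  shows "with_prob_ge M (1 - (a + b)) (\<lambda>\<omega>. P \<omega> \<and> Q \<omega>)"
proof -
  obtain A B where A: "A \<in> events" "\<forall>\<omega>\<in>A. P \<omega>" "1 - a \<le> prob A"
    and B: "B \<in> events" "\<forall>\<omega>\<in>B. Q \<omega>" "1 - b \<le> prob B"
    using assms unfolding with_prob_ge_def by blast
  have "prob (A \<union> B) = prob A + prob (B - A)" using A B by (intro finite_measure_Union') auto
  moreover have "prob B = prob (A \<inter> B) + prob (B - A)"
    using A B by (subst finite_measure_Union[symmetric]) (auto intro!: arg_cong[where f = prob])
  moreover have "prob (A \<union> B) \<le> 1" by (rule prob_le_1)
  ultimately have "1 - (a + b) \<le> prob (A \<inter> B)" using A B by linarith
  then show ?thesis using A B unfolding with_prob_ge_def by (intro bexI[of _ "A \<inter> B"]) auto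
qed

lemma (in prob_space) with_prob_ge_ball:
  assumes "finite K" "\<And>k. k \<in> K \<Longrightarrow> with_prob_ge M (1 - a) (P k)"
  shows "with_prob_ge M (1 - real (card K) * a) (\<lambda>\<omega>. \<forall>k\<in>K. P k \<omega>)"
  using assms
proof (induction rule: finite_induct)
  case empty
  show ?case unfolding with_prob_ge_def by (intro bexI[of _ "space M"]) (auto simp: prob_space)
next
  case (insert k K)
  have "with_prob_ge M (1 - (a + real (card K) * a)) (\<lambda>\<omega>. P k \<omega> \<and> (\<forall>k\<in>K. P k \<omega>))"
    using insert by (intro with_prob_ge_conj) auto
  then show ?case using insert.hyps by (simp add: distrib_right)
qed

text \<open>A Hanson-Wright inequality obtained from Markov's inequality for exp (l Y) with one
  fixed \<open>l\<close> instead of an optimized one. The squared Frobenius norm therefore enters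
  divided by \<beta>. In the applications this costs only constants: there \<beta> is itself a
  Frobenius bound, or the trace dominates.\<close>

lemma (in prob_space) std_normal_quadratic_form_tail:
  fixes b :: "'i \<Rightarrow> 'i \<Rightarrow> real" and X :: "'i \<Rightarrow> 'a \<Rightarrow> real"
  assumes J: "finite J" "J \<noteq> {}"
    and indep: "indep_vars (\<lambda>_. borel) X J"
    and std: "\<And>j. j \<in> J \<Longrightarrow> distributed M lborel (X j) std_normal_density"
    and \<beta>: "\<beta> > 0"
    and bound: "\<And>x. \<bar>\<Sum>j\<in>J. \<Sum>k\<in>J. b j k * x j * x k\<bar> \<le> \<beta> * (\<Sum>j\<in>J. (x j)\<^sup>2)"
    and \<delta>: "\<delta> > 0"
  shows "with_prob_ge M (1 - \<delta>) (\<lambda>\<omega>. (\<Sum>j\<in>J. \<Sum>k\<in>J. b j k * X j \<omega> * X k \<omega>)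
    \<le> (\<Sum>j\<in>J. b j j) + (\<Sum>j\<in>J. \<Sum>k\<in>J. (b j k)\<^sup>2) / (4 * \<beta>) + 16 * \<beta> * ln (1 / \<delta>))"
proof -
  have X[measurable]: "j \<in> J \<Longrightarrow> X j \<in> borel_measurable M" for j
    using indep by (auto simp: indep_vars_def)
  \<comment> \<open>The largest scaling for which the hypothesis with bound 1/16 in
    \<open>nn_integral_exp_quadratic_form\<close> is guaranteed.\<close>
  define l where "l = 1 / (16 * \<beta>)"
  define Q where "Q x = (\<Sum>j\<in>J. \<Sum>k\<in>J. b j k * x j * x k)" for x :: "'i \<Rightarrow> real"
  define F where "F = (\<Sum>j\<in>J. \<Sum>k\<in>J. (b j k)\<^sup>2)"
  define T where "T = (\<Sum>j\<in>J. b j j) + F / (4 * \<beta>) + 16 * \<beta> * ln (1 / \<delta>)"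
  define Y where "Y \<omega> = Q (\<lambda>j. X j \<omega>)" for \<omega>
  have l: "l > 0" using \<beta> by (simp add: l_def)
  have Y[measurable]: "Y \<in> borel_measurable M" unfolding Y_def Q_def by measurable
  have distr: "distr M (\<Pi>\<^sub>M j\<in>J. borel) (\<lambda>\<omega>. \<lambda>j\<in>J. X j \<omega>) = Pi\<^sub>M J (\<lambda>_. std_gauss)"
  proof -
    have "distr M borel (X j) = std_gauss" if "j \<in> J" for j
      using distributed_distr_eq_density[OF std[OF that]] by (simp cong: distr_cong)
    then show ?thesis
      using indep_vars_iff_distr_eq_PiM'[where X = X and M' = "\<lambda>_. borel", OF J(2)] X indep
      by (simp cong: PiM_cong)
  qed
  have "(\<integral>\<^sup>+\<omega>. ennreal (exp (l * Y \<omega>)) \<partial>M)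
      = (\<integral>\<^sup>+x. ennreal (exp (l * Q x)) \<partial>distr M (\<Pi>\<^sub>M j\<in>J. borel) (\<lambda>\<omega>. \<lambda>j\<in>J. X j \<omega>))"
    unfolding Q_def by (subst nn_integral_distr) (auto simp: Y_def Q_def cong: sum.cong)
  also have "\<dots> = (\<integral>\<^sup>+x. ennreal (exp (\<Sum>j\<in>J. \<Sum>k\<in>J. (l * b j k) * x j * x k)) \<partial>Pi\<^sub>M J (\<lambda>_. std_gauss))"
    unfolding distr by (simp add: Q_def sum_distrib_left mult.assoc)
  also have "\<dots> \<le> ennreal (exp ((\<Sum>j\<in>J. l * b j j) + 4 * (\<Sum>j\<in>J. \<Sum>k\<in>J. (l * b j k)\<^sup>2)))"
  proof (rule nn_integral_exp_quadratic_form[OF J(1)])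
    fix x
    have "\<bar>\<Sum>j\<in>J. \<Sum>k\<in>J. l * b j k * x j * x k\<bar> = l * \<bar>Q x\<bar>"
      using l by (simp only: Q_def mult.assoc sum_distrib_left[symmetric] abs_mult abs_of_pos)
    also have "\<dots> \<le> l * (\<beta> * (\<Sum>j\<in>J. (x j)\<^sup>2))"
      using bound[of x] l by (intro mult_left_mono) (auto simp: Q_def)
    also have "\<dots> = (\<Sum>j\<in>J. (x j)\<^sup>2) / 16" using \<beta> by (simp add: l_def)
    finally show "\<bar>\<Sum>j\<in>J. \<Sum>k\<in>J. l * b j k * x j * x k\<bar> \<le> (\<Sum>j\<in>J. (x j)\<^sup>2) / 16" .
  qed
  also have "(\<Sum>j\<in>J. l * b j j) + 4 * (\<Sum>j\<in>J. \<Sum>k\<in>J. (l * b j k)\<^sup>2) = l * T + ln \<delta>"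
  proof -
    have "(\<Sum>j\<in>J. \<Sum>k\<in>J. (l * b j k)\<^sup>2) = l\<^sup>2 * F"
      by (simp add: F_def power_mult_distrib sum_distrib_left)
    moreover have "4 * (l\<^sup>2 * F) = l * (F / (4 * \<beta>))"
      using \<beta> by (simp add: l_def power2_eq_square)
    moreover have "l * (16 * \<beta> * ln (1 / \<delta>)) = - ln \<delta>"
      using \<beta> \<delta> by (simp add: l_def ln_div)
    ultimately show ?thesis by (simp add: T_def distrib_left sum_distrib_left)
  qed
  finally have mgf: "(\<integral>\<^sup>+\<omega>. ennreal (exp (l * Y \<omega>)) \<partial>M) \<le> ennreal (exp (l * T + ln \<delta>))" .
  define A where "A = {\<omega> \<in> space M. Y \<omega> \<le> T}"
  have A[measurable]: "A \<in> events" unfolding A_def by measurable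
  have "emeasure M (space M - A) \<le> emeasure M {\<omega> \<in> space M. 1 \<le> ennreal (exp (- l * T)) * ennreal (exp (l * Y \<omega>))}"
    using l by (intro emeasure_mono) (auto simp: A_def ennreal_mult[symmetric] mult_exp_exp)
  also have "\<dots> \<le> ennreal (exp (- l * T)) * (\<integral>\<^sup>+\<omega>. ennreal (exp (l * Y \<omega>)) * indicator (space M) \<omega> \<partial>M)"
    by (rule nn_integral_Markov_inequality) auto
  also have "\<dots> \<le> ennreal (exp (- l * T)) * ennreal (exp (l * T + ln \<delta>))"
    by (intro mult_left_mono order_trans[OF _ mgf]) (auto intro!: nn_integral_mono simp: indicator_def)
  also have "\<dots> = ennreal \<delta>" using \<delta> by (simp add: ennreal_mult[symmetric] mult_exp_exp)
  finally have "prob (space M - A) \<le> \<delta>" using \<delta> by (simp add: emeasure_eq_measure)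
  then have "1 - \<delta> \<le> prob A" using prob_compl[OF A] by simp
  then show ?thesis unfolding with_prob_ge_def using A
    by (intro bexI[of _ A]) (auto simp: A_def Y_def Q_def T_def F_def)
qed

text \<open>Splitting each variable into real and imaginary part gives a real form in twice as many
  independent standard normals. Its trace is twice the real part of the complex trace, and its
  squared Frobenius norm is twice the complex one.\<close>

lemma (in prob_space) complex_gaussian_quadratic_form_tail:
  fixes B :: "int \<Rightarrow> int \<Rightarrow> complex"
  assumes I: "finite I" "I \<noteq> {}"
    and iid: "iid_std_complex_gaussian M I \<zeta>"
    and \<beta>: "\<beta> > 0"
    and bound: "\<And>z. \<bar>Re (\<Sum>s\<in>I. \<Sum>t\<in>I. cnj (z s) * B s t * z t)\<bar> \<le> \<beta> * (\<Sum>t\<in>I. (cmod (z t))\<^sup>2)"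
    and \<delta>: "\<delta> > 0"
  shows "with_prob_ge M (1 - \<delta>) (\<lambda>\<omega>. Re (\<Sum>s\<in>I. \<Sum>t\<in>I. cnj (\<zeta> s \<omega>) * B s t * \<zeta> t \<omega>)
    \<le> 2 * Re (\<Sum>t\<in>I. B t t) + (\<Sum>s\<in>I. \<Sum>t\<in>I. (cmod (B s t))\<^sup>2) / (2 * \<beta>) + 16 * \<beta> * ln (1 / \<delta>))"
proof -
  define u where "u p = (if p then 1 else \<i>)" for p
  define b where "b j k = Re (cnj (u (snd j)) * B (fst j) (fst k) * u (snd k))" for j k
  define X where "X = (\<lambda>(\<tau>, re) \<omega>. if re then Re (\<zeta> \<tau> \<omega>) else Im (\<zeta> \<tau> \<omega>))"
  let ?J = "I \<times> (UNIV :: bool set)"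
  have split: "(\<Sum>j\<in>?J. f j) = (\<Sum>s\<in>I. f (s, True) + f (s, False))" for f :: "int \<times> bool \<Rightarrow> real"
    by (simp add: sum.cartesian_product' UNIV_bool add.commute)
  have form: "(\<Sum>j\<in>?J. \<Sum>k\<in>?J. b j k * x j * x k)
      = Re (\<Sum>s\<in>I. \<Sum>t\<in>I. cnj (Complex (x (s, True)) (x (s, False))) * B s t * Complex (x (t, True)) (x (t, False)))"
    for x
    unfolding split by (simp add: b_def u_def sum.distrib[symmetric] algebra_simps)
  have "with_prob_ge M (1 - \<delta>) (\<lambda>\<omega>. (\<Sum>j\<in>?J. \<Sum>k\<in>?J. b j k * X j \<omega> * X k \<omega>)
    \<le> (\<Sum>j\<in>?J. b j j) + (\<Sum>j\<in>?J. \<Sum>k\<in>?J. (b j k)\<^sup>2) / (4 * \<beta>) + 16 * \<beta> * ln (1 / \<delta>))"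
  proof (rule std_normal_quadratic_form_tail[OF _ _ _ _ \<beta> _ \<delta>])
    show "\<bar>\<Sum>j\<in>?J. \<Sum>k\<in>?J. b j k * x j * x k\<bar> \<le> \<beta> * (\<Sum>j\<in>?J. (x j)\<^sup>2)" for x
      using bound[of "\<lambda>s. Complex (x (s, True)) (x (s, False))"]
      unfolding form by (simp add: split cmod_power2)
    show "distributed M lborel (X j) std_normal_density" if "j \<in> ?J" for j
      using iid that by (cases j; cases "snd j") (simp_all add: iid_std_complex_gaussian_def X_def)
  qed (use I iid in \<open>auto simp: iid_std_complex_gaussian_def X_def\<close>)
  moreover have "(\<Sum>j\<in>?J. b j j) = 2 * Re (\<Sum>t\<in>I. B t t)"
    unfolding split by (simp add: b_def u_def sum_distrib_left)
  moreover have "(\<Sum>j\<in>?J. \<Sum>k\<in>?J. (b j k)\<^sup>2) = 2 * (\<Sum>s\<in>I. \<Sum>t\<in>I. (cmod (B s t))\<^sup>2)"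
    unfolding split by (simp add: b_def u_def sum_distrib_left sum.distrib[symmetric] cmod_power2 add_ac)
  ultimately show ?thesis unfolding form by (simp add: X_def)
qed

lemma sum_mult_le_frobenius:
  fixes B :: "'i \<Rightarrow> 'j \<Rightarrow> complex"
  assumes "finite I" "finite J"
  shows "cmod (\<Sum>s\<in>I. \<Sum>t\<in>J. cnj (v s) * B s t * z t)
    \<le> sqrt (\<Sum>s\<in>I. \<Sum>t\<in>J. (cmod (B s t))\<^sup>2) * (sqrt (\<Sum>s\<in>I. (cmod (v s))\<^sup>2) * sqrt (\<Sum>t\<in>J. (cmod (z t))\<^sup>2))"
proof -
  have "cmod (\<Sum>s\<in>I. \<Sum>t\<in>J. cnj (v s) * B s t * z t) = cmod (\<Sum>p\<in>I \<times> J. cnj (v (fst p)) * B (fst p) (snd p) * z (snd p))"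
    by (simp add: sum.cartesian_product case_prod_beta)
  also have "\<dots> \<le> (\<Sum>p\<in>I \<times> J. \<bar>cmod (B (fst p) (snd p))\<bar> * \<bar>cmod (v (fst p)) * cmod (z (snd p))\<bar>)"
    by (rule order_trans[OF norm_sum]) (simp add: norm_mult mult_ac)
  also have "\<dots> \<le> L2_set (\<lambda>p. cmod (B (fst p) (snd p))) (I \<times> J) * L2_set (\<lambda>p. cmod (v (fst p)) * cmod (z (snd p))) (I \<times> J)"
    by (rule L2_set_mult_ineq)
  also have "\<dots> = sqrt (\<Sum>s\<in>I. \<Sum>t\<in>J. (cmod (B s t))\<^sup>2) * (sqrt (\<Sum>s\<in>I. (cmod (v s))\<^sup>2) * sqrt (\<Sum>t\<in>J. (cmod (z t))\<^sup>2))"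
    by (simp add: L2_set_def sum.cartesian_product' power_mult_distrib sum_product real_sqrt_mult[symmetric])
  finally show ?thesis .
qed

text \<open>The modulus is controlled through the real parts of the form multiplied by 1, -1, i and
  -i. This explains the failure probability \<open>4 * \<delta>\<close> and, since |Z| \<le> |Re Z|
  + |Im Z|, the doubled right-hand side. The Frobenius bound \<open>F\<close> also serves as the
  bound \<beta> on the form.\<close>

lemma (in prob_space) complex_gaussian_sesquilinear_tail:
  fixes B :: "int \<Rightarrow> int \<Rightarrow> complex"
  assumes I: "finite I" "I \<noteq> {}"
    and iid: "iid_std_complex_gaussian M I \<zeta>"
    and F: "F > 0" "(\<Sum>s\<in>I. \<Sum>t\<in>I. (cmod (B s t))\<^sup>2) \<le> F\<^sup>2"
    and \<delta>: "\<delta> > 0"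
  shows "with_prob_ge M (1 - 4 * \<delta>) (\<lambda>\<omega>. cmod (\<Sum>s\<in>I. \<Sum>t\<in>I. cnj (\<zeta> s \<omega>) * B s t * \<zeta> t \<omega>)
    \<le> 4 * cmod (\<Sum>t\<in>I. B t t) + F * (1 + 32 * ln (1 / \<delta>)))"
proof -
  define Z where "Z \<omega> = (\<Sum>s\<in>I. \<Sum>t\<in>I. cnj (\<zeta> s \<omega>) * B s t * \<zeta> t \<omega>)" for \<omega>
  define D where "D = 2 * cmod (\<Sum>t\<in>I. B t t) + F / 2 + 16 * F * ln (1 / \<delta>)"
  have *: "with_prob_ge M (1 - \<delta>) (\<lambda>\<omega>. Re (c * Z \<omega>) \<le> D)" if c: "cmod c = 1" for c
  proof -
    have "with_prob_ge M (1 - \<delta>) (\<lambda>\<omega>. Re (\<Sum>s\<in>I. \<Sum>t\<in>I. cnj (\<zeta> s \<omega>) * (c * B s t) * \<zeta> t \<omega>)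
      \<le> 2 * Re (\<Sum>t\<in>I. c * B t t) + (\<Sum>s\<in>I. \<Sum>t\<in>I. (cmod (c * B s t))\<^sup>2) / (2 * F) + 16 * F * ln (1 / \<delta>))"
    proof (rule complex_gaussian_quadratic_form_tail[OF I iid F(1) _ \<delta>])
      fix z :: "int \<Rightarrow> complex"
      have "\<bar>Re (\<Sum>s\<in>I. \<Sum>t\<in>I. cnj (z s) * (c * B s t) * z t)\<bar>
          \<le> cmod (\<Sum>s\<in>I. \<Sum>t\<in>I. cnj (z s) * (c * B s t) * z t)" by (rule abs_Re_le_cmod)
      also have "\<dots> \<le> sqrt (\<Sum>s\<in>I. \<Sum>t\<in>I. (cmod (c * B s t))\<^sup>2) * (\<Sum>t\<in>I. (cmod (z t))\<^sup>2)"
        using sum_mult_le_frobenius[OF I(1) I(1), of z "\<lambda>s t. c * B s t" z]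
        by (simp add: sum_nonneg)
      also have "\<dots> \<le> F * (\<Sum>t\<in>I. (cmod (z t))\<^sup>2)"
        using F c by (intro mult_right_mono sum_nonneg real_le_lsqrt) (auto simp: norm_mult)
      finally show "\<bar>Re (\<Sum>s\<in>I. \<Sum>t\<in>I. cnj (z s) * (c * B s t) * z t)\<bar> \<le> F * (\<Sum>t\<in>I. (cmod (z t))\<^sup>2)" .
    qed
    moreover have "(\<Sum>s\<in>I. \<Sum>t\<in>I. cnj (\<zeta> s \<omega>) * (c * B s t) * \<zeta> t \<omega>) = c * Z \<omega>" for \<omega>
      by (simp add: Z_def sum_distrib_left mult_ac)
    moreover have "2 * Re (\<Sum>t\<in>I. c * B t t) + (\<Sum>s\<in>I. \<Sum>t\<in>I. (cmod (c * B s t))\<^sup>2) / (2 * F) + 16 * F * ln (1 / \<delta>) \<le> D"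
    proof -
      have "Re (\<Sum>t\<in>I. c * B t t) \<le> cmod (\<Sum>t\<in>I. B t t)"
        using complex_Re_le_cmod[of "c * (\<Sum>t\<in>I. B t t)"] c
        by (simp only: norm_mult sum_distrib_left[symmetric] mult_1)
      moreover have "(\<Sum>s\<in>I. \<Sum>t\<in>I. (cmod (c * B s t))\<^sup>2) / (2 * F) \<le> F / 2"
        using F c by (simp add: norm_mult divide_le_eq power2_eq_square)
      ultimately show ?thesis by (simp add: D_def)
    qed
    ultimately show ?thesis by (elim with_prob_ge_mono) auto
  qed
  have "with_prob_ge M (1 - ((\<delta> + \<delta>) + (\<delta> + \<delta>))) (\<lambda>\<omega>. (Re (1 * Z \<omega>) \<le> D \<and> Re ((-1) * Z \<omega>) \<le> D)
      \<and> (Re (\<i> * Z \<omega>) \<le> D \<and> Re ((-\<i>) * Z \<omega>) \<le> D))"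
    by (intro with_prob_ge_conj *) auto
  then show ?thesis
  proof (rule with_prob_ge_mono)
    fix \<omega>
    assume "(Re (1 * Z \<omega>) \<le> D \<and> Re ((-1) * Z \<omega>) \<le> D) \<and> (Re (\<i> * Z \<omega>) \<le> D \<and> Re ((-\<i>) * Z \<omega>) \<le> D)"
    then have "\<bar>Re (Z \<omega>)\<bar> \<le> D" "\<bar>Im (Z \<omega>)\<bar> \<le> D" by auto
    then have "cmod (Z \<omega>) \<le> 2 * D" using cmod_le[of "Z \<omega>"] by linarith
    then show "cmod (\<Sum>s\<in>I. \<Sum>t\<in>I. cnj (\<zeta> s \<omega>) * B s t * \<zeta> t \<omega>)
      \<le> 4 * cmod (\<Sum>t\<in>I. B t t) + F * (1 + 32 * ln (1 / \<delta>))"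
      by (simp add: Z_def D_def algebra_simps)
  qed simp
qed

text \<open>Duality: with \<open>h\<close> the adjoint applied to \<open>v\<close>, the squared norm
  \<open>H\<close> of \<open>h\<close> equals the pairing of \<open>G h\<close> with
  \<open>v\<close>, so Cauchy-Schwarz bounds \<open>H\<close> by
  \<open>sqrt (\<beta> * H) * sqrt V\<close>, and one factor \<open>sqrt H\<close> cancels.\<close>

lemma norm_adjoint_le:
  fixes G :: "'r \<Rightarrow> 'i \<Rightarrow> complex"
  assumes \<beta>: "\<beta> \<ge> 0"
    and G: "\<And>z. (\<Sum>r\<in>R. (cmod (\<Sum>t\<in>I. G r t * z t))\<^sup>2) \<le> \<beta> * (\<Sum>t\<in>I. (cmod (z t))\<^sup>2)"
  shows "(\<Sum>s\<in>I. (cmod (\<Sum>r\<in>R. cnj (G r s) * v r))\<^sup>2) \<le> \<beta> * (\<Sum>r\<in>R. (cmod (v r))\<^sup>2)"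
proof -
  define h where "h s = (\<Sum>r\<in>R. cnj (G r s) * v r)" for s
  define H where "H = (\<Sum>s\<in>I. (cmod (h s))\<^sup>2)"
  define V where "V = (\<Sum>r\<in>R. (cmod (v r))\<^sup>2)"
  have H: "H \<ge> 0" and V: "V \<ge> 0" by (auto simp: H_def V_def sum_nonneg)
  have h: "cnj a * h s = (\<Sum>r\<in>R. cnj (G r s * a) * v r)" for a s
    by (simp add: h_def sum_distrib_left mult_ac)
  have "complex_of_real H = (\<Sum>s\<in>I. cnj (h s) * h s)"
    by (simp only: H_def of_real_sum complex_norm_square mult.commute)
  also have "\<dots> = (\<Sum>s\<in>I. \<Sum>r\<in>R. cnj (G r s * h s) * v r)"
    by (intro sum.cong refl h)
  also have "\<dots> = (\<Sum>r\<in>R. cnj (\<Sum>s\<in>I. G r s * h s) * v r)"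
    by (subst sum.swap) (simp add: sum_distrib_right)
  finally have "H = cmod (\<Sum>r\<in>R. cnj (\<Sum>s\<in>I. G r s * h s) * v r)"
    using H by (metis abs_of_nonneg norm_of_real)
  also have "\<dots> \<le> (\<Sum>r\<in>R. \<bar>cmod (\<Sum>s\<in>I. G r s * h s)\<bar> * \<bar>cmod (v r)\<bar>)"
    by (rule order_trans[OF norm_sum]) (simp only: norm_mult complex_mod_cnj abs_norm_cancel order_refl)
  also have "\<dots> \<le> L2_set (\<lambda>r. cmod (\<Sum>s\<in>I. G r s * h s)) R * L2_set (\<lambda>r. cmod (v r)) R"
    by (rule L2_set_mult_ineq)
  also have "\<dots> \<le> sqrt (\<beta> * H) * sqrt V"
    unfolding L2_set_def H_def V_def by (intro mult_right_mono real_sqrt_le_mono G) (simp add: sum_nonneg)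
  finally have "H \<le> sqrt (\<beta> * H * V)" by (simp add: real_sqrt_mult)
  then have "H\<^sup>2 \<le> (sqrt (\<beta> * H * V))\<^sup>2" using H by (intro power_mono) auto
  then have "H * H \<le> (\<beta> * V) * H"
    using H V \<beta> by (simp add: power2_eq_square mult_ac)
  moreover have "0 \<le> \<beta> * V" using V \<beta> by simp
  ultimately have "H \<le> \<beta> * V" using H by (cases "H = 0") (auto simp: mult_le_cancel_right)
  then show ?thesis by (simp add: h_def H_def V_def)
qed

text \<open>The squared norm is the quadratic form of G* G. Its trace is the squared Frobenius norm
  of \<open>G\<close>. Its columns are the adjoint applied to the columns of \<open>G\<close>, so
  its squared Frobenius norm is at most \<open>\<beta> * D\<close>. Hence 5/2 = 2 + 1/2, and the
  logarithm multiplies \<beta> rather than \<open>D\<close>.\<close>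

lemma (in prob_space) complex_gaussian_norm_tail:
  fixes G :: "'r \<Rightarrow> int \<Rightarrow> complex"
  assumes I: "finite I" "I \<noteq> {}"
    and iid: "iid_std_complex_gaussian M I \<zeta>"
    and \<beta>: "\<beta> > 0"
    and G: "\<And>z. (\<Sum>r\<in>R. (cmod (\<Sum>t\<in>I. G r t * z t))\<^sup>2) \<le> \<beta> * (\<Sum>t\<in>I. (cmod (z t))\<^sup>2)"
    and D: "(\<Sum>r\<in>R. \<Sum>t\<in>I. (cmod (G r t))\<^sup>2) \<le> D"
    and \<delta>: "\<delta> > 0"
  shows "with_prob_ge M (1 - \<delta>) (\<lambda>\<omega>. (\<Sum>r\<in>R. (cmod (\<Sum>t\<in>I. G r t * \<zeta> t \<omega>))\<^sup>2)
    \<le> 5 / 2 * D + 16 * \<beta> * ln (1 / \<delta>))"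
proof -
  define B where "B s t = (\<Sum>r\<in>R. cnj (G r s) * G r t)" for s t
  have form: "Re (\<Sum>s\<in>I. \<Sum>t\<in>I. cnj (z s) * B s t * z t) = (\<Sum>r\<in>R. (cmod (\<Sum>t\<in>I. G r t * z t))\<^sup>2)" for z
  proof -
    have "(\<Sum>s\<in>I. \<Sum>t\<in>I. cnj (z s) * B s t * z t)
        = (\<Sum>s\<in>I. \<Sum>t\<in>I. \<Sum>r\<in>R. cnj (G r s * z s) * (G r t * z t))"
      by (simp add: B_def sum_distrib_left sum_distrib_right mult_ac)
    also have "\<dots> = (\<Sum>s\<in>I. \<Sum>r\<in>R. \<Sum>t\<in>I. cnj (G r s * z s) * (G r t * z t))"
      by (intro sum.cong refl sum.swap)
    also have "\<dots> = (\<Sum>r\<in>R. \<Sum>s\<in>I. \<Sum>t\<in>I. cnj (G r s * z s) * (G r t * z t))"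
      by (rule sum.swap)
    also have "\<dots> = (\<Sum>r\<in>R. cnj (\<Sum>t\<in>I. G r t * z t) * (\<Sum>t\<in>I. G r t * z t))"
      by (simp only: cnj_sum sum_product)
    also have "\<dots> = (\<Sum>r\<in>R. complex_of_real ((cmod (\<Sum>t\<in>I. G r t * z t))\<^sup>2))"
      by (intro sum.cong refl) (simp only: complex_norm_square mult.commute)
    finally show ?thesis by simp
  qed
  have tr: "Re (\<Sum>t\<in>I. B t t) = (\<Sum>r\<in>R. \<Sum>t\<in>I. (cmod (G r t))\<^sup>2)"
    unfolding cmod_power2 by (subst sum.swap) (simp add: B_def power2_eq_square)
  have fr: "(\<Sum>s\<in>I. \<Sum>t\<in>I. (cmod (B s t))\<^sup>2) \<le> \<beta> * D"
  proof -
    have "(\<Sum>s\<in>I. \<Sum>t\<in>I. (cmod (B s t))\<^sup>2) = (\<Sum>t\<in>I. \<Sum>s\<in>I. (cmod (B s t))\<^sup>2)" by (rule sum.swap)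
    also have "\<dots> \<le> (\<Sum>t\<in>I. \<beta> * (\<Sum>r\<in>R. (cmod (G r t))\<^sup>2))"
      unfolding B_def using \<beta> by (intro sum_mono norm_adjoint_le G) simp
    also have "\<dots> = \<beta> * (\<Sum>r\<in>R. \<Sum>t\<in>I. (cmod (G r t))\<^sup>2)"
      by (subst sum.swap) (simp add: sum_distrib_left)
    also have "\<dots> \<le> \<beta> * D" using \<beta> D by (intro mult_left_mono) auto
    finally show ?thesis .
  qed
  have "with_prob_ge M (1 - \<delta>) (\<lambda>\<omega>. Re (\<Sum>s\<in>I. \<Sum>t\<in>I. cnj (\<zeta> s \<omega>) * B s t * \<zeta> t \<omega>)
    \<le> 2 * Re (\<Sum>t\<in>I. B t t) + (\<Sum>s\<in>I. \<Sum>t\<in>I. (cmod (B s t))\<^sup>2) / (2 * \<beta>) + 16 * \<beta> * ln (1 / \<delta>))"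
    by (rule complex_gaussian_quadratic_form_tail[OF I iid \<beta> _ \<delta>])
      (use G in \<open>simp only: form abs_of_nonneg sum_nonneg zero_le_power2\<close>)
  moreover have "(\<Sum>s\<in>I. \<Sum>t\<in>I. (cmod (B s t))\<^sup>2) / (2 * \<beta>) \<le> D / 2"
    using fr \<beta> by (simp add: field_simps)
  ultimately show ?thesis
    unfolding form tr by (elim with_prob_ge_mono) (use D in auto)
qed

text \<open>The cruder choice \<beta> = \<open>D\<close>, justified by Cauchy-Schwarz in each row,
  for families of which only the Frobenius norm is known.\<close>

lemma (in prob_space) complex_gaussian_norm_tail':
  fixes G :: "'r \<Rightarrow> int \<Rightarrow> complex"
  assumes I: "finite I" "I \<noteq> {}" and R: "finite R"
    and iid: "iid_std_complex_gaussian M I \<zeta>"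
    and D: "(\<Sum>r\<in>R. \<Sum>t\<in>I. (cmod (G r t))\<^sup>2) \<le> D"
    and \<delta>: "\<delta> > 0"
  shows "with_prob_ge M (1 - \<delta>) (\<lambda>\<omega>. (\<Sum>r\<in>R. (cmod (\<Sum>t\<in>I. G r t * \<zeta> t \<omega>))\<^sup>2)
    \<le> D * (5 / 2 + 16 * ln (1 / \<delta>)))"
proof (cases "D > 0")
  case True
  have "(\<Sum>r\<in>R. (cmod (\<Sum>t\<in>I. G r t * z t))\<^sup>2) \<le> D * (\<Sum>t\<in>I. (cmod (z t))\<^sup>2)" for z
  proof -
    have "(cmod (\<Sum>t\<in>I. G r t * z t))\<^sup>2 \<le> (\<Sum>t\<in>I. (cmod (G r t))\<^sup>2) * (\<Sum>t\<in>I. (cmod (z t))\<^sup>2)" for r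
    proof -
      have "cmod (\<Sum>t\<in>I. G r t * z t) \<le> sqrt (\<Sum>t\<in>I. (cmod (G r t))\<^sup>2) * sqrt (\<Sum>t\<in>I. (cmod (z t))\<^sup>2)"
        using sum_mult_le_frobenius[of "{()}" I "\<lambda>_. 1" "\<lambda>_. G r" z] I by simp
      then have "(cmod (\<Sum>t\<in>I. G r t * z t))\<^sup>2 \<le> (sqrt (\<Sum>t\<in>I. (cmod (G r t))\<^sup>2) * sqrt (\<Sum>t\<in>I. (cmod (z t))\<^sup>2))\<^sup>2"
        by (intro power_mono) auto
      then show ?thesis by (simp add: power_mult_distrib sum_nonneg)
    qed
    then have "(\<Sum>r\<in>R. (cmod (\<Sum>t\<in>I. G r t * z t))\<^sup>2)
        \<le> (\<Sum>r\<in>R. (\<Sum>t\<in>I. (cmod (G r t))\<^sup>2) * (\<Sum>t\<in>I. (cmod (z t))\<^sup>2))"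
      by (intro sum_mono)
    also have "\<dots> = (\<Sum>r\<in>R. \<Sum>t\<in>I. (cmod (G r t))\<^sup>2) * (\<Sum>t\<in>I. (cmod (z t))\<^sup>2)"
      by (simp add: sum_distrib_right)
    also have "\<dots> \<le> D * (\<Sum>t\<in>I. (cmod (z t))\<^sup>2)"
      using D by (intro mult_right_mono sum_nonneg) auto
    finally show ?thesis .
  qed
  from complex_gaussian_norm_tail[OF I iid True this D \<delta>] show ?thesis
    by (elim with_prob_ge_mono) (auto simp: algebra_simps)
next
  \<comment> \<open>The previous bound requires \<beta> > 0. If \<open>D\<close> is not positive it
    is 0, so all coefficients vanish and the whole space serves as the event.\<close>
  case False
  have "0 \<le> (\<Sum>r\<in>R. \<Sum>t\<in>I. (cmod (G r t))\<^sup>2)" by (intro sum_nonneg) simp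
  with D False have D0: "D = 0" and "(\<Sum>r\<in>R. \<Sum>t\<in>I. (cmod (G r t))\<^sup>2) = 0" by auto
  then have "G r t = 0" if "r \<in> R" "t \<in> I" for r t
    using that R I by (simp add: sum_nonneg_eq_0_iff sum_nonneg)
  then show ?thesis using \<delta> D0 unfolding with_prob_ge_def
    by (intro bexI[of _ "space M"]) (auto simp: prob_space)
qed

section \<open>Roots of unity and the Dirichlet kernel\<close>

definition unit_root :: "nat \<Rightarrow> int \<Rightarrow> complex" where
  "unit_root q j = cis (2 * pi * real_of_int j / real q)"

lemma unit_root_add: "unit_root q (i + j) = unit_root q i * unit_root q j"
  by (simp add: unit_root_def cis_mult add_divide_distrib ring_distribs)

lemma unit_root_diff: "unit_root q (k * (i - j)) = unit_root q (k * i) * unit_root q (- (k * j))"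
  by (simp add: unit_root_add[symmetric] right_diff_distrib)

lemma cnj_unit_root: "cnj (unit_root q j) = unit_root q (- j)"
  by (simp add: unit_root_def cis_cnj)

lemma norm_unit_root [simp]: "cmod (unit_root q j) = 1"
  by (simp add: unit_root_def)

lemma unit_root_0 [simp]: "unit_root q 0 = 1"
  by (simp add: unit_root_def)

lemma unit_root_of_nat_mult: "unit_root q (int k * d) = unit_root q d ^ k"
  by (induction k) (simp_all add: ring_distribs unit_root_add mult.commute)

lemma unit_root_eq_1_iff:
  assumes "q > 0"
  shows "unit_root q d = 1 \<longleftrightarrow> int q dvd d"
proof
  assume "unit_root q d = 1"
  then have "cos (2 * pi * real_of_int d / real q) = 1"
    by (simp add: unit_root_def complex_eq_iff)
  then obtain n :: int where "2 * pi * real_of_int d / real q = real_of_int n * 2 * pi"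
    unfolding cos_one_2pi_int by blast
  then have "real_of_int d = real_of_int (int q * n)" using assms by (simp add: field_simps)
  then show "int q dvd d" unfolding of_int_eq_iff by simp
next
  assume "int q dvd d"
  then obtain n where "d = int q * n" ..
  then show "unit_root q d = 1"
    using assms cis_multiple_2pi[of "real_of_int n"] by (simp add: unit_root_def mult.assoc)
qed

lemma sum_unit_root:
  assumes "q > 0"
  shows "(\<Sum>k = 1..q. unit_root q (int k * d)) = (if int q dvd d then of_nat q else 0)"
proof -
  define z where "z = unit_root q d"
  have eq: "(\<Sum>k = 1..q. unit_root q (int k * d)) = (\<Sum>k = 1..q. z ^ k)"
    by (simp add: z_def unit_root_of_nat_mult)
  show ?thesis
  proof (cases "int q dvd d")
    case True
    then have "z = 1" using unit_root_eq_1_iff[OF assms] by (simp add: z_def)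
    then show ?thesis unfolding eq using True by simp
  next
    case False
    then have z: "z \<noteq> 1" using unit_root_eq_1_iff[OF assms] by (simp add: z_def)
    have "z ^ q = unit_root q (int q * d)" by (simp add: z_def unit_root_of_nat_mult)
    then have zq: "z ^ q = 1" using unit_root_eq_1_iff[OF assms] by simp
    have "(1 - z) * (\<Sum>k = 1..q. z ^ k) = z - z ^ Suc q"
      using assms by (subst sum_gp_multiplied) auto
    then show ?thesis unfolding eq using z zq False by simp
  qed
qed

text \<open>These are the Fourier coefficients modulo \<open>N\<close> of the indicator of {-m..m};
  their mean modulus is the Lebesgue constant bounded in
  \<open>sum_norm_dirichlet_le\<close>.\<close>

definition dirichlet :: "nat \<Rightarrow> nat \<Rightarrow> int \<Rightarrow> complex" where
  "dirichlet m N j = (\<Sum>\<tau> = - int m..int m. unit_root N (- (j * \<tau>)))"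

text \<open>Fourier inversion modulo \<open>N\<close>. The hypothesis excludes aliasing: two indices
  \<open>d\<close> and \<tau> with |\<tau>| \<le> m that agree modulo \<open>N\<close> must
  coincide.\<close>

lemma sum_dirichlet:
  assumes "\<bar>d\<bar> + int m < int N"
  shows "(\<Sum>j = 1..N. dirichlet m N (int j) * unit_root N (int j * d))
    = (if \<bar>d\<bar> \<le> int m then of_nat N else 0)"
proof -
  have N: "N > 0" using assms by linarith
  have "(\<Sum>j = 1..N. dirichlet m N (int j) * unit_root N (int j * d))
      = (\<Sum>j = 1..N. \<Sum>\<tau> = - int m..int m. unit_root N (int j * (d - \<tau>)))"
    unfolding dirichlet_def sum_distrib_right
    by (intro sum.cong refl) (simp add: unit_root_add[symmetric] algebra_simps)
  also have "\<dots> = (\<Sum>\<tau> = - int m..int m. \<Sum>j = 1..N. unit_root N (int j * (d - \<tau>)))"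
    by (rule sum.swap)
  also have "\<dots> = (\<Sum>\<tau> = - int m..int m. if \<tau> = d then of_nat N else 0)"
  proof (rule sum.cong[OF refl])
    fix \<tau> assume "\<tau> \<in> {- int m..int m}"
    then have "\<bar>d - \<tau>\<bar> < int N" using assms by auto
    then have "int N dvd d - \<tau> \<longleftrightarrow> \<tau> = d"
      using dvd_imp_le_int[of "d - \<tau>" "int N"] by auto
    then show "(\<Sum>j = 1..N. unit_root N (int j * (d - \<tau>))) = (if \<tau> = d then of_nat N else 0)"
      using sum_unit_root[OF N] by simp
  qed
  also have "\<dots> = (if \<bar>d\<bar> \<le> int m then of_nat N else 0)"
    by (simp add: abs_le_iff)
  finally show ?thesis .
qed

text \<open>The geometric sum in product form, so that no division by zero has to be excluded. The
  right-hand side has modulus at most 2, which leaves the reciprocal of a sine as bound on the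
  kernel.\<close>

lemma dirichlet_telescope:
  "(1 - unit_root N (- j)) * dirichlet m N j = unit_root N (j * int m) - unit_root N (- (j * (int m + 1)))"
proof (induction m)
  case 0
  show ?case by (simp add: dirichlet_def)
next
  case (Suc m)
  have "{- int (Suc m)..int (Suc m)} = insert (int m + 1) (insert (- int m - 1) {- int m..int m})"
    by auto
  then have "dirichlet (Suc m) N j = dirichlet m N j + unit_root N (j * (int m + 1)) + unit_root N (- (j * (int m + 1)))"
    by (simp add: dirichlet_def algebra_simps)
  moreover have "unit_root N (- j) * unit_root N (j * (int m + 1)) = unit_root N (j * int m)"
    "unit_root N (- j) * unit_root N (- (j * (int m + 1))) = unit_root N (- (j * (int (Suc m) + 1)))"
    unfolding unit_root_add[symmetric] by (rule arg_cong[where f = "unit_root N"], simp add: algebra_simps)+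
  moreover have "int (Suc m) = int m + 1" by simp
  ultimately show ?case using Suc by (simp add: algebra_simps)
qed

text \<open>From sin x \<ge> x - x^3 / 6 and x \<le> 2. The factor 1/3 is weaker than in Jordan's
  inequality, but it is exactly what \<open>pi > 3\<close> compensates in
  \<open>norm_dirichlet_le\<close>.\<close>

lemma sin_ge_third:
  fixes x :: real
  assumes "0 \<le> x" "x \<le> pi / 2"
  shows "x / 3 \<le> sin x"
proof -
  have "x \<le> 2" using assms pi_less_4 by linarith
  then have "x\<^sup>2 \<le> 2\<^sup>2" using assms(1) by (intro power_mono)
  then have "x ^ 3 \<le> 4 * x"
    using assms(1) mult_right_mono[of "x\<^sup>2" 4 x] by (simp add: power3_eq_cube power2_eq_square)
  moreover have "\<bar>sin x - x\<bar> \<le> x ^ 3 / 6"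
  proof -
    have "(\<Sum>m<3. sin_coeff m * x ^ m) = x" by (simp add: sin_coeff_def eval_nat_numeral)
    moreover have "fact 3 = (6::real)" by (simp add: fact_numeral)
    ultimately show ?thesis
      using Maclaurin_sin_bound[of x 3] assms(1) by (simp only: abs_of_nonneg divide_inverse mult.commute[of "x ^ 3"])
  qed
  ultimately show ?thesis by linarith
qed

lemma norm_one_minus_unit_root: "cmod (1 - unit_root N j) = 2 * \<bar>sin (pi * real_of_int j / real N)\<bar>"
proof -
  define x where "x = pi * real_of_int j / real N"
  have "(cmod (1 - unit_root N j))\<^sup>2 = (1 - cos (2 * x))\<^sup>2 + (sin (2 * x))\<^sup>2"
    by (simp add: unit_root_def cmod_power2 x_def mult.assoc)
  also have "\<dots> = 2 - 2 * cos (2 * x)"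
    using sin_cos_squared_add[of "2 * x"] by (simp add: power2_eq_square algebra_simps)
  also have "\<dots> = (2 * \<bar>sin x\<bar>)\<^sup>2" by (simp add: cos_double_sin power2_eq_square)
  finally show ?thesis unfolding x_def[symmetric] by (rule power2_eq_imp_eq) auto
qed

text \<open>The kernel decays like the reciprocal of the cyclic distance from \<open>j\<close> to 0,
  with the reflection of \<open>j\<close> to \<open>N - j\<close> handling the upper half. The sum
  of both reciprocals replaces their maximum so that summation over \<open>j\<close> gives twice a
  harmonic sum.\<close>

lemma norm_dirichlet_le:
  assumes "0 < j" "j < N"
  shows "cmod (dirichlet m N (int j)) \<le> real N * (1 / real j + 1 / real (N - j))"
proof -
  have *: "1 / \<bar>sin (pi * real i / real N)\<bar> \<le> real N / real i" if i: "0 < i" "2 * i \<le> N" for i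
  proof -
    have "pi * real i / real N \<le> pi / 2" using i by (simp add: field_simps)
    then have "pi * real i / real N / 3 \<le> sin (pi * real i / real N)"
      using i by (intro sin_ge_third) auto
    moreover have "real i / real N \<le> pi * real i / real N / 3"
      using mult_right_mono[of 3 pi "real i / real N"] pi_gt3 by simp
    ultimately have le: "real i / real N \<le> \<bar>sin (pi * real i / real N)\<bar>" by linarith
    have pos: "0 < real i / real N" using i by simp
    have "1 / \<bar>sin (pi * real i / real N)\<bar> \<le> 1 / (real i / real N)"
      by (intro divide_left_mono mult_pos_pos le pos less_le_trans[OF pos le]) simp
    then show ?thesis by simp
  qed
  define S where "S = \<bar>sin (pi * real j / real N)\<bar>"
  have bd: "1 / S \<le> real N * (1 / real j + 1 / real (N - j))"
  proof (cases "2 * j \<le> N")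
    case True
    then have "1 / S \<le> real N / real j" using * assms by (simp add: S_def)
    also have "\<dots> \<le> real N * (1 / real j + 1 / real (N - j))" by (simp add: distrib_left)
    finally show ?thesis .
  next
    case False
    have "sin (pi * real (N - j) / real N) = sin (pi - pi * real j / real N)"
      using assms by (intro arg_cong[where f = sin]) (simp add: of_nat_diff field_simps)
    then have "S = \<bar>sin (pi * real (N - j) / real N)\<bar>" by (simp add: S_def)
    then have "1 / S \<le> real N / real (N - j)" using *[of "N - j"] False assms by simp
    also have "\<dots> \<le> real N * (1 / real j + 1 / real (N - j))" by (simp add: distrib_left)
    finally show ?thesis .
  qed
  have S0: "S \<noteq> 0"
  proof
    assume "S = 0"
    then have "1 - unit_root N (int j) = 0" using norm_one_minus_unit_root[of N "int j"] by (simp add: S_def)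
    then have "int N dvd int j" using unit_root_eq_1_iff[of N "int j"] assms by simp
    then show False using assms by (auto dest: dvd_imp_le)
  qed
  have "2 * S * cmod (dirichlet m N (int j)) = cmod ((1 - unit_root N (- int j)) * dirichlet m N (int j))"
    by (simp add: norm_mult norm_one_minus_unit_root S_def)
  also have "\<dots> \<le> 2"
    unfolding dirichlet_telescope by (rule order_trans[OF norm_triangle_ineq4]) simp
  finally have "cmod (dirichlet m N (int j)) \<le> 1 / S"
    using S0 by (simp add: field_simps S_def)
  with bd show ?thesis by simp
qed

lemma sum_norm_dirichlet_le:
  assumes "2 * m + 1 \<le> N"
  shows "(\<Sum>j = 1..N. cmod (dirichlet m N (int j))) \<le> real N * (3 + 2 * ln (real N))"
proof -
  have N: "N > 0" using assms by simp
  have split: "{1..N} = insert N {1..<N}" using N by auto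
  have top: "cmod (dirichlet m N (int N)) \<le> real N"
  proof -
    have "cmod (dirichlet m N (int N)) \<le> (\<Sum>\<tau> = - int m..int m. 1)"
      unfolding dirichlet_def by (rule order_trans[OF norm_sum]) simp
    also have "\<dots> \<le> real N" using assms by simp
    finally show ?thesis .
  qed
  have h: "(\<Sum>j = 1..<N. 1 / real j) \<le> 1 + ln (real N)"
  proof -
    have "(\<Sum>j = 1..<N. 1 / real j) \<le> (\<Sum>j = 1..N. 1 / real j)" by (intro sum_mono2) auto
    also have "\<dots> = harm N" by (simp add: harm_def inverse_eq_divide)
    \<comment> \<open>The difference \<open>harm N - ln N\<close> decreases in \<open>N\<close> and
      equals 1 at \<open>N = 1\<close>.\<close>
    also have "\<dots> \<le> 1 + ln (real N)"
      using euler_mascheroni_sequence_decreasing[of 1 N] N by (simp add: harm_def)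
    finally show ?thesis .
  qed
  have "(\<Sum>j = 1..<N. cmod (dirichlet m N (int j))) \<le> (\<Sum>j = 1..<N. real N * (1 / real j + 1 / real (N - j)))"
    by (intro sum_mono norm_dirichlet_le) auto
  also have "\<dots> = real N * ((\<Sum>j = 1..<N. 1 / real j) + (\<Sum>j = 1..<N. 1 / real (N - j)))"
    by (simp add: sum_distrib_left sum.distrib distrib_left)
  also have "(\<Sum>j = 1..<N. 1 / real (N - j)) = (\<Sum>j = 1..<N. 1 / real j)"
    by (rule sum.reindex_bij_witness[of _ "\<lambda>j. N - j" "\<lambda>j. N - j"]) auto
  also have "real N * ((\<Sum>j = 1..<N. 1 / real j) + (\<Sum>j = 1..<N. 1 / real j)) \<le> real N * (2 * (1 + ln (real N)))"
    using h by (intro mult_left_mono) auto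
  finally show ?thesis unfolding split using top by (simp add: algebra_simps)
qed

section \<open>Orthogonal projections on a window\<close>

definition inner_on :: "'i set \<Rightarrow> ('i \<Rightarrow> complex) \<Rightarrow> ('i \<Rightarrow> complex) \<Rightarrow> complex" where
  "inner_on W u v = (\<Sum>t\<in>W. cnj (u t) * v t)"

definition norm2_on :: "'i set \<Rightarrow> ('i \<Rightarrow> complex) \<Rightarrow> real" where
  "norm2_on W u = (\<Sum>t\<in>W. (cmod (u t))\<^sup>2)"

definition orthonormal_on :: "'i set \<Rightarrow> (nat \<Rightarrow> 'i \<Rightarrow> complex) \<Rightarrow> nat \<Rightarrow> bool" where
  "orthonormal_on W e d \<longleftrightarrow> (\<forall>i<d. \<forall>j<d. inner_on W (e i) (e j) = (if i = j then 1 else 0))"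

text \<open>Keeping the projection in coordinates makes its value depend on \<open>v\<close> only
  through \<open>v\<close> on \<open>W\<close>, and reduces idempotence and self-adjointness to
  inner products with the basis.\<close>

definition proj_on :: "'i set \<Rightarrow> (nat \<Rightarrow> 'i \<Rightarrow> complex) \<Rightarrow> nat \<Rightarrow> ('i \<Rightarrow> complex) \<Rightarrow> 'i \<Rightarrow> complex" where
  "proj_on W e d v = (\<lambda>t. \<Sum>i<d. inner_on W (e i) v * e i t)"

lemma proj_on_cong:
  "(\<And>i. i < d \<Longrightarrow> inner_on W (e i) u = inner_on W (e i) v) \<Longrightarrow> proj_on W e d u = proj_on W e d v"
  by (simp add: proj_on_def)

lemma norm2_on_nonneg [simp]: "norm2_on W u \<ge> 0"
  by (simp add: norm2_on_def sum_nonneg)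

lemma inner_on_self: "inner_on W u u = complex_of_real (norm2_on W u)"
  by (simp only: inner_on_def norm2_on_def of_real_sum complex_norm_square mult.commute)

lemma cnj_inner_on: "cnj (inner_on W u v) = inner_on W v u"
  by (simp add: inner_on_def mult.commute)

lemma inner_on_diff_right: "inner_on W u (\<lambda>t. v t - w t) = inner_on W u v - inner_on W u w"
  by (simp add: inner_on_def algebra_simps sum_subtractf)

lemma inner_on_diff_left: "inner_on W (\<lambda>t. v t - w t) u = inner_on W v u - inner_on W w u"
  by (simp add: inner_on_def algebra_simps sum_subtractf)

lemma inner_on_mult_right: "inner_on W u (\<lambda>t. c * v t) = c * inner_on W u v"
  by (simp add: inner_on_def sum_distrib_left mult_ac)

lemma inner_on_sum_right: "inner_on W u (\<lambda>t. \<Sum>k\<in>K. c k * v k t) = (\<Sum>k\<in>K. c k * inner_on W u (v k))"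
  by (simp add: inner_on_def sum_distrib_left sum.swap[of _ K W] mult_ac)

lemma inner_on_sum_left: "inner_on W (\<lambda>t. \<Sum>k\<in>K. c k * v k t) u = (\<Sum>k\<in>K. cnj (c k) * inner_on W (v k) u)"
  by (simp add: inner_on_def sum_distrib_left sum_distrib_right sum.swap[of _ K W] mult_ac)

lemma inner_on_cong:
  "(\<And>t. t \<in> W \<Longrightarrow> u t = u' t) \<Longrightarrow> (\<And>t. t \<in> W \<Longrightarrow> v t = v' t) \<Longrightarrow> inner_on W u v = inner_on W u' v'"
  by (simp add: inner_on_def)

lemma norm2_on_diff:
  "norm2_on W (\<lambda>t. u t - v t) = norm2_on W u - 2 * Re (inner_on W u v) + norm2_on W v"
proof -
  have "(cmod (a - b))\<^sup>2 = (cmod a)\<^sup>2 - 2 * Re (cnj a * b) + (cmod b)\<^sup>2" for a b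
    unfolding cmod_power2 by (simp add: power2_eq_square algebra_simps)
  then show ?thesis
    by (simp add: norm2_on_def inner_on_def sum.distrib sum_subtractf sum_distrib_left)
qed

lemma norm_inner_on_le: "cmod (inner_on W u v) \<le> sqrt (norm2_on W u) * sqrt (norm2_on W v)"
proof -
  have "cmod (inner_on W u v) \<le> (\<Sum>t\<in>W. \<bar>cmod (u t)\<bar> * \<bar>cmod (v t)\<bar>)"
    unfolding inner_on_def by (rule order_trans[OF norm_sum]) (simp add: norm_mult)
  also have "\<dots> \<le> L2_set (\<lambda>t. cmod (u t)) W * L2_set (\<lambda>t. cmod (v t)) W"
    by (rule L2_set_mult_ineq)
  finally show ?thesis by (simp add: L2_set_def norm2_on_def)
qed

lemma inner_on_proj_on:
  assumes "orthonormal_on W e d" "i < d"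
  shows "inner_on W (e i) (proj_on W e d v) = inner_on W (e i) v"
proof -
  have "inner_on W (e i) (proj_on W e d v) = (\<Sum>j<d. inner_on W (e j) v * (if i = j then 1 else 0))"
    using assms unfolding proj_on_def inner_on_sum_right
    by (intro sum.cong) (auto simp: orthonormal_on_def)
  also have "\<dots> = inner_on W (e i) v" using assms by (simp add: if_distrib sum.delta cong: if_cong)
  finally show ?thesis .
qed

lemma proj_on_self_adjoint: "inner_on W (proj_on W e d u) v = inner_on W u (proj_on W e d v)"
  unfolding proj_on_def inner_on_sum_left inner_on_sum_right cnj_inner_on by (simp add: mult.commute)

lemma inner_on_proj_on_self: "inner_on W v (proj_on W e d v) = complex_of_real (\<Sum>i<d. (cmod (inner_on W (e i) v))\<^sup>2)"
  unfolding proj_on_def inner_on_sum_right of_real_sum complex_norm_square cnj_inner_on ..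

lemma norm2_on_proj_on:
  assumes "orthonormal_on W e d"
  shows "norm2_on W (proj_on W e d v) = (\<Sum>i<d. (cmod (inner_on W (e i) v))\<^sup>2)"
proof -
  have "complex_of_real (norm2_on W (proj_on W e d v)) = inner_on W v (proj_on W e d (proj_on W e d v))"
    unfolding inner_on_self[symmetric] proj_on_self_adjoint ..
  also have "proj_on W e d (proj_on W e d v) = proj_on W e d v"
    by (rule proj_on_cong) (rule inner_on_proj_on[OF assms])
  finally show ?thesis unfolding inner_on_proj_on_self of_real_eq_iff .
qed

lemma norm2_on_diff_proj_on:
  assumes "orthonormal_on W e d"
  shows "norm2_on W (\<lambda>t. v t - proj_on W e d v t) = norm2_on W v - (\<Sum>i<d. (cmod (inner_on W (e i) v))\<^sup>2)"
  unfolding norm2_on_diff inner_on_proj_on_self norm2_on_proj_on[OF assms] by simp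

lemma bessel:
  assumes "orthonormal_on W e d"
  shows "(\<Sum>i<d. (cmod (inner_on W (e i) v))\<^sup>2) \<le> norm2_on W v"
  using norm2_on_diff_proj_on[OF assms, of v] norm2_on_nonneg[of W "\<lambda>t. v t - proj_on W e d v t"] by linarith

lemma norm2_on_diff_proj_on_le:
  assumes "orthonormal_on W e d"
  shows "norm2_on W (\<lambda>t. v t - proj_on W e d v t) \<le> norm2_on W v"
  unfolding norm2_on_diff_proj_on[OF assms] by (simp add: sum_nonneg)

text \<open>The dimension \<open>d\<close> may drop below \<open>card B\<close>, because sequences
  that are independent on all integers can become dependent on \<open>W\<close>. Membership in the
  span is expressed as being fixed by the projection, the only form in which it is used.\<close>

lemma gram_schmidt:
  assumes "finite W" "finite B"
  shows "\<exists>d e. d \<le> card B \<and> orthonormal_on W e d \<and> (\<forall>b\<in>B. \<forall>t\<in>W. proj_on W e d b t = b t)"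
  using assms(2)
proof (induction rule: finite_induct)
  case empty
  show ?case by (intro exI[of _ 0]) (simp add: orthonormal_on_def)
next
  case (insert b B)
  then obtain d e where d: "d \<le> card B" and e: "orthonormal_on W e d"
    and B: "\<forall>b\<in>B. \<forall>t\<in>W. proj_on W e d b t = b t" by blast
  define r where "r t = b t - proj_on W e d b t" for t
  show ?case
  proof (cases "norm2_on W r = 0")
    case True
    then have "\<forall>t\<in>W. proj_on W e d b t = b t"
      using assms(1) by (simp add: norm2_on_def r_def sum_nonneg_eq_0_iff)
    then show ?thesis using d e B insert by (intro exI[of _ d] exI[of _ e]) auto
  next
    case False
    define c where "c = complex_of_real (1 / sqrt (norm2_on W r))"
    define e' where "e' = e(d := (\<lambda>t. c * r t))"
    have pos: "norm2_on W r > 0" using False norm2_on_nonneg[of W r] by linarith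
    have orth: "inner_on W (e i) r = 0" if "i < d" for i
      unfolding r_def inner_on_diff_right using inner_on_proj_on[OF e that] by simp
    have e'i: "e' i = e i" if "i < d" for i using that by (simp add: e'_def)
    have dd: "inner_on W (e' d) (e' d) = 1"
    proof -
      have "inner_on W (e' d) (e' d) = c * c * complex_of_real (norm2_on W r)"
        by (simp add: e'_def inner_on_mult_right inner_on_self[symmetric])
          (simp add: inner_on_def c_def sum_distrib_left mult_ac)
      also have "\<dots> = complex_of_real (1 / sqrt (norm2_on W r) * (1 / sqrt (norm2_on W r)) * norm2_on W r)"
        by (simp only: c_def of_real_mult)
      also have "1 / sqrt (norm2_on W r) * (1 / sqrt (norm2_on W r)) * norm2_on W r = 1"
        using pos by (simp add: real_div_sqrt)
      finally show ?thesis by simp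
    qed
    have id: "inner_on W (e' i) (e' d) = 0" if "i < d" for i
      using orth[OF that] that by (simp add: e'_def inner_on_mult_right)
    have di: "inner_on W (e' d) (e' i) = 0" if "i < d" for i
      using id[OF that] cnj_inner_on[of W "e' i" "e' d"] by simp
    have e': "orthonormal_on W e' (Suc d)"
      unfolding orthonormal_on_def less_Suc_eq
      using e dd id di by (auto simp: orthonormal_on_def e'i)
    have P: "proj_on W e' (Suc d) v t = proj_on W e d v t + inner_on W (e' d) v * e' d t" for v t
      by (simp add: proj_on_def e'i)
    \<comment> \<open>Any combination of the first \<open>d + 1\<close> vectors is fixed by the new
      projection. The old members of \<open>B\<close> have last coefficient 0, and \<open>b\<close>
      has the norm of its remainder \<open>r\<close> as last coefficient.\<close>
    have mem: "proj_on W e' (Suc d) v t = v t" if v: "\<forall>t\<in>W. v t = (\<Sum>i<Suc d. a i * e' i t)" and t: "t \<in> W" for v a t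
    proof -
      have "inner_on W (e' i) v = a i" if i: "i < Suc d" for i
      proof -
        have "inner_on W (e' i) v = inner_on W (e' i) (\<lambda>t. \<Sum>j<Suc d. a j * e' j t)"
          using v by (intro inner_on_cong) auto
        also have "\<dots> = (\<Sum>j<Suc d. a j * (if i = j then 1 else 0))"
          unfolding inner_on_sum_right using e' i by (intro sum.cong) (auto simp: orthonormal_on_def)
        also have "\<dots> = a i" using i by (simp add: if_distrib sum.delta del: sum.lessThan_Suc cong: if_cong)
        finally show ?thesis .
      qed
      then show ?thesis using v t by (simp add: proj_on_def)
    qed
    have "proj_on W e' (Suc d) b t = b t" if "t \<in> W" for t
    proof (rule mem[OF _ that, of b "\<lambda>i. if i < d then inner_on W (e i) b else sqrt (norm2_on W r)"])
      have "sqrt (norm2_on W r) * e' d t = r t" for t using pos by (simp add: e'_def c_def)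
      then show "\<forall>t\<in>W. b t = (\<Sum>i<Suc d. (if i < d then inner_on W (e i) b else sqrt (norm2_on W r)) * e' i t)"
        by (simp add: e'i r_def proj_on_def)
    qed
    moreover have "proj_on W e' (Suc d) v t = v t" if "v \<in> B" "t \<in> W" for v t
    proof (rule mem[OF _ that(2), of v "\<lambda>i. if i < d then inner_on W (e i) v else 0"])
      show "\<forall>t\<in>W. v t = (\<Sum>i<Suc d. (if i < d then inner_on W (e i) v else 0) * e' i t)"
        using B that by (simp add: e'i proj_on_def)
    qed
    ultimately show ?thesis using e' d insert.hyps by (intro exI[of _ "Suc d"] exI[of _ e']) auto
  qed
qed

section \<open>Filters as combinations of modulated averages\<close>

abbreviation (input) window :: "nat \<Rightarrow> int set" where
  "window n \<equiv> {- int n..int n}"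

lemma seminorm2_power2: "(seminorm2 n u)\<^sup>2 = norm2_on (window n) u"
  by (simp add: seminorm2_def L2_set_def norm2_on_def sum_nonneg)

lemma seminorm2_eq: "seminorm2 n u = sqrt (norm2_on (window n) u)"
  by (simp add: seminorm2_def L2_set_def norm2_on_def)

lemma seminorm2_nonneg: "seminorm2 n u \<ge> 0"
  by (simp add: seminorm2_def)

lemma seminorm2_triangle: "seminorm2 n (\<lambda>t. u t + v t) \<le> seminorm2 n u + seminorm2 n v"
proof -
  have "seminorm2 n (\<lambda>t. u t + v t) \<le> L2_set (\<lambda>t. cmod (u t) + cmod (v t)) (window n)"
    unfolding seminorm2_def by (intro L2_set_mono norm_triangle_ineq) auto
  also have "\<dots> \<le> seminorm2 n u + seminorm2 n v"
    unfolding seminorm2_def by (rule L2_set_triangle_ineq)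
  finally show ?thesis .
qed

lemma seminorm2_mult: "seminorm2 n (\<lambda>t. c * u t) = cmod c * seminorm2 n u"
  by (simp add: seminorm2_def norm_mult L2_set_right_distrib)

lemma seminorm2_sum:
  "finite K \<Longrightarrow> seminorm2 n (\<lambda>t. \<Sum>k\<in>K. c k * v k t) \<le> (\<Sum>k\<in>K. cmod (c k) * seminorm2 n (v k))"
proof (induction K rule: finite_induct)
  case empty
  show ?case by (simp add: seminorm2_def L2_set_def)
next
  case (insert k K)
  then show ?case
    using seminorm2_triangle[of n "\<lambda>t. c k * v k t" "\<lambda>t. \<Sum>k\<in>K. c k * v k t"]
    by (simp add: seminorm2_mult)
qed

lemma seminorm2_cong: "(\<And>t. t \<in> window n \<Longrightarrow> u t = v t) \<Longrightarrow> seminorm2 n u = seminorm2 n v"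
  by (simp add: seminorm2_eq norm2_on_def)

lemma seq_conv_filter:
  assumes "\<phi> \<in> filters m"
  shows "seq_conv \<phi> z t = (\<Sum>\<tau>\<in>window m. \<phi> \<tau> * z (t - \<tau>))"
proof -
  have "seq_conv \<phi> z t = (\<Sum>\<^sub>\<infinity>\<tau>\<in>window m. \<phi> \<tau> * z (t - \<tau>))"
    unfolding seq_conv_def using assms
    by (intro infsum_cong_neutral) (auto simp: filters_def)
  then show ?thesis by simp
qed

text \<open>Up to phase and scale, the filters behind \<open>modavg m k\<close> are the extreme points of the feasible set,
  so every bound that is uniform over feasible filters reduces to these \<open>2 * m + 1\<close> filters.\<close>

definition modavg :: "nat \<Rightarrow> nat \<Rightarrow> (int \<Rightarrow> complex) \<Rightarrow> int \<Rightarrow> complex" where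
  "modavg m k z t = (\<Sum>\<tau>\<in>window m. unit_root (2 * m + 1) (int k * \<tau>) * z (t - \<tau>)) / of_nat (2 * m + 1)"

text \<open>The Toeplitz matrix of \<open>modavg m k\<close>, banded with half-width
  \<open>m\<close>: this is the form in which the tail bounds for fixed matrices apply.\<close>

definition modavg_kernel :: "nat \<Rightarrow> nat \<Rightarrow> int \<Rightarrow> int \<Rightarrow> complex" where
  "modavg_kernel m k t s =
     (if \<bar>t - s\<bar> \<le> int m then unit_root (2 * m + 1) (int k * (t - s)) / of_nat (2 * m + 1) else 0)"

lemma dft_unit_root:
  "dft m \<phi> k = complex_of_real (1 / sqrt (2 * real m + 1)) * (\<Sum>\<tau>\<in>window m. unit_root (2 * m + 1) (- (int k * \<tau>)) * \<phi> \<tau>)"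
proof -
  have "exp (- (2 * complex_of_real pi * \<i> * of_nat k * of_int \<tau> / (2 * of_nat m + 1)))
      = unit_root (2 * m + 1) (- (int k * \<tau>))" for \<tau>
    unfolding unit_root_def cis_conv_exp by (rule arg_cong[where f = exp]) (simp add: mult_ac)
  then show ?thesis by (simp add: dft_def)
qed

lemma filter_dft_inversion:
  assumes "\<bar>\<tau>\<bar> \<le> int m"
  shows "\<phi> \<tau> = (\<Sum>k = 1..2 * m + 1. complex_of_real (sqrt (2 * real m + 1)) * dft m \<phi> k *
    unit_root (2 * m + 1) (int k * \<tau>)) / of_nat (2 * m + 1)"
proof -
  let ?q = "2 * m + 1"
  have "(\<Sum>k = 1..?q. complex_of_real (sqrt (2 * real m + 1)) * dft m \<phi> k * unit_root ?q (int k * \<tau>))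
      = (\<Sum>k = 1..?q. \<Sum>\<tau>'\<in>window m. \<phi> \<tau>' * unit_root ?q (int k * (\<tau> - \<tau>')))"
  proof (intro sum.cong refl)
    fix k
    have "complex_of_real (sqrt (2 * real m + 1)) * dft m \<phi> k
        = (\<Sum>\<tau>\<in>window m. unit_root ?q (- (int k * \<tau>)) * \<phi> \<tau>)"
      unfolding dft_unit_root mult.assoc[symmetric] of_real_mult[symmetric] by simp
    then show "complex_of_real (sqrt (2 * real m + 1)) * dft m \<phi> k * unit_root ?q (int k * \<tau>)
        = (\<Sum>\<tau>'\<in>window m. \<phi> \<tau>' * unit_root ?q (int k * (\<tau> - \<tau>')))"
      unfolding unit_root_diff by (simp only: sum_distrib_right) (simp only: mult_ac)
  qed
  also have "\<dots> = (\<Sum>\<tau>'\<in>window m. \<phi> \<tau>' * (\<Sum>k = 1..?q. unit_root ?q (int k * (\<tau> - \<tau>'))))"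
    unfolding sum_distrib_left by (rule sum.swap)
  also have "\<dots> = (\<Sum>\<tau>'\<in>window m. if \<tau>' = \<tau> then \<phi> \<tau> * of_nat ?q else 0)"
  proof (intro sum.cong refl)
    fix \<tau>' assume "\<tau>' \<in> window m"
    then have "\<bar>\<tau> - \<tau>'\<bar> < int ?q" using assms by auto
    then have "int ?q dvd \<tau> - \<tau>' \<longleftrightarrow> \<tau>' = \<tau>"
      using dvd_imp_le_int[of "\<tau> - \<tau>'" "int ?q"] by auto
    then show "\<phi> \<tau>' * (\<Sum>k = 1..?q. unit_root ?q (int k * (\<tau> - \<tau>'))) = (if \<tau>' = \<tau> then \<phi> \<tau> * of_nat ?q else 0)"
      using sum_unit_root[of ?q "\<tau> - \<tau>'"] by simp
  qed
  also have "\<dots> = \<phi> \<tau> * of_nat ?q" using assms by (simp add: abs_le_iff)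
  finally show ?thesis by (simp del: of_nat_Suc of_nat_add)
qed

text \<open>Fourier inversion with the factor 1 / (2m + 1) moved into \<open>modavg\<close>. The
  remaining factor \<open>sqrt (2 * m + 1)\<close> cancels the denominator of the feasibility
  constraint, so the coefficients have total mass at most \<rho>.\<close>

lemma seq_conv_modavg:
  assumes "\<phi> \<in> filters m"
  shows "seq_conv \<phi> z t = (\<Sum>k = 1..2 * m + 1. complex_of_real (sqrt (2 * real m + 1)) * dft m \<phi> k * modavg m k z t)"
proof -
  have "seq_conv \<phi> z t = (\<Sum>\<tau>\<in>window m. \<Sum>k = 1..2 * m + 1. complex_of_real (sqrt (2 * real m + 1)) * dft m \<phi> k *
    unit_root (2 * m + 1) (int k * \<tau>) / of_nat (2 * m + 1) * z (t - \<tau>))"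
    unfolding seq_conv_filter[OF assms]
  proof (intro sum.cong refl)
    fix \<tau> assume "\<tau> \<in> window m"
    then have "\<bar>\<tau>\<bar> \<le> int m" by auto
    then show "\<phi> \<tau> * z (t - \<tau>) = (\<Sum>k = 1..2 * m + 1. complex_of_real (sqrt (2 * real m + 1)) * dft m \<phi> k *
      unit_root (2 * m + 1) (int k * \<tau>) / of_nat (2 * m + 1) * z (t - \<tau>))"
      by (subst filter_dft_inversion) (simp_all only: sum_divide_distrib sum_distrib_right)
  qed
  also have "\<dots> = (\<Sum>k = 1..2 * m + 1. \<Sum>\<tau>\<in>window m. complex_of_real (sqrt (2 * real m + 1)) * dft m \<phi> k *
    unit_root (2 * m + 1) (int k * \<tau>) / of_nat (2 * m + 1) * z (t - \<tau>))"
    by (rule sum.swap)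
  also have "\<dots> = (\<Sum>k = 1..2 * m + 1. complex_of_real (sqrt (2 * real m + 1)) * dft m \<phi> k * modavg m k z t)"
    by (intro sum.cong refl) (simp add: modavg_def sum_distrib_left sum_divide_distrib mult_ac)
  finally show ?thesis .
qed

lemma sum_filter_coeff_le:
  assumes "dft_norm1 m \<phi> \<le> \<rho> / sqrt (2 * real m + 1)"
  shows "(\<Sum>k = 1..2 * m + 1. cmod (complex_of_real (sqrt (2 * real m + 1)) * dft m \<phi> k)) \<le> \<rho>"
proof -
  have "(\<Sum>k = 1..2 * m + 1. cmod (complex_of_real (sqrt (2 * real m + 1)) * dft m \<phi> k)) = sqrt (2 * real m + 1) * dft_norm1 m \<phi>"
    unfolding dft_norm1_def norm_mult sum_distrib_left by simp
  also have "\<dots> \<le> sqrt (2 * real m + 1) * (\<rho> / sqrt (2 * real m + 1))"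
    using assms by (intro mult_left_mono) auto
  finally show ?thesis by simp
qed

lemma modavg_eq_kernel:
  assumes "t \<in> window n"
  shows "modavg m k z t = (\<Sum>s\<in>window (m + n). modavg_kernel m k t s * z s)"
proof -
  have "(\<Sum>s\<in>window (m + n). modavg_kernel m k t s * z s) = (\<Sum>s\<in>{t - int m..t + int m}. modavg_kernel m k t s * z s)"
    using assms by (intro sum.mono_neutral_right) (auto simp: modavg_kernel_def)
  also have "\<dots> = (\<Sum>\<tau>\<in>window m. modavg_kernel m k t (t - \<tau>) * z (t - \<tau>))"
    by (rule sum.reindex_bij_witness[of _ "\<lambda>\<tau>. t - \<tau>" "\<lambda>s. t - s"]) auto
  also have "\<dots> = modavg m k z t"
    unfolding modavg_def sum_divide_distrib
    by (intro sum.cong refl) (auto simp: modavg_kernel_def abs_le_iff)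
  finally show ?thesis by simp
qed

lemma norm_modavg_kernel:
  "cmod (modavg_kernel m k t s) = (if \<bar>t - s\<bar> \<le> int m then 1 / (2 * real m + 1) else 0)"
proof -
  have "cmod (of_nat (2 * m + 1)) = 2 * real m + 1" unfolding norm_of_nat by simp
  then show ?thesis by (simp add: modavg_kernel_def norm_divide)
qed

text \<open>This is where the ratio comes from: each of the 2n + 1 rows has 2m + 1 entries of
  modulus 1 / (2m + 1), all inside the observation window.\<close>

lemma kernel_frobenius:
  "(\<Sum>t\<in>window n. \<Sum>s\<in>window (m + n). (cmod (modavg_kernel m k t s))\<^sup>2) = (kappa_ratio m n)\<^sup>2"
proof -
  let ?q = "2 * real m + 1"
  have "(\<Sum>s\<in>window (m + n). (cmod (modavg_kernel m k t s))\<^sup>2) = 1 / ?q" if t: "t \<in> window n" for t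
  proof -
    have "(\<Sum>s\<in>window (m + n). (cmod (modavg_kernel m k t s))\<^sup>2) = (\<Sum>s\<in>{t - int m..t + int m}. (1 / ?q)\<^sup>2)"
      using t by (intro sum.mono_neutral_cong_right) (auto simp: norm_modavg_kernel)
    also have "\<dots> = ?q * (1 / ?q)\<^sup>2" by simp
    also have "\<dots> = 1 / ?q" by (simp add: power2_eq_square)
    finally show ?thesis .
  qed
  then show ?thesis by (simp add: kappa_ratio_def)
qed

text \<open>For fixed \<open>t\<close> the averages over all \<open>k\<close> form, up to scale, a
  discrete Fourier transform of \<open>z\<close> on the window of radius \<open>m\<close> around
  \<open>t\<close>, so orthogonality of the characters removes all cross terms.\<close>

lemma modavg_parseval:
  "(\<Sum>k = 1..2 * m + 1. (cmod (modavg m k z t))\<^sup>2) = (\<Sum>\<tau>\<in>window m. (cmod (z (t - \<tau>)))\<^sup>2) / (2 * real m + 1)"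
proof -
  let ?q = "2 * m + 1"
  define a where "a k \<tau> = unit_root ?q (int k * \<tau>) * z (t - \<tau>)" for k \<tau>
  have "complex_of_real (\<Sum>k = 1..?q. (cmod (\<Sum>\<tau>\<in>window m. a k \<tau>))\<^sup>2)
     = (\<Sum>k = 1..?q. \<Sum>\<tau>\<in>window m. \<Sum>\<tau>'\<in>window m. z (t - \<tau>) * cnj (z (t - \<tau>')) * unit_root ?q (int k * (\<tau> - \<tau>')))"
    unfolding of_real_sum complex_norm_square cnj_sum sum_product
    by (intro sum.cong refl)
      (simp only: a_def complex_cnj_mult cnj_unit_root unit_root_diff mult_ac)
  also have "\<dots> = (\<Sum>\<tau>\<in>window m. \<Sum>\<tau>'\<in>window m. \<Sum>k = 1..?q. z (t - \<tau>) * cnj (z (t - \<tau>')) * unit_root ?q (int k * (\<tau> - \<tau>')))"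
    by (subst sum.swap) (intro sum.cong refl sum.swap)
  also have "\<dots> = (\<Sum>\<tau>\<in>window m. \<Sum>\<tau>'\<in>window m. if \<tau>' = \<tau> then of_nat ?q * (z (t - \<tau>) * cnj (z (t - \<tau>))) else 0)"
  proof (intro sum.cong refl)
    fix \<tau> \<tau>' assume "\<tau> \<in> window m" "\<tau>' \<in> window m"
    then have "\<bar>\<tau> - \<tau>'\<bar> < int ?q" by auto
    then have "int ?q dvd \<tau> - \<tau>' \<longleftrightarrow> \<tau>' = \<tau>"
      using dvd_imp_le_int[of "\<tau> - \<tau>'" "int ?q"] by auto
    then show "(\<Sum>k = 1..?q. z (t - \<tau>) * cnj (z (t - \<tau>')) * unit_root ?q (int k * (\<tau> - \<tau>')))
        = (if \<tau>' = \<tau> then of_nat ?q * (z (t - \<tau>) * cnj (z (t - \<tau>))) else 0)"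
      unfolding sum_distrib_left[symmetric] using sum_unit_root[of ?q "\<tau> - \<tau>'"] by simp
  qed
  also have "\<dots> = (\<Sum>\<tau>\<in>window m. of_nat ?q * (z (t - \<tau>) * cnj (z (t - \<tau>))))"
    by (intro sum.cong refl) (simp add: sum.delta)
  also have "\<dots> = complex_of_real (real ?q * (\<Sum>\<tau>\<in>window m. (cmod (z (t - \<tau>)))\<^sup>2))"
    unfolding of_real_mult of_real_sum complex_norm_square sum_distrib_left by simp
  finally have "(\<Sum>k = 1..?q. (cmod (\<Sum>\<tau>\<in>window m. a k \<tau>))\<^sup>2) = real ?q * (\<Sum>\<tau>\<in>window m. (cmod (z (t - \<tau>)))\<^sup>2)"
    unfolding of_real_eq_iff .
  moreover have "(\<Sum>k = 1..?q. (cmod (modavg m k z t))\<^sup>2) = (\<Sum>k = 1..?q. (cmod (\<Sum>\<tau>\<in>window m. a k \<tau>))\<^sup>2) / (real ?q)\<^sup>2"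
    unfolding modavg_def a_def norm_divide power_divide norm_of_nat by (rule sum_divide_distrib[symmetric])
  ultimately show ?thesis by (simp add: power2_eq_square)
qed

text \<open>After Parseval the left-hand side is the mean over |\<tau>| \<le> m of the squared
  window norms of the shifts of \<epsilon>. This is why the class controls \<epsilon> on every
  shifted window, and why the sum over \<open>k\<close> costs no factor \<open>m\<close>.\<close>

lemma sum_norm2_on_modavg_le:
  assumes "\<And>\<tau>. \<bar>\<tau>\<bar> \<le> int m \<Longrightarrow> seminorm2 n (seq_shift (- \<tau>) \<epsilon>) \<le> b"
  shows "(\<Sum>k = 1..2 * m + 1. norm2_on (window n) (modavg m k \<epsilon>)) \<le> b\<^sup>2"
proof -
  let ?q = "2 * real m + 1"
  have "(\<Sum>k = 1..2 * m + 1. norm2_on (window n) (modavg m k \<epsilon>))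
      = (\<Sum>t\<in>window n. \<Sum>k = 1..2 * m + 1. (cmod (modavg m k \<epsilon> t))\<^sup>2)"
    unfolding norm2_on_def by (rule sum.swap)
  also have "\<dots> = (\<Sum>t\<in>window n. \<Sum>\<tau>\<in>window m. (cmod (\<epsilon> (t - \<tau>)))\<^sup>2) / ?q"
    unfolding modavg_parseval sum_divide_distrib ..
  also have "(\<Sum>t\<in>window n. \<Sum>\<tau>\<in>window m. (cmod (\<epsilon> (t - \<tau>)))\<^sup>2)
      = (\<Sum>\<tau>\<in>window m. \<Sum>t\<in>window n. (cmod (\<epsilon> (t - \<tau>)))\<^sup>2)"
    by (rule sum.swap)
  also have "\<dots> / ?q \<le> (\<Sum>\<tau>\<in>window m. b\<^sup>2) / ?q"
  proof (intro divide_right_mono sum_mono)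
    fix \<tau> assume "\<tau> \<in> window m"
    then have "seminorm2 n (seq_shift (- (- \<tau>)) \<epsilon>) \<le> b" by (intro assms) auto
    then have "(seminorm2 n (seq_shift \<tau> \<epsilon>))\<^sup>2 \<le> b\<^sup>2"
      by (intro power_mono seminorm2_nonneg) simp
    then show "(\<Sum>t\<in>window n. (cmod (\<epsilon> (t - \<tau>)))\<^sup>2) \<le> b\<^sup>2"
      by (simp add: seminorm2_power2 norm2_on_def seq_shift_def)
  qed simp
  finally show ?thesis by simp
qed

section \<open>Shift-invariant signals\<close>

interpretation seq_shift: Vector_Spaces.linear seq_scale seq_scale "seq_shift k"
  by unfold_locales (auto simp: seq_shift_def seq_scale_def)

lemma sum_fun_apply: "(\<Sum>k\<in>K. f k) t = (\<Sum>k\<in>K. f k t)"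
  by (induction K rule: infinite_finite_induct) auto

text \<open>On a finite-dimensional space the injective map \<open>\<Delta>\<close> is onto, so the space is also invariant
  under \<open>\<Delta>\<^sup>-\<^sup>1\<close>.\<close>

lemma seq_shift_image_eq:
  assumes S: "seq_subspace S" "seq_shift 1 ` S \<subseteq> S" and B: "finite B" "S \<subseteq> seq_span B"
  shows "seq_shift 1 ` S = S"
proof (rule subset_antisym[OF S(2)])
  obtain A where A: "A \<subseteq> S" "seq.independent A" "S \<subseteq> seq_span A"
    using seq.basis_exists by metis
  have fin: "finite A" using seq.independent_span_bound[OF B(1) A(2)] A(1) B(2) by auto
  have spanA: "seq_span A = S" using A S by (metis seq.span_minimal subset_antisym)
  have inj: "inj (seq_shift 1)"
  proof (rule injI)
    fix u v assume "seq_shift 1 u = seq_shift 1 v"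
    then have "u (t + 1 - 1) = v (t + 1 - 1)" for t by (metis seq_shift_def)
    then show "u = v" by auto
  qed
  have indep: "seq.independent (seq_shift 1 ` A)"
    using seq_shift.independent_injective_image[OF A(2)] inj by (meson inj_on_subset subset_UNIV)
  have sub: "seq_shift 1 ` A \<subseteq> S" using A S by auto
  have "S \<subseteq> seq_span (seq_shift 1 ` A)"
  proof
    fix v assume v: "v \<in> S"
    show "v \<in> seq_span (seq_shift 1 ` A)"
    proof (rule ccontr)
      assume nv: "v \<notin> seq_span (seq_shift 1 ` A)"
      then have "seq.independent (insert v (seq_shift 1 ` A))" using indep by (simp add: seq.independent_insertI)
      moreover have "insert v (seq_shift 1 ` A) \<subseteq> seq_span A" using v sub spanA by auto
      ultimately have "card (insert v (seq_shift 1 ` A)) \<le> card A"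
        using seq.independent_span_bound[OF fin] by blast
      moreover have "v \<notin> seq_shift 1 ` A" using nv seq.span_base by blast
      moreover have "card (seq_shift 1 ` A) = card A" using inj by (meson card_image inj_on_subset subset_UNIV)
      ultimately show False using fin by simp
    qed
  qed
  then show "S \<subseteq> seq_shift 1 ` S" using seq_shift.span_image[of 1 A, folded seq_span_def] spanA by simp
qed

lemma seq_shift_mem:
  assumes S: "seq_subspace S" "seq_shift 1 ` S \<subseteq> S" and B: "finite B" "S \<subseteq> seq_span B"
    and z: "z \<in> S"
  shows "seq_shift k z \<in> S"
proof (induction k rule: int_induct[where k = 0])
  case base
  show ?case using z by (simp add: seq_shift_def)
next
  case (step1 k)
  then have "seq_shift 1 (seq_shift k z) \<in> S" using S by auto
  then show ?case by (simp add: seq_shift_def algebra_simps)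
next
  case (step2 k)
  then obtain u where u: "u \<in> S" "seq_shift k z = seq_shift 1 u"
    using seq_shift_image_eq[OF S B] by blast
  then have "u = seq_shift (k - 1) z"
    by (auto simp: seq_shift_def fun_eq_iff algebra_simps dest: spec[of _ "_ + 1"])
  with u show ?case by simp
qed

lemma seq_conv_mem:
  assumes S: "seq_subspace S" "seq_shift 1 ` S \<subseteq> S" and B: "finite B" "S \<subseteq> seq_span B"
    and z: "z \<in> S" and \<phi>: "\<phi> \<in> filters m"
  shows "seq_conv \<phi> z \<in> S"
proof -
  have "seq_conv \<phi> z = (\<Sum>\<tau>\<in>window m. seq_scale (\<phi> \<tau>) (seq_shift \<tau> z))"
    by (rule ext) (simp add: seq_conv_filter[OF \<phi>] sum_fun_apply seq_scale_def seq_shift_def)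
  also have "\<dots> \<in> S"
    by (intro seq.subspace_sum seq.subspace_scale S(1) seq_shift_mem[OF S B z])
  finally show ?thesis .
qed

lemma proj_on_span:
  assumes B: "\<forall>b\<in>B. \<forall>t\<in>W. proj_on W e d b t = b t" and v: "v \<in> seq_span B" and t: "t \<in> W"
  shows "proj_on W e d v t = v t"
proof -
  have "seq_span B \<subseteq> {v. \<forall>t\<in>W. proj_on W e d v t = v t}"
  proof (rule seq.span_minimal)
    show "seq_subspace {v. \<forall>t\<in>W. proj_on W e d v t = v t}"
      unfolding seq.subspace_def
    proof (intro conjI allI ballI; clarsimp)
      show "proj_on W e d 0 t = 0" for t by (simp add: proj_on_def inner_on_def)
    next
      fix u v :: "int \<Rightarrow> complex" and t
      assume "\<forall>t\<in>W. proj_on W e d u t = u t" "\<forall>t\<in>W. proj_on W e d v t = v t" "t \<in> W"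
      moreover have "proj_on W e d (u + v) t = proj_on W e d u t + proj_on W e d v t"
        by (simp add: proj_on_def inner_on_def sum.distrib algebra_simps)
      ultimately show "proj_on W e d (u + v) t = u t + v t" by simp
    next
      fix c and v :: "int \<Rightarrow> complex" and t
      assume "\<forall>t\<in>W. proj_on W e d v t = v t" "t \<in> W"
      moreover have "proj_on W e d (seq_scale c v) t = c * proj_on W e d v t"
        by (simp add: proj_on_def seq_scale_def inner_on_mult_right sum_distrib_left mult.assoc)
      ultimately show "proj_on W e d (seq_scale c v) t = seq_scale c v t" by (simp add: seq_scale_def)
    qed
  qed (use B in auto)
  then show ?thesis using v t by auto
qed

text \<open>The orthonormal system is chosen before the filter. As the space is invariant under
  shifts in both directions, it contains the residual of \<open>u\<close> for every filter
  simultaneously, so the same projection is valid for a filter that depends on the noise.\<close>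

lemma signal_class_decomposition:
  assumes "x \<in> signal_class m n \<sigma> s \<kappa>"
  obtains u \<epsilon> d e where "d \<le> s" "orthonormal_on (window n) e d" "\<And>t. x t = u t + \<epsilon> t"
    "\<And>\<psi> t. \<psi> \<in> filters m \<Longrightarrow> t \<in> window n \<Longrightarrow>
       proj_on (window n) e d (\<lambda>t. u t - seq_conv \<psi> u t) t = u t - seq_conv \<psi> u t"
    "\<And>\<tau>. \<bar>\<tau>\<bar> \<le> int m \<Longrightarrow> seminorm2 n (seq_shift (- \<tau>) \<epsilon>) \<le> \<kappa> * \<sigma>"
proof -
  obtain S u \<epsilon> B where x: "x = u + \<epsilon>" and u: "u \<in> S" and S: "seq_subspace S" "seq_shift 1 ` S \<subseteq> S"
    and B: "finite B" "S \<subseteq> seq_span B" and s: "s = seq_dim S"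
    and \<epsilon>: "\<And>\<tau>. \<bar>\<tau>\<bar> \<le> int m \<Longrightarrow> seminorm2 n (seq_shift (- \<tau>) \<epsilon>) \<le> \<kappa> * \<sigma>"
    using assms unfolding signal_class_def by blast
  obtain A where A: "A \<subseteq> S" "seq.independent A" "S \<subseteq> seq_span A" "card A = seq_dim S"
    using seq.basis_exists by metis
  have fin: "finite A" using seq.independent_span_bound[OF B(1) A(2)] A(1) B(2) by auto
  obtain d e where d: "d \<le> card A" and e: "orthonormal_on (window n) e d"
    and P: "\<forall>b\<in>A. \<forall>t\<in>window n. proj_on (window n) e d b t = b t"
    using gram_schmidt[OF _ fin, of "window n"] by auto
  show ?thesis
  proof (rule that[OF _ e _ _ \<epsilon>])
    fix \<psi> t assume \<psi>: "\<psi> \<in> filters m" and t: "t \<in> window n"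
    have "u - seq_conv \<psi> u \<in> S"
      by (intro seq.subspace_diff S(1) u seq_conv_mem[OF S B u \<psi>])
    then have "u - seq_conv \<psi> u \<in> seq_span A" using A by auto
    from proj_on_span[OF P this t]
    show "proj_on (window n) e d (\<lambda>t. u t - seq_conv \<psi> u t) t = u t - seq_conv \<psi> u t"
      by (simp add: fun_diff_def)
  qed (use d A s x in auto)
qed

section \<open>Pathwise comparison of the optimal filter with the oracle filter\<close>

lemma seq_conv_diff_window:
  assumes "\<psi> \<in> filters m" and "\<And>t. t \<in> window (m + n) \<Longrightarrow> y t = x t + c * z t" and "t \<in> window n"
  shows "seq_conv \<psi> y t = seq_conv \<psi> x t + c * seq_conv \<psi> z t"
proof -
  \<comment> \<open>For |t| \<le> n and |\<tau>| \<le> m the index t - \<tau> stays within m + n,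
    the range on which the observation model holds; elsewhere \<open>y\<close> is arbitrary.\<close>
  have "seq_conv \<psi> y t = (\<Sum>\<tau>\<in>window m. \<psi> \<tau> * (x (t - \<tau>) + c * z (t - \<tau>)))"
    unfolding seq_conv_filter[OF assms(1)] using assms(2,3) by (intro sum.cong) auto
  then show ?thesis
    by (simp add: seq_conv_filter[OF assms(1)] sum.distrib sum_distrib_left algebra_simps)
qed

lemma inner_on_seq_conv_le:
  assumes \<psi>: "con_feasible m \<rho> \<psi>"
    and b: "\<And>k. k \<in> {1..2 * m + 1} \<Longrightarrow> cmod (inner_on W u (modavg m k z)) \<le> b"
  shows "cmod (inner_on W u (seq_conv \<psi> z)) \<le> \<rho> * b"
proof -
  define c where "c k = complex_of_real (sqrt (2 * real m + 1)) * dft m \<psi> k" for k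
  have "b \<ge> 0" using b[of 1] by (auto intro: order_trans[OF norm_ge_zero])
  have "seq_conv \<psi> z = (\<lambda>t. \<Sum>k = 1..2 * m + 1. c k * modavg m k z t)"
    using \<psi> by (intro ext) (simp only: con_feasible_def seq_conv_modavg c_def)
  then have "cmod (inner_on W u (seq_conv \<psi> z)) \<le> (\<Sum>k = 1..2 * m + 1. cmod (c k) * cmod (inner_on W u (modavg m k z)))"
    by (simp only: inner_on_sum_right norm_mult[symmetric] norm_sum)
  also have "\<dots> \<le> (\<Sum>k = 1..2 * m + 1. cmod (c k) * b)"
    by (intro sum_mono mult_left_mono b) auto
  also have "\<dots> = (\<Sum>k = 1..2 * m + 1. cmod (c k)) * b" by (simp only: sum_distrib_right)
  also have "\<dots> \<le> \<rho> * b"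
    using \<psi> \<open>b \<ge> 0\<close> unfolding c_def by (intro mult_right_mono sum_filter_coeff_le) (auto simp: con_feasible_def)
  finally show ?thesis .
qed

lemma seminorm2_seq_conv_le:
  assumes \<psi>: "con_feasible m \<rho> \<psi>"
    and b: "\<And>k. k \<in> {1..2 * m + 1} \<Longrightarrow> seminorm2 n (modavg m k z) \<le> b"
  shows "seminorm2 n (seq_conv \<psi> z) \<le> \<rho> * b"
proof -
  define c where "c k = complex_of_real (sqrt (2 * real m + 1)) * dft m \<psi> k" for k
  have "b \<ge> 0" using b[of 1] by (auto intro: order_trans[OF seminorm2_nonneg])
  have "seq_conv \<psi> z = (\<lambda>t. \<Sum>k = 1..2 * m + 1. c k * modavg m k z t)"
    using \<psi> by (intro ext) (simp only: con_feasible_def seq_conv_modavg c_def)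
  then have "seminorm2 n (seq_conv \<psi> z) \<le> (\<Sum>k = 1..2 * m + 1. cmod (c k) * seminorm2 n (modavg m k z))"
    by (simp only: seminorm2_sum finite_atLeastAtMost)
  also have "\<dots> \<le> (\<Sum>k = 1..2 * m + 1. cmod (c k) * b)"
    by (intro sum_mono mult_left_mono b) auto
  also have "\<dots> = (\<Sum>k = 1..2 * m + 1. cmod (c k)) * b" by (simp only: sum_distrib_right)
  also have "\<dots> \<le> \<rho> * b"
    using \<psi> \<open>b \<ge> 0\<close> unfolding c_def by (intro mult_right_mono sum_filter_coeff_le) (auto simp: con_feasible_def)
  finally show ?thesis .
qed

text \<open>The randomness is confined to \<open>A1\<close>, ..., \<open>A5\<close> and
  \<open>D\<close>. \<open>A1\<close> and \<open>A3\<close> concern noise averaged by fixed filters,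
  \<open>A4\<close> the projected noise, \<open>A5\<close> the noise against the residual of the
  oracle, and \<open>D\<close> the complementary noise against \<epsilon>. Only the first two and
  part of \<open>D\<close> are transferred to the feasible filters at the cost of \<rho>.\<close>

lemma oracle_inequality_deterministic:
  fixes n :: nat and \<sigma> \<rho> A1 A3 A4 A5 D :: real
  defines "W \<equiv> window n"
  assumes \<sigma>: "\<sigma> > 0" and \<rho>: "\<rho> \<ge> 0"
    and y: "\<And>t. t \<in> window (m + n) \<Longrightarrow> y t = x t + complex_of_real \<sigma> * z t"
    and x: "\<And>t. x t = u t + \<epsilon> t"
    and P: "\<And>t. t \<in> W \<Longrightarrow> proj_on W e d (\<lambda>t. u t - seq_conv \<psi> u t) t = u t - seq_conv \<psi> u t"
    and opt: "con_optimal m n \<rho> y \<psi>" and \<phi>: "con_feasible m \<rho> \<phi>"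
    and E1: "\<And>k. k \<in> {1..2 * m + 1} \<Longrightarrow> cmod (inner_on W z (modavg m k z)) \<le> A1"
    and E2: "\<And>k. k \<in> {1..2 * m + 1} \<Longrightarrow> cmod (inner_on W (proj_on W e d z) (modavg m k z)) \<le> A1"
    and E3: "\<And>k. k \<in> {1..2 * m + 1} \<Longrightarrow> seminorm2 n (modavg m k z) \<le> A3"
    and E4: "seminorm2 n (proj_on W e d z) \<le> A4"
    and E5: "cmod (inner_on W z (\<lambda>t. x t - seq_conv \<phi> x t)) \<le> seminorm2 n (\<lambda>t. x t - seq_conv \<phi> x t) * A5"
      "A5 \<ge> 0"
    and E6: "cmod (inner_on W (\<lambda>t. z t - proj_on W e d z t) \<epsilon>) \<le> \<sigma> * D"
    and E7: "\<And>k. k \<in> {1..2 * m + 1} \<Longrightarrow>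
      cmod (inner_on W (\<lambda>t. z t - proj_on W e d z t) (modavg m k \<epsilon>)) \<le> \<sigma> * D"
  shows "seminorm2 n (x - seq_conv \<psi> y) \<le> seminorm2 n (x - seq_conv \<phi> y)
    + \<sigma> * (A4 + A5 + sqrt (A4\<^sup>2 + 2 * \<rho> * A5 * A3 + 6 * \<rho> * A1 + 2 * (1 + \<rho>) * D))"
proof -
  have \<psi>: "con_feasible m \<rho> \<psi>" using opt by (simp add: con_optimal_def is_arg_min_def)
  have le: "(seminorm2 n (y - seq_conv \<psi> y))\<^sup>2 \<le> (seminorm2 n (y - seq_conv \<phi> y))\<^sup>2"
    using opt \<phi> by (auto simp: con_optimal_def is_arg_min_def not_less)
  define Pz where "Pz = proj_on W e d z"
  define r where "r \<theta> t = x t - seq_conv \<theta> y t" for \<theta> t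
  define a where "a = seminorm2 n (r \<psi>)"
  define b where "b = seminorm2 n (r \<phi>)"
  have ab: "a \<ge> 0" "b \<ge> 0" by (simp_all add: a_def b_def seminorm2_nonneg)
  have filt: "\<psi> \<in> filters m" "\<phi> \<in> filters m" using \<psi> \<phi> by (auto simp: con_feasible_def)
  have conv: "seq_conv \<theta> y t = seq_conv \<theta> x t + complex_of_real \<sigma> * seq_conv \<theta> z t"
    if "\<theta> \<in> filters m" "t \<in> W" for \<theta> t
    using seq_conv_diff_window[OF that(1) y] that(2) by (simp add: W_def)
  \<comment> \<open>The term \<open>\<sigma>\<^sup>2 * norm2_on W z\<close> is the same for both
    filters and cancels in the comparison; only the cross terms remain.\<close>
  have sq: "(seminorm2 n (y - seq_conv \<theta> y))\<^sup>2
      = \<sigma>\<^sup>2 * norm2_on W z + 2 * \<sigma> * Re (inner_on W z (r \<theta>)) + (seminorm2 n (r \<theta>))\<^sup>2" for \<theta>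
  proof -
    have yt: "t \<in> W \<Longrightarrow> y t = x t + complex_of_real \<sigma> * z t" for t using y[of t] by (auto simp: W_def)
    have "(seminorm2 n (y - seq_conv \<theta> y))\<^sup>2 = norm2_on W (\<lambda>t. r \<theta> t - (- complex_of_real \<sigma>) * z t)"
      unfolding seminorm2_power2 W_def[symmetric] using yt by (simp add: norm2_on_def r_def algebra_simps)
    also have "\<dots> = (seminorm2 n (r \<theta>))\<^sup>2 + 2 * \<sigma> * Re (inner_on W (r \<theta>) z) + \<sigma>\<^sup>2 * norm2_on W z"
      unfolding norm2_on_diff inner_on_mult_right seminorm2_power2 W_def[symmetric]
      by (simp add: norm2_on_def norm_mult power_mult_distrib sum_distrib_left)
    also have "Re (inner_on W (r \<theta>) z) = Re (inner_on W z (r \<theta>))"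
      using cnj_inner_on[of W z "r \<theta>"] by (metis complex_cnj(1) cnj.sel(1))
    finally show ?thesis by (simp only: ac_simps)
  qed
  have main: "a\<^sup>2 \<le> b\<^sup>2 + 2 * \<sigma> * (Re (inner_on W z (r \<phi>)) - Re (inner_on W z (r \<psi>)))"
    using le unfolding sq a_def b_def by (simp add: algebra_simps)
  have split: "inner_on W v (r \<theta>) = inner_on W v (\<lambda>t. x t - seq_conv \<theta> x t) - complex_of_real \<sigma> * inner_on W v (seq_conv \<theta> z)"
    if "\<theta> \<in> filters m" for \<theta> v
    unfolding inner_on_mult_right[symmetric] inner_on_diff_right[symmetric]
    by (rule inner_on_cong) (auto simp: r_def conv[OF that])
  \<comment> \<open>The bound \<open>E5\<close> needs a deterministic residual, so it is stated for
    x - \<phi> * x. Returning to the loss \<open>b\<close>, which contains filtered noise, costs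
    \<open>\<sigma> * (\<rho> * A3)\<close>.\<close>
  have t1: "Re (inner_on W z (r \<phi>)) \<le> (b + \<sigma> * (\<rho> * A3)) * A5 + \<sigma> * (\<rho> * A1)"
  proof -
    have "seminorm2 n (\<lambda>t. x t - seq_conv \<phi> x t) \<le> b + \<sigma> * (\<rho> * A3)"
    proof -
      have "seminorm2 n (\<lambda>t. x t - seq_conv \<phi> x t) = seminorm2 n (\<lambda>t. r \<phi> t + complex_of_real \<sigma> * seq_conv \<phi> z t)"
        by (rule seminorm2_cong) (use conv[OF filt(2)] in \<open>auto simp: r_def W_def\<close>)
      also have "\<dots> \<le> b + \<sigma> * seminorm2 n (seq_conv \<phi> z)"
        unfolding b_def using seminorm2_triangle[of n "r \<phi>" "\<lambda>t. complex_of_real \<sigma> * seq_conv \<phi> z t"] \<sigma>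
        by (simp add: seminorm2_mult)
      also have "\<dots> \<le> b + \<sigma> * (\<rho> * A3)"
        using \<sigma> seminorm2_seq_conv_le[OF \<phi> E3] by simp
      finally show ?thesis .
    qed
    then have "cmod (inner_on W z (\<lambda>t. x t - seq_conv \<phi> x t)) \<le> (b + \<sigma> * (\<rho> * A3)) * A5"
      using E5 by (meson mult_right_mono order_trans)
    moreover have "cmod (inner_on W z (seq_conv \<phi> z)) \<le> \<rho> * A1"
      by (rule inner_on_seq_conv_le[OF \<phi> E1])
    then have "\<sigma> * cmod (inner_on W z (seq_conv \<phi> z)) \<le> \<sigma> * (\<rho> * A1)" using \<sigma> by simp
    moreover have "Re (inner_on W z (r \<phi>)) \<le> cmod (inner_on W z (\<lambda>t. x t - seq_conv \<phi> x t)) + \<sigma> * cmod (inner_on W z (seq_conv \<phi> z))"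
    proof -
      have "Re (inner_on W z (r \<phi>)) \<le> cmod (inner_on W z (r \<phi>))" by (rule complex_Re_le_cmod)
      also have "\<dots> \<le> cmod (inner_on W z (\<lambda>t. x t - seq_conv \<phi> x t)) + cmod (complex_of_real \<sigma> * inner_on W z (seq_conv \<phi> z))"
        unfolding split[OF filt(2)] by (rule norm_triangle_ineq4)
      finally show ?thesis using \<sigma> by (simp add: norm_mult)
    qed
    ultimately show ?thesis by linarith
  qed
  \<comment> \<open>The projected noise \<open>Pz\<close> is paired with the full residual
    \<open>r \<psi>\<close>, not with x - \<psi> * x, because only the full residual has norm
    \<open>a\<close>, which the left-hand side can absorb. The exchange costs the second quadratic
    form, from \<open>E2\<close>. The complement \<open>q\<close> is orthogonal to the structured
    residual by \<open>P\<close> and self-adjointness.\<close>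
  have t2: "- Re (inner_on W z (r \<psi>)) \<le> A4 * a + 2 * \<sigma> * (\<rho> * A1) + \<sigma> * D + \<rho> * (\<sigma> * D)"
  proof -
    define q where "q t = z t - Pz t" for t
    have zq: "inner_on W z v = inner_on W Pz v + inner_on W q v" for v
      unfolding q_def inner_on_diff_left by simp
    have "inner_on W q (\<lambda>t. u t - seq_conv \<psi> u t) = 0"
    proof -
      have "inner_on W z (proj_on W e d (\<lambda>t. u t - seq_conv \<psi> u t)) = inner_on W z (\<lambda>t. u t - seq_conv \<psi> u t)"
        by (rule inner_on_cong) (auto simp: P)
      then show ?thesis unfolding q_def inner_on_diff_left Pz_def proj_on_self_adjoint by simp
    qed
    moreover have "inner_on W q (\<lambda>t. x t - seq_conv \<psi> x t)
        = inner_on W q (\<lambda>t. u t - seq_conv \<psi> u t) + inner_on W q (\<lambda>t. \<epsilon> t - seq_conv \<psi> \<epsilon> t)"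
    proof -
      have "seq_conv \<psi> x t = seq_conv \<psi> u t + seq_conv \<psi> \<epsilon> t" for t
        unfolding seq_conv_filter[OF filt(1)] by (simp add: x sum.distrib algebra_simps)
      then show ?thesis by (simp add: inner_on_def x sum.distrib[symmetric] algebra_simps)
    qed
    ultimately have qx: "inner_on W q (\<lambda>t. x t - seq_conv \<psi> x t) = inner_on W q \<epsilon> - inner_on W q (seq_conv \<psi> \<epsilon>)"
      by (simp add: inner_on_diff_right)
    have px: "inner_on W Pz (\<lambda>t. x t - seq_conv \<psi> x t)
        = inner_on W Pz (r \<psi>) + complex_of_real \<sigma> * inner_on W Pz (seq_conv \<psi> z)"
      by (simp add: split[OF filt(1)])
    have "inner_on W z (r \<psi>) = inner_on W Pz (r \<psi>) + complex_of_real \<sigma> * inner_on W Pz (seq_conv \<psi> z)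
        + inner_on W q \<epsilon> - inner_on W q (seq_conv \<psi> \<epsilon>) - complex_of_real \<sigma> * inner_on W z (seq_conv \<psi> z)"
      unfolding split[OF filt(1), of z] zq[of "\<lambda>t. x t - seq_conv \<psi> x t"] qx px by simp
    then have "- Re (inner_on W z (r \<psi>)) = - Re (inner_on W Pz (r \<psi>)) - \<sigma> * Re (inner_on W Pz (seq_conv \<psi> z))
        - Re (inner_on W q \<epsilon>) + Re (inner_on W q (seq_conv \<psi> \<epsilon>)) + \<sigma> * Re (inner_on W z (seq_conv \<psi> z))"
      by simp
    moreover have "- Re (inner_on W Pz (r \<psi>)) \<le> A4 * a"
    proof -
      have "cmod (inner_on W Pz (r \<psi>)) \<le> seminorm2 n Pz * a"
        using norm_inner_on_le[of W Pz "r \<psi>"] by (simp add: seminorm2_eq a_def W_def)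
      also have "\<dots> \<le> A4 * a" using E4 ab by (intro mult_right_mono) (auto simp: Pz_def)
      finally show ?thesis using abs_Re_le_cmod[of "inner_on W Pz (r \<psi>)"] by linarith
    qed
    moreover have "- (\<sigma> * Re (inner_on W Pz (seq_conv \<psi> z))) \<le> \<sigma> * (\<rho> * A1)"
    proof -
      have "cmod (inner_on W Pz (seq_conv \<psi> z)) \<le> \<rho> * A1"
        using inner_on_seq_conv_le[OF \<psi> E2] by (simp add: Pz_def)
      then have "- Re (inner_on W Pz (seq_conv \<psi> z)) \<le> \<rho> * A1"
        using abs_Re_le_cmod[of "inner_on W Pz (seq_conv \<psi> z)"] by linarith
      then have "\<sigma> * (- Re (inner_on W Pz (seq_conv \<psi> z))) \<le> \<sigma> * (\<rho> * A1)"
        using \<sigma> by (intro mult_left_mono) auto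
      then show ?thesis by simp
    qed
    moreover have "\<sigma> * Re (inner_on W z (seq_conv \<psi> z)) \<le> \<sigma> * (\<rho> * A1)"
      using \<sigma> inner_on_seq_conv_le[OF \<psi> E1] complex_Re_le_cmod[of "inner_on W z (seq_conv \<psi> z)"]
      by (intro mult_left_mono) auto
    moreover have "- Re (inner_on W q \<epsilon>) \<le> \<sigma> * D"
      using E6 abs_Re_le_cmod[of "inner_on W q \<epsilon>"] unfolding q_def Pz_def by linarith
    moreover have "Re (inner_on W q (seq_conv \<psi> \<epsilon>)) \<le> \<rho> * (\<sigma> * D)"
      using inner_on_seq_conv_le[OF \<psi> E7] complex_Re_le_cmod[of "inner_on W q (seq_conv \<psi> \<epsilon>)"]
      unfolding q_def Pz_def by linarith
    ultimately show ?thesis by linarith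
  qed
  \<comment> \<open>The summand \<open>A4\<^sup>2\<close> comes from completing the square in
    \<open>a\<close>. The coefficient 6 is twice three quadratic forms: one for \<phi>, and two for
    \<psi>, with and without projection.\<close>
  define R where "R = A4\<^sup>2 + 2 * \<rho> * A5 * A3 + 6 * \<rho> * A1 + 2 * (1 + \<rho>) * D"
  have "A4 \<ge> 0" using E4 seminorm2_nonneg order_trans by blast
  have "A1 \<ge> 0" using E1[of 1] by (auto intro: order_trans[OF norm_ge_zero])
  have "A3 \<ge> 0" using E3[of 1] by (auto intro: order_trans[OF seminorm2_nonneg])
  have "\<sigma> * D \<ge> 0" using E6 by (auto intro: order_trans[OF norm_ge_zero])
  then have "D \<ge> 0" using \<sigma> by (simp add: zero_le_mult_iff)
  have R: "R \<ge> 0"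
    unfolding R_def using \<rho> \<open>A1 \<ge> 0\<close> \<open>A3 \<ge> 0\<close> \<open>A5 \<ge> 0\<close> \<open>D \<ge> 0\<close> by (intro add_nonneg_nonneg mult_nonneg_nonneg) auto
  have "2 * \<sigma> * (Re (inner_on W z (r \<phi>)) - Re (inner_on W z (r \<psi>)))
      \<le> 2 * \<sigma> * ((b + \<sigma> * (\<rho> * A3)) * A5 + \<sigma> * (\<rho> * A1) + (A4 * a + 2 * \<sigma> * (\<rho> * A1) + \<sigma> * D + \<rho> * (\<sigma> * D)))"
  proof (rule mult_left_mono)
    show "Re (inner_on W z (r \<phi>)) - Re (inner_on W z (r \<psi>))
        \<le> (b + \<sigma> * (\<rho> * A3)) * A5 + \<sigma> * (\<rho> * A1) + (A4 * a + 2 * \<sigma> * (\<rho> * A1) + \<sigma> * D + \<rho> * (\<sigma> * D))"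
      using t1 t2 by linarith
  qed (use \<sigma> in simp)
  with main have "a\<^sup>2 \<le> b\<^sup>2 + 2 * \<sigma> * ((b + \<sigma> * (\<rho> * A3)) * A5 + \<sigma> * (\<rho> * A1) + (A4 * a + 2 * \<sigma> * (\<rho> * A1) + \<sigma> * D + \<rho> * (\<sigma> * D)))"
    by linarith
  \<comment> \<open>Squares are completed in \<open>a\<close> and in \<open>b\<close>. The negative
    term is then dropped, and the square root of a sum of squares is bounded by the sum, which keeps
    the coefficient of \<open>b\<close> equal to 1.\<close>
  then have "(a - \<sigma> * A4)\<^sup>2 \<le> (b + \<sigma> * A5)\<^sup>2 + \<sigma>\<^sup>2 * R - (\<sigma> * A5)\<^sup>2"
    unfolding R_def by (simp add: power2_eq_square algebra_simps)
  also have "\<dots> \<le> (b + \<sigma> * A5)\<^sup>2 + (\<sigma> * sqrt R)\<^sup>2"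
    using R by (simp add: power_mult_distrib)
  also have "\<dots> \<le> (b + \<sigma> * A5 + \<sigma> * sqrt R)\<^sup>2"
    using ab \<sigma> \<open>A5 \<ge> 0\<close> R by (simp add: power2_sum)
  finally have "a - \<sigma> * A4 \<le> b + \<sigma> * A5 + \<sigma> * sqrt R"
    by (rule power2_le_imp_le) (use ab \<sigma> \<open>A5 \<ge> 0\<close> R in auto)
  then have "a \<le> b + \<sigma> * (A4 + A5 + sqrt R)" by (simp add: algebra_simps)
  moreover have "x - seq_conv \<theta> y = r \<theta>" for \<theta> by (simp add: fun_eq_iff r_def)
  ultimately show ?thesis by (simp only: a_def b_def R_def)
qed

section \<open>High-probability bounds\<close>

lemma sum_restrict:
  fixes f :: "'i \<Rightarrow> 'b::semiring_0"
  assumes "finite I" "W \<subseteq> I"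
  shows "(\<Sum>t\<in>I. (if t \<in> W then f t else 0) * g t) = (\<Sum>t\<in>W. f t * g t)"
  using assms by (intro sum.mono_neutral_cong_right) auto

lemma (in prob_space) complex_gaussian_inner_on_matrix_tail:
  fixes A :: "int \<Rightarrow> int \<Rightarrow> complex"
  assumes I: "finite I" "I \<noteq> {}" and W: "W \<subseteq> I"
    and iid: "iid_std_complex_gaussian M I \<zeta>"
    and F: "F > 0" "(\<Sum>s\<in>W. \<Sum>t\<in>I. (cmod (A s t))\<^sup>2) \<le> F\<^sup>2"
    and \<delta>: "\<delta> > 0"
  shows "with_prob_ge M (1 - 4 * \<delta>) (\<lambda>\<omega>. cmod (inner_on W (\<lambda>t. \<zeta> t \<omega>) (\<lambda>s. \<Sum>t\<in>I. A s t * \<zeta> t \<omega>))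
    \<le> 4 * cmod (\<Sum>t\<in>W. A t t) + F * (1 + 32 * ln (1 / \<delta>)))"
proof -
  \<comment> \<open>The loss lives on \<open>W\<close>, but the averages read the noise on the
    larger set \<open>I\<close>; padding with zero rows makes the matrix square.\<close>
  define B where "B s t = (if s \<in> W then A s t else 0)" for s t
  have "(\<Sum>s\<in>I. \<Sum>t\<in>I. (cmod (B s t))\<^sup>2) = (\<Sum>s\<in>W. \<Sum>t\<in>I. (cmod (A s t))\<^sup>2)"
    using I W by (intro sum.mono_neutral_cong_right) (auto simp: B_def)
  moreover have "(\<Sum>t\<in>I. B t t) = (\<Sum>t\<in>W. A t t)"
    using I W by (intro sum.mono_neutral_cong_right) (auto simp: B_def)
  moreover have "(\<Sum>s\<in>I. \<Sum>t\<in>I. cnj (z s) * B s t * z t) = inner_on W z (\<lambda>s. \<Sum>t\<in>I. A s t * z t)" for z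
  proof -
    have "(\<Sum>s\<in>I. \<Sum>t\<in>I. cnj (z s) * B s t * z t) = (\<Sum>s\<in>W. \<Sum>t\<in>I. cnj (z s) * A s t * z t)"
      using I W by (intro sum.mono_neutral_cong_right) (auto simp: B_def)
    then show ?thesis by (simp add: inner_on_def sum_distrib_left mult.assoc)
  qed
  ultimately show ?thesis
    using complex_gaussian_sesquilinear_tail[OF I iid F(1) _ \<delta>, of B] F(2) by simp
qed

text \<open>One tail bound for the sum of squares controls all members of the family together. A
  union bound would add the logarithm of \<open>card R\<close>.\<close>

lemma (in prob_space) complex_gaussian_inner_on_family_tail:
  fixes v :: "'r \<Rightarrow> int \<Rightarrow> complex"
  assumes I: "finite I" "I \<noteq> {}" and W: "W \<subseteq> I" and R: "finite R"
    and iid: "iid_std_complex_gaussian M I \<zeta>"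
    and D: "(\<Sum>r\<in>R. norm2_on W (v r)) \<le> D"
    and \<delta>: "\<delta> > 0"
  shows "with_prob_ge M (1 - \<delta>) (\<lambda>\<omega>. (\<Sum>r\<in>R. (cmod (inner_on W (\<lambda>t. \<zeta> t \<omega>) (v r)))\<^sup>2)
    \<le> D * (5 / 2 + 16 * ln (1 / \<delta>)))"
proof -
  define G where "G r t = (if t \<in> W then cnj (v r t) else 0)" for r t
  have "(\<Sum>t\<in>I. G r t * z t) = inner_on W (v r) z" for r z
    unfolding G_def inner_on_def by (rule sum_restrict[OF I(1) W])
  then have "cmod (\<Sum>t\<in>I. G r t * z t) = cmod (inner_on W z (v r))" for r z
    by (metis cnj_inner_on complex_mod_cnj)
  moreover have "(\<Sum>t\<in>I. (cmod (G r t))\<^sup>2) = norm2_on W (v r)" for r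
    unfolding norm2_on_def G_def using I W by (intro sum.mono_neutral_cong_right) auto
  ultimately show ?thesis
    using complex_gaussian_norm_tail'[OF I R iid _ \<delta>, of G D] D by simp
qed

text \<open>By Bessel the map to the coefficients has norm at most 1, while its squared Frobenius
  norm is \<open>d\<close>. Hence the logarithm is added to the dimension instead of multiplying
  it.\<close>

lemma (in prob_space) complex_gaussian_proj_on_tail:
  assumes I: "finite I" "I \<noteq> {}" and W: "W \<subseteq> I"
    and iid: "iid_std_complex_gaussian M I \<zeta>"
    and e: "orthonormal_on W e d"
    and \<delta>: "\<delta> > 0"
  shows "with_prob_ge M (1 - \<delta>) (\<lambda>\<omega>. norm2_on W (proj_on W e d (\<lambda>t. \<zeta> t \<omega>))
    \<le> 5 / 2 * real d + 16 * ln (1 / \<delta>))"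
proof -
  define G where "G i t = (if t \<in> W then cnj (e i t) else 0)" for i t
  have G: "(\<Sum>t\<in>I. G i t * z t) = inner_on W (e i) z" for i z
    unfolding G_def inner_on_def by (rule sum_restrict[OF I(1) W])
  have "(\<Sum>i<d. \<Sum>t\<in>I. (cmod (G i t))\<^sup>2) = (\<Sum>i<d. 1)"
  proof (intro sum.cong refl)
    fix i assume i: "i \<in> {..<d}"
    have "(\<Sum>t\<in>I. (cmod (G i t))\<^sup>2) = norm2_on W (e i)"
      unfolding norm2_on_def G_def using I W by (intro sum.mono_neutral_cong_right) auto
    moreover have "complex_of_real (norm2_on W (e i)) = 1"
      using e i unfolding inner_on_self[symmetric] by (simp add: orthonormal_on_def)
    ultimately show "(\<Sum>t\<in>I. (cmod (G i t))\<^sup>2) = 1" by simp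
  qed
  then have D: "(\<Sum>i<d. \<Sum>t\<in>I. (cmod (G i t))\<^sup>2) \<le> real d" by simp
  have "(\<Sum>i<d. (cmod (\<Sum>t\<in>I. G i t * z t))\<^sup>2) \<le> 1 * (\<Sum>t\<in>I. (cmod (z t))\<^sup>2)" for z
  proof -
    have "norm2_on W z \<le> (\<Sum>t\<in>I. (cmod (z t))\<^sup>2)"
      unfolding norm2_on_def using I W by (intro sum_mono2) auto
    then show ?thesis unfolding G using bessel[OF e, of z] by simp
  qed
  from complex_gaussian_norm_tail[OF I iid zero_less_one this D \<delta>] show ?thesis
    unfolding G norm2_on_proj_on[OF e] by simp
qed

lemma proj_on_sum:
  "proj_on W e d (\<lambda>t. \<Sum>s\<in>J. f t s * c s) t = (\<Sum>s\<in>J. proj_on W e d (\<lambda>t. f t s) t * c s)"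
proof -
  have "inner_on W u (\<lambda>t. \<Sum>s\<in>J. f t s * c s) = (\<Sum>s\<in>J. c s * inner_on W u (\<lambda>t. f t s))" for u
    using inner_on_sum_right[where K = J and c = c and v = "\<lambda>s t. f t s"] by (simp add: mult.commute)
  then have "proj_on W e d (\<lambda>t. \<Sum>s\<in>J. f t s * c s) t
      = (\<Sum>i<d. \<Sum>s\<in>J. c s * inner_on W (e i) (\<lambda>t. f t s) * e i t)"
    by (simp add: proj_on_def sum_distrib_right)
  also have "\<dots> = (\<Sum>s\<in>J. \<Sum>i<d. c s * inner_on W (e i) (\<lambda>t. f t s) * e i t)" by (rule sum.swap)
  finally show ?thesis by (simp add: proj_on_def sum_distrib_left mult_ac)
qed

lemma kernel_trace:
  "(\<Sum>t\<in>window n. modavg_kernel m k t t) = complex_of_real ((kappa_ratio m n)\<^sup>2)"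
  by (simp add: modavg_kernel_def kappa_ratio_def add.commute)

text \<open>Differences of window points are at most 2n in modulus and the band has half-width
  \<open>m\<close>. Since 2n + m < N, the banded Toeplitz matrix is a corner of a circulant matrix
  of order \<open>N\<close>, which the characters diagonalize; the modulation only multiplies each
  character by a fixed phase.\<close>

lemma kernel_dirichlet:
  fixes m n :: nat
  assumes t: "t \<in> window n" and u: "u \<in> window n"
  defines "N \<equiv> 2 * m + 2 * n + 1"
  shows "modavg_kernel m k u t = (\<Sum>j = 1..N. dirichlet m N (int j) / of_nat (N * (2 * m + 1)) *
    (unit_root N (int j * u) * unit_root (2 * m + 1) (int k * u)) *
    cnj (unit_root N (int j * t) * unit_root (2 * m + 1) (int k * t)))"
proof -
  let ?q = "2 * m + 1"
  have "\<bar>u - t\<bar> + int m < int N" using t u by (auto simp: N_def)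
  note sum = sum_dirichlet[OF this]
  have "(\<Sum>j = 1..N. dirichlet m N (int j) / of_nat (N * ?q) *
      (unit_root N (int j * u) * unit_root ?q (int k * u)) *
      cnj (unit_root N (int j * t) * unit_root ?q (int k * t)))
    = (\<Sum>j = 1..N. dirichlet m N (int j) * unit_root N (int j * (u - t))) * (unit_root ?q (int k * (u - t)) / of_nat (N * ?q))"
    unfolding sum_distrib_right
    by (intro sum.cong refl) (simp add: unit_root_diff cnj_unit_root)
  also have "\<dots> = modavg_kernel m k u t"
  proof -
    have "complex_of_nat N \<noteq> 0" unfolding of_nat_eq_0_iff by (simp add: N_def)
    then show ?thesis unfolding sum of_nat_mult by (simp add: modavg_kernel_def)
  qed
  finally show ?thesis by simp
qed

text \<open>The Frobenius norms of projection and kernel bound this trace only by \<open>kappa_ratio m n * sqrt d\<close>,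
  which is too large. Expanding the kernel in \<open>N\<close>-th roots of unity turns every term into a Bessel sum
  and costs a Lebesgue constant, that is, a logarithm.\<close>

lemma proj_on_kernel_trace:
  assumes e: "orthonormal_on (window n) e d"
  shows "cmod (\<Sum>t\<in>window n. proj_on (window n) e d (\<lambda>u. modavg_kernel m k u t) t)
    \<le> (kappa_ratio m n)\<^sup>2 * (3 + 2 * ln (real (2 * m + 2 * n + 1)))"
proof -
  define N where "N = 2 * m + 2 * n + 1"
  define W where "W = window n"
  define h where "h j u = unit_root N (int j * u) * unit_root (2 * m + 1) (int k * u)" for j u
  define c where "c j = dirichlet m N (int j) / of_nat (N * (2 * m + 1))" for j
  have ker: "modavg_kernel m k u t = (\<Sum>j = 1..N. (c j * cnj (h j t)) * h j u)" if "u \<in> W" "t \<in> W" for u t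
    using kernel_dirichlet[of t n u m k] that by (simp add: N_def h_def c_def W_def mult_ac)
  have "(\<Sum>t\<in>W. proj_on W e d (\<lambda>u. modavg_kernel m k u t) t)
      = (\<Sum>t\<in>W. \<Sum>i<d. \<Sum>j = 1..N. c j * inner_on W (e i) (h j) * (cnj (h j t) * e i t))"
  proof (intro sum.cong refl)
    fix t assume t: "t \<in> W"
    have "inner_on W v (\<lambda>u. modavg_kernel m k u t) = (\<Sum>j = 1..N. (c j * cnj (h j t)) * inner_on W v (h j))" for v
      unfolding inner_on_sum_right[symmetric] by (rule inner_on_cong) (simp_all add: ker t)
    then show "proj_on W e d (\<lambda>u. modavg_kernel m k u t) t
        = (\<Sum>i<d. \<Sum>j = 1..N. c j * inner_on W (e i) (h j) * (cnj (h j t) * e i t))"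
      by (simp add: proj_on_def sum_distrib_left sum_distrib_right mult_ac)
  qed
  also have "\<dots> = (\<Sum>i<d. \<Sum>t\<in>W. \<Sum>j = 1..N. c j * inner_on W (e i) (h j) * (cnj (h j t) * e i t))"
    by (rule sum.swap)
  also have "\<dots> = (\<Sum>i<d. \<Sum>j = 1..N. c j * inner_on W (e i) (h j) * inner_on W (h j) (e i))"
    unfolding inner_on_def[of W "h _" "e _"] sum_distrib_left by (intro sum.cong refl sum.swap)
  also have "\<dots> = (\<Sum>i<d. \<Sum>j = 1..N. c j * complex_of_real ((cmod (inner_on W (e i) (h j)))\<^sup>2))"
    unfolding complex_norm_square cnj_inner_on by (simp add: mult.assoc)
  also have "\<dots> = (\<Sum>j = 1..N. c j * complex_of_real (\<Sum>i<d. (cmod (inner_on W (e i) (h j)))\<^sup>2))"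
    by (subst sum.swap) (simp add: sum_distrib_left)
  finally have "cmod (\<Sum>t\<in>W. proj_on W e d (\<lambda>u. modavg_kernel m k u t) t)
      \<le> (\<Sum>j = 1..N. cmod (c j * complex_of_real (\<Sum>i<d. (cmod (inner_on W (e i) (h j)))\<^sup>2)))"
    by (simp only: norm_sum)
  also have "\<dots> = (\<Sum>j = 1..N. cmod (c j) * \<bar>\<Sum>i<d. (cmod (inner_on W (e i) (h j)))\<^sup>2\<bar>)"
    by (simp only: norm_mult norm_of_real)
  \<comment> \<open>Bessel bounds each inner sum by the squared norm of \<open>h j\<close>, whose
    values have modulus 1. The estimate is thus independent of \<open>d\<close>.\<close>
  also have "\<dots> \<le> (\<Sum>j = 1..N. cmod (c j) * (2 * real n + 1))"
  proof (intro sum_mono mult_left_mono)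
    fix j
    have "norm2_on W (h j) = 2 * real n + 1" by (simp add: norm2_on_def h_def norm_mult W_def)
    then show "\<bar>\<Sum>i<d. (cmod (inner_on W (e i) (h j)))\<^sup>2\<bar> \<le> 2 * real n + 1"
      using bessel[OF e, of "h j"] by (simp add: W_def sum_nonneg)
  qed simp
  also have "\<dots> = (\<Sum>j = 1..N. cmod (dirichlet m N (int j))) * ((2 * real n + 1) / (real N * (2 * real m + 1)))"
    unfolding sum_distrib_right c_def norm_divide norm_of_nat
    by (intro sum.cong refl) (simp add: field_simps)
  also have "\<dots> \<le> real N * (3 + 2 * ln (real N)) * ((2 * real n + 1) / (real N * (2 * real m + 1)))"
    by (intro mult_right_mono sum_norm_dirichlet_le) (auto simp: N_def)
  also have "\<dots> = (kappa_ratio m n)\<^sup>2 * (3 + 2 * ln (real N))"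
    by (simp add: kappa_ratio_def N_def)
  finally show ?thesis by (simp add: W_def N_def)
qed

text \<open>The projection acts on the columns of the kernel, and by Bessel it lengthens none of
  them.\<close>

lemma proj_on_kernel_frobenius:
  assumes e: "orthonormal_on (window n) e d"
  shows "(\<Sum>s\<in>window n. \<Sum>t\<in>window (m + n). (cmod (proj_on (window n) e d (\<lambda>u. modavg_kernel m k u t) s))\<^sup>2)
    \<le> (kappa_ratio m n)\<^sup>2"
proof -
  have "(\<Sum>s\<in>window n. \<Sum>t\<in>window (m + n). (cmod (proj_on (window n) e d (\<lambda>u. modavg_kernel m k u t) s))\<^sup>2)
      = (\<Sum>t\<in>window (m + n). norm2_on (window n) (proj_on (window n) e d (\<lambda>u. modavg_kernel m k u t)))"
    unfolding norm2_on_def by (rule sum.swap)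
  also have "\<dots> \<le> (\<Sum>t\<in>window (m + n). norm2_on (window n) (\<lambda>u. modavg_kernel m k u t))"
    unfolding norm2_on_proj_on[OF e] by (intro sum_mono bessel[OF e])
  also have "\<dots> = (kappa_ratio m n)\<^sup>2"
    unfolding norm2_on_def kernel_frobenius[symmetric, of m n k] by (rule sum.swap)
  finally show ?thesis .
qed

lemma kappa_ratio_pos: "kappa_ratio m n > 0"
  by (simp add: kappa_ratio_def)

lemma window_mono: "window n \<subseteq> window (m + n)" by auto

lemma (in prob_space) inner_on_modavg_tail:
  assumes iid: "iid_std_complex_gaussian M (window (m + n)) \<zeta>" and \<delta>: "\<delta> > 0"
  shows "with_prob_ge M (1 - 4 * \<delta>) (\<lambda>\<omega>. cmod (inner_on (window n) (\<lambda>t. \<zeta> t \<omega>) (modavg m k (\<lambda>t. \<zeta> t \<omega>)))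
    \<le> 4 * (kappa_ratio m n)\<^sup>2 + kappa_ratio m n * (1 + 32 * ln (1 / \<delta>)))"
proof -
  have "inner_on (window n) z (\<lambda>s. \<Sum>t\<in>window (m + n). modavg_kernel m k s t * z t)
      = inner_on (window n) z (modavg m k z)" for z
    by (rule inner_on_cong) (auto simp: modavg_eq_kernel)
  then show ?thesis
    using complex_gaussian_inner_on_matrix_tail[OF _ _ window_mono iid kappa_ratio_pos _ \<delta>,
        of "modavg_kernel m k" m n]
    by (simp add: kernel_frobenius kernel_trace norm_power del: of_nat_add)
qed

text \<open>Self-adjointness moves the projection from the noise to the columns of the kernel, which
  gives a quadratic form with a fixed matrix. Its trace is where the Lebesgue constant
  enters.\<close>

lemma (in prob_space) inner_on_proj_on_modavg_tail:
  assumes iid: "iid_std_complex_gaussian M (window (m + n)) \<zeta>" and \<delta>: "\<delta> > 0"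
    and e: "orthonormal_on (window n) e d"
  shows "with_prob_ge M (1 - 4 * \<delta>) (\<lambda>\<omega>.
    cmod (inner_on (window n) (proj_on (window n) e d (\<lambda>t. \<zeta> t \<omega>)) (modavg m k (\<lambda>t. \<zeta> t \<omega>)))
    \<le> 4 * ((kappa_ratio m n)\<^sup>2 * (3 + 2 * ln (real (2 * m + 2 * n + 1)))) + kappa_ratio m n * (1 + 32 * ln (1 / \<delta>)))"
proof -
  define A where "A s t = proj_on (window n) e d (\<lambda>u. modavg_kernel m k u t) s" for s t
  have eq: "inner_on (window n) z (\<lambda>s. \<Sum>t\<in>window (m + n). A s t * z t)
      = inner_on (window n) (proj_on (window n) e d z) (modavg m k z)" for z
  proof -
    have "proj_on (window n) e d (modavg m k z)
        = proj_on (window n) e d (\<lambda>u. \<Sum>t\<in>window (m + n). modavg_kernel m k u t * z t)"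
      by (intro proj_on_cong inner_on_cong) (auto simp: modavg_eq_kernel)
    then show ?thesis unfolding proj_on_self_adjoint A_def proj_on_sum[symmetric] by simp
  qed
  have "with_prob_ge M (1 - 4 * \<delta>) (\<lambda>\<omega>. cmod (inner_on (window n) (\<lambda>t. \<zeta> t \<omega>) (\<lambda>s. \<Sum>t\<in>window (m + n). A s t * \<zeta> t \<omega>))
    \<le> 4 * cmod (\<Sum>t\<in>window n. A t t) + kappa_ratio m n * (1 + 32 * ln (1 / \<delta>)))"
    by (rule complex_gaussian_inner_on_matrix_tail[OF _ _ window_mono iid kappa_ratio_pos _ \<delta>])
      (simp_all add: A_def proj_on_kernel_frobenius[OF e] del: of_nat_add)
  then show ?thesis
    unfolding eq by (elim with_prob_ge_mono) (use proj_on_kernel_trace[OF e, of m k] in \<open>auto simp: A_def\<close>)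
qed

lemma (in prob_space) norm2_on_modavg_tail:
  assumes iid: "iid_std_complex_gaussian M (window (m + n)) \<zeta>" and \<delta>: "\<delta> > 0"
  shows "with_prob_ge M (1 - \<delta>) (\<lambda>\<omega>. norm2_on (window n) (modavg m k (\<lambda>t. \<zeta> t \<omega>))
    \<le> (kappa_ratio m n)\<^sup>2 * (5 / 2 + 16 * ln (1 / \<delta>)))"
proof -
  have "norm2_on (window n) (modavg m k z) = (\<Sum>s\<in>window n. (cmod (\<Sum>t\<in>window (m + n). modavg_kernel m k s t * z t))\<^sup>2)" for z
    unfolding norm2_on_def by (intro sum.cong refl) (simp add: modavg_eq_kernel)
  then show ?thesis
    using complex_gaussian_norm_tail'[OF _ _ _ iid _ \<delta>, of "window n" "modavg_kernel m k" "(kappa_ratio m n)\<^sup>2"]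
    by (simp add: kernel_frobenius del: of_nat_add)
qed

section \<open>The oracle inequality\<close>

text \<open>Arithmetic that turns the remainder of the deterministic inequality into the stated
  rate. \<open>L\<close> includes the cost of union bounds over the filters; \<open>l\<close> is the
  bare ln (1 / \<alpha>), and it alone accompanies \<kappa>. \<open>U\<close> and \<open>V\<close>
  name the first two summands of \<open>E\<close>.\<close>

lemma remainder_le:
  fixes K L l k \<rho> \<kappa> s :: real
  assumes K: "K \<ge> 1" and L: "L \<ge> 0" and l: "l \<ge> 0" and k: "k \<ge> 0"
    and \<rho>: "\<rho> > 1" and \<kappa>: "\<kappa> \<ge> 0" and s: "s \<ge> 0"
  defines "E \<equiv> \<rho> * (k\<^sup>2 + 1) * L + \<rho> * \<kappa> * sqrt l + s"
  shows "sqrt (3 * s + 16 * (K * L)) + sqrt (17 * (K * L))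
    + sqrt ((sqrt (3 * s + 16 * (K * L)))\<^sup>2 + 2 * \<rho> * sqrt (17 * (K * L)) * (k * sqrt (17 * (K * L)))
        + 6 * \<rho> * (41 * (k\<^sup>2 + 1) * (K * L)) + 2 * (1 + \<rho>) * (\<kappa> * sqrt (17 * (K * l))))
    \<le> 30 * K * sqrt E"
proof -
  define U where "U = \<rho> * (k\<^sup>2 + 1) * L"
  define V where "V = \<rho> * \<kappa> * sqrt l"
  have E: "E = U + V + s" by (simp add: E_def U_def V_def)
  have U: "U \<ge> 0" and V: "V \<ge> 0" using L l \<rho> \<kappa> by (simp_all add: U_def V_def)
  have LU: "L \<le> U"
  proof -
    have "1 * 1 \<le> \<rho> * (k\<^sup>2 + 1)" using \<rho> by (intro mult_mono) auto
    then show ?thesis unfolding U_def using mult_right_mono[of 1 "\<rho> * (k\<^sup>2 + 1)" L] L by simp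
  qed
  have KE: "K * U \<ge> 0" "K * V \<ge> 0" "K * s \<ge> 0" using K U V s by auto
  have KL: "K * L \<le> K * U" "K * L \<ge> 0" using LU K L by auto
  have ss: "s \<le> K * s" using mult_right_mono[of 1 K s] K s by simp
  have KEeq: "K * E = K * U + K * V + K * s" by (simp add: E distrib_left)
  have b4: "3 * s + 16 * (K * L) \<le> 16 * (K * E)" using KE KL ss unfolding KEeq distrib_left by argo
  have b5: "17 * (K * L) \<le> 25 * (K * E)" using KE KL unfolding KEeq distrib_left by argo
  \<comment> \<open>The mixed term is of order \<rho> k L; \<open>2 * k \<le> k\<^sup>2 + 1\<close>
    puts it under the first summand of the rate.\<close>
  have c1: "2 * \<rho> * sqrt (17 * (K * L)) * (k * sqrt (17 * (K * L))) \<le> 17 * (K * U)"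
  proof -
    have "2 * \<rho> * sqrt (17 * (K * L)) * (k * sqrt (17 * (K * L))) = (2 * k) * (17 * (K * (\<rho> * L)))"
      using KL by simp
    also have "\<dots> \<le> (k\<^sup>2 + 1) * (17 * (K * (\<rho> * L)))"
    proof (rule mult_right_mono)
      show "2 * k \<le> k\<^sup>2 + 1" using zero_le_power2[of "k - 1"] by (simp add: power2_eq_square algebra_simps)
    qed (use K \<rho> L in auto)
    finally show ?thesis by (simp add: U_def mult_ac)
  qed
  have c2: "6 * \<rho> * (41 * (k\<^sup>2 + 1) * (K * L)) = 246 * (K * U)" by (simp add: U_def)
  have c3: "2 * (1 + \<rho>) * (\<kappa> * sqrt (17 * (K * l))) \<le> 20 * (K * V)"
  proof -
    have "sqrt (17 * (K * l)) \<le> 5 * K * sqrt l"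
    proof (rule real_le_lsqrt)
      have "17 * (K * l) \<le> 25 * (K * K * l)"
        using K l mult_right_mono[of 1 K "K * l"] by (simp add: mult.assoc)
      moreover have "(5 * K * sqrt l)\<^sup>2 = 25 * (K * K * l)"
        using l unfolding power_mult_distrib by (simp add: power2_eq_square[of K])
      ultimately show "17 * (K * l) \<le> (5 * K * sqrt l)\<^sup>2" by (simp only:)
    qed (use K l in auto)
    then have "\<kappa> * sqrt (17 * (K * l)) \<le> \<kappa> * (5 * K * sqrt l)" using \<kappa> by (rule mult_left_mono)
    moreover have "2 * (1 + \<rho>) \<le> 4 * \<rho>" using \<rho> by simp
    ultimately have "2 * (1 + \<rho>) * (\<kappa> * sqrt (17 * (K * l))) \<le> (4 * \<rho>) * (\<kappa> * (5 * K * sqrt l))"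
      using \<rho> \<kappa> K l by (intro mult_mono[of "2 * (1 + \<rho>)"]) auto
    then show ?thesis by (simp add: V_def mult_ac)
  qed
  have c: "(sqrt (3 * s + 16 * (K * L)))\<^sup>2 + 2 * \<rho> * sqrt (17 * (K * L)) * (k * sqrt (17 * (K * L)))
        + 6 * \<rho> * (41 * (k\<^sup>2 + 1) * (K * L)) + 2 * (1 + \<rho>) * (\<kappa> * sqrt (17 * (K * l))) \<le> 400 * (K * E)"
  proof -
    have "(sqrt (3 * s + 16 * (K * L)))\<^sup>2 = 3 * s + 16 * (K * L)" using s KL by simp
    then have "(sqrt (3 * s + 16 * (K * L)))\<^sup>2 + 2 * \<rho> * sqrt (17 * (K * L)) * (k * sqrt (17 * (K * L)))
        + 6 * \<rho> * (41 * (k\<^sup>2 + 1) * (K * L)) + 2 * (1 + \<rho>) * (\<kappa> * sqrt (17 * (K * l)))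
        \<le> 16 * (K * E) + 17 * (K * U) + 246 * (K * U) + 20 * (K * V)"
      by (intro add_mono c1 c3) (simp_all only: c2 b4 order_refl)
    \<comment> \<open>The largest coefficient, that of \<open>K * U\<close>, is 16 + 17 + 246 = 279;
      rounding up to 400 gives the square root 20.\<close>
    also have "\<dots> \<le> 400 * (K * E)" using KE unfolding KEeq distrib_left by argo
    finally show ?thesis .
  qed
  have KsE: "sqrt (K * E) \<le> K * sqrt E"
  proof -
    have "sqrt K \<le> K" using K real_le_lsqrt[of K K] by (simp add: power2_eq_square)
    then show ?thesis using E U V s by (simp add: real_sqrt_mult mult_right_mono)
  qed
  \<comment> \<open>The three square roots contribute 4 + 5 + 20 = 29, which is rounded up to
    30.\<close>
  have "sqrt (3 * s + 16 * (K * L)) \<le> 4 * sqrt (K * E)"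
    using real_sqrt_le_mono[OF b4] by (simp add: real_sqrt_mult)
  moreover have "sqrt (17 * (K * L)) \<le> 5 * sqrt (K * E)"
    using real_sqrt_le_mono[OF b5] by (simp add: real_sqrt_mult)
  moreover have "sqrt (400 * (K * E)) = 20 * sqrt (K * E)"
    by (simp add: real_sqrt_mult)
  moreover have "sqrt (K * E) \<ge> 0" using KE unfolding KEeq by simp
  ultimately show ?thesis using real_sqrt_le_mono[OF c] KsE by linarith
qed

text \<open>The failure probability \<alpha> is divided equally among seven events
  \<open>E1\<close>, ..., \<open>E7\<close>, which provide the hypotheses of the deterministic
  inequality. The lower bound \<open>l0\<close> on ln (1 / \<alpha>) keeps the constant
  finite.\<close>

lemma (in prob_space) oracle_inequality:
  fixes m n s :: nat and \<alpha> l0 \<sigma> \<rho> \<kappa> :: real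
  assumes mn: "m + n > 0" and \<kappa>: "\<kappa> \<ge> 0" and \<rho>: "\<rho> > 1" and \<sigma>: "\<sigma> > 0"
    and x: "x \<in> signal_class m n \<sigma> s \<kappa>" and \<phi>: "con_feasible m \<rho> \<phi>"
    and iid: "iid_std_complex_gaussian M (window (m + n)) \<zeta>"
    and y: "\<And>\<omega> \<tau>. \<omega> \<in> space M \<Longrightarrow> \<tau> \<in> window (m + n) \<Longrightarrow> y \<omega> \<tau> = x \<tau> + complex_of_real \<sigma> * \<zeta> \<tau> \<omega>"
    and opt: "\<And>\<omega>. \<omega> \<in> space M \<Longrightarrow> con_optimal m n \<rho> (y \<omega>) (\<psi> \<omega>)"
    and \<alpha>: "\<alpha> > 0" and l0: "l0 > 0" "l0 \<le> ln (1 / \<alpha>)"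
  shows "with_prob_ge M (1 - \<alpha>) (\<lambda>\<omega>.
         seminorm2 n (x - seq_conv (\<psi> \<omega>) (y \<omega>))
           \<le> seminorm2 n (x - seq_conv \<phi> (y \<omega>))
             + 30 * (1 + 7 / l0) * \<sigma> * sqrt (\<rho> * ((kappa_ratio m n)\<^sup>2 + 1) * ln (real (m + n) / \<alpha>)
                             + \<rho> * \<kappa> * sqrt (ln (1 / \<alpha>)) + real s))"
proof -
  define W where "W = window n"
  define k where "k = kappa_ratio m n"
  define K where "K = 1 + 7 / l0"
  define L where "L = ln (real (m + n) / \<alpha>)"
  define l where "l = ln (1 / \<alpha>)"
  define q where "q = 2 * m + 1"
  have q: "real q > 0" by (simp add: q_def)
  have k: "k > 0" unfolding k_def by (rule kappa_ratio_pos)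
  have K: "K \<ge> 1" using l0 by (simp add: K_def)
  have lL: "l \<le> L" unfolding l_def L_def using mn \<alpha> by (intro ln_mono divide_right_mono) auto
  \<comment> \<open>This absorbs every additive constant below: at most 7 from
    \<open>ln (2 ^ 7)\<close>, at most 6 from \<open>ln 7\<close>, and the fixed terms of the tail
    bounds, since also \<open>K * v \<ge> 7\<close>. As \<open>m + n \<ge> 1\<close>, it applies to
    \<open>L\<close> as well as to \<open>l\<close>.\<close>
  have Kge: "v + 7 \<le> K * v" if "l0 \<le> v" for v
    using that l0 by (simp add: K_def field_simps)
  have l: "l + 7 \<le> K * l" "l > 0" using Kge l0 by (auto simp: l_def)
  have L: "L + 7 \<le> K * L" "L > 0" using Kge[of L] l0 lL by (auto simp: l_def)
  \<comment> \<open>28q counts seven events, four half-planes for the modulus of a complex form, and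
    \<open>q\<close> filters.\<close>
  have lnq: "ln (28 * real q / \<alpha>) \<le> K * L"
  proof -
    have "1 \<le> real (m + n)" using mn by linarith
    then have "28 * real q \<le> 2 ^ 7 * real (m + n)" by (simp add: q_def)
    then have "28 * real q / \<alpha> \<le> 2 ^ 7 * (real (m + n) / \<alpha>)"
      using \<alpha> by (simp add: divide_right_mono)
    then have "ln (28 * real q / \<alpha>) \<le> ln (2 ^ 7 * (real (m + n) / \<alpha>))"
      using \<alpha> by (intro ln_mono) (auto simp: q_def)
    also have "\<dots> = ln (2 ^ 7) + L" using mn \<alpha> by (subst ln_mult_pos) (auto simp: L_def)
    finally have "ln (28 * real q / \<alpha>) \<le> ln (2 ^ 7) + L" .
    moreover have "ln (2 ^ 7) = 7 * ln (2::real)" by (subst ln_realpow) simp_all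
    ultimately show ?thesis using L ln_2_less_1 by linarith
  qed
  have ln7q: "ln (7 * real q / \<alpha>) \<le> K * L"
  proof -
    have "ln (7 * real q / \<alpha>) \<le> ln (28 * real q / \<alpha>)"
      using \<alpha> by (intro ln_mono divide_right_mono) (auto simp: q_def)
    with lnq show ?thesis by simp
  qed
  have ln7: "ln (7 / \<alpha>) \<le> K * l"
  proof -
    have "ln (7 / \<alpha>) = ln 7 + l" using ln_mult_pos[of 7 "1 / \<alpha>"] \<alpha> by (simp add: l_def)
    moreover have "ln 7 \<le> (7 - 1 :: real)" by (rule ln_le_minus_one) simp
    ultimately show ?thesis using l by linarith
  qed
  have lnN: "3 + 2 * ln (real (2 * m + 2 * n + 1)) \<le> 2 * (K * L)"
  proof -
    have "\<alpha> < 1" using l(2) \<alpha> by (simp add: l_def ln_div)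
    then have le: "real (m + n) \<le> real (m + n) / \<alpha>"
      using \<alpha> mult_left_mono[of \<alpha> 1 "real (m + n)"] by (simp add: le_divide_eq)
    have "real (2 * m + 2 * n + 1) \<le> real (4 * (m + n))"
      unfolding of_nat_le_iff using mn by presburger
    also have "\<dots> = 2 ^ 2 * real (m + n)" by simp
    also have "\<dots> \<le> 2 ^ 2 * (real (m + n) / \<alpha>)" using le by (rule mult_left_mono) simp
    finally have "real (2 * m + 2 * n + 1) \<le> 2 ^ 2 * (real (m + n) / \<alpha>)" .
    then have "ln (real (2 * m + 2 * n + 1)) \<le> ln (2 ^ 2 * (real (m + n) / \<alpha>))" by (intro ln_mono) auto
    also have "\<dots> = ln (2 ^ 2) + L" using mn \<alpha> by (subst ln_mult_pos) (auto simp: L_def)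
    finally have "ln (real (2 * m + 2 * n + 1)) \<le> ln (2 ^ 2) + L" .
    moreover have "ln (2 ^ 2) = 2 * ln (2::real)" by (subst ln_realpow) simp_all
    ultimately show ?thesis using L ln_2_less_1 by linarith
  qed
  obtain u \<epsilon> d e where d: "d \<le> s" and e: "orthonormal_on W e d" and xu: "\<And>t. x t = u t + \<epsilon> t"
    and P: "\<And>\<theta> t. \<theta> \<in> filters m \<Longrightarrow> t \<in> W \<Longrightarrow> proj_on W e d (\<lambda>t. u t - seq_conv \<theta> u t) t = u t - seq_conv \<theta> u t"
    and \<epsilon>: "\<And>\<tau>. \<bar>\<tau>\<bar> \<le> int m \<Longrightarrow> seminorm2 n (seq_shift (- \<tau>) \<epsilon>) \<le> \<kappa> * \<sigma>"
    by (rule signal_class_decomposition[OF x, folded W_def]) (rule that)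
  have WI: "W \<subseteq> window (m + n)" unfolding W_def by (rule window_mono)
  define z where "z \<omega> t = \<zeta> t \<omega>" for \<omega> t
  define res where "res v t = v t - proj_on W e d v t" for v t
  have res: "inner_on W v (res w) = inner_on W (res v) w" for v w
    unfolding res_def inner_on_diff_right inner_on_diff_left proj_on_self_adjoint ..
  have res_le: "norm2_on W (res v) \<le> norm2_on W v" for v
    unfolding res_def by (rule norm2_on_diff_proj_on_le[OF e])
  \<comment> \<open>The lone 1 is absorbed by \<open>K * L\<close>, and
    \<open>k \<le> k\<^sup>2 + 1\<close>. Together with the 8 from the trace terms, the 33 makes the
    41 in \<open>E1\<close> and \<open>E2\<close>.\<close>
  have kln: "k * (1 + 32 * ln (1 / (\<alpha> / (28 * real q)))) \<le> (k\<^sup>2 + 1) * (33 * (K * L))"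
  proof -
    have "k * (1 + 32 * ln (1 / (\<alpha> / (28 * real q)))) \<le> k * (33 * (K * L))"
      using lnq L k by (intro mult_left_mono) auto
    also have "\<dots> \<le> (k\<^sup>2 + 1) * (33 * (K * L))"
    proof (rule mult_right_mono)
      show "k \<le> k\<^sup>2 + 1" using zero_le_power2[of "k - 1"] k by (simp add: power2_eq_square algebra_simps)
    qed (use L in simp)
    finally show ?thesis .
  qed
  have E1: "with_prob_ge M (1 - \<alpha> / 7) (\<lambda>\<omega>. \<forall>j\<in>{1..q}. cmod (inner_on W (z \<omega>) (modavg m j (z \<omega>))) \<le> 41 * (k\<^sup>2 + 1) * (K * L))"
  proof -
    have "with_prob_ge M (1 - real (card {1..q}) * (4 * (\<alpha> / (28 * real q))))
      (\<lambda>\<omega>. \<forall>j\<in>{1..q}. cmod (inner_on W (z \<omega>) (modavg m j (z \<omega>))) \<le> 4 * k\<^sup>2 + k * (1 + 32 * ln (1 / (\<alpha> / (28 * real q)))))"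
      unfolding z_def W_def k_def using \<alpha>
      by (intro with_prob_ge_ball inner_on_modavg_tail iid) (auto simp: q_def)
    moreover have "real (card {1..q}) * (4 * (\<alpha> / (28 * real q))) = \<alpha> / 7" using q by simp
    moreover have "4 * k\<^sup>2 + k * (1 + 32 * ln (1 / (\<alpha> / (28 * real q)))) \<le> 41 * (k\<^sup>2 + 1) * (K * L)"
    proof -
      note kln
      moreover have "4 * k\<^sup>2 \<le> (k\<^sup>2 + 1) * (8 * (K * L))"
        using mult_mono[of "k\<^sup>2" "k\<^sup>2 + 1" 4 "8 * (K * L)"] L by simp
      ultimately show ?thesis by (simp add: algebra_simps)
    qed
    ultimately show ?thesis by (elim with_prob_ge_mono) (auto intro: order_trans)
  qed
  have E2: "with_prob_ge M (1 - \<alpha> / 7) (\<lambda>\<omega>. \<forall>j\<in>{1..q}.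
      cmod (inner_on W (proj_on W e d (z \<omega>)) (modavg m j (z \<omega>))) \<le> 41 * (k\<^sup>2 + 1) * (K * L))"
  proof -
    have "with_prob_ge M (1 - real (card {1..q}) * (4 * (\<alpha> / (28 * real q))))
      (\<lambda>\<omega>. \<forall>j\<in>{1..q}. cmod (inner_on W (proj_on W e d (z \<omega>)) (modavg m j (z \<omega>)))
        \<le> 4 * (k\<^sup>2 * (3 + 2 * ln (real (2 * m + 2 * n + 1)))) + k * (1 + 32 * ln (1 / (\<alpha> / (28 * real q)))))"
      unfolding z_def W_def k_def using \<alpha> e
      by (intro with_prob_ge_ball inner_on_proj_on_modavg_tail iid) (auto simp: q_def W_def)
    moreover have "real (card {1..q}) * (4 * (\<alpha> / (28 * real q))) = \<alpha> / 7" using q by simp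
    moreover have "4 * (k\<^sup>2 * (3 + 2 * ln (real (2 * m + 2 * n + 1)))) + k * (1 + 32 * ln (1 / (\<alpha> / (28 * real q))))
        \<le> 41 * (k\<^sup>2 + 1) * (K * L)"
    proof -
      note kln
      moreover have "k\<^sup>2 * (3 + 2 * ln (real (2 * m + 2 * n + 1))) \<le> (k\<^sup>2 + 1) * (2 * (K * L))"
        using lnN L by (intro order_trans[OF mult_left_mono[OF lnN] mult_right_mono]) auto
      ultimately show ?thesis by (simp add: algebra_simps)
    qed
    ultimately show ?thesis by (elim with_prob_ge_mono) (auto intro: order_trans)
  qed
  have E3: "with_prob_ge M (1 - \<alpha> / 7) (\<lambda>\<omega>. \<forall>j\<in>{1..q}. seminorm2 n (modavg m j (z \<omega>)) \<le> k * sqrt (17 * (K * L)))"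
  proof -
    have "with_prob_ge M (1 - real (card {1..q}) * (\<alpha> / (7 * real q)))
      (\<lambda>\<omega>. \<forall>j\<in>{1..q}. norm2_on W (modavg m j (z \<omega>)) \<le> k\<^sup>2 * (5 / 2 + 16 * ln (1 / (\<alpha> / (7 * real q)))))"
      unfolding z_def W_def k_def using \<alpha>
      by (intro with_prob_ge_ball norm2_on_modavg_tail iid) (auto simp: q_def)
    moreover have "real (card {1..q}) * (\<alpha> / (7 * real q)) = \<alpha> / 7" using q by simp
    moreover have "k\<^sup>2 * (5 / 2 + 16 * ln (1 / (\<alpha> / (7 * real q)))) \<le> (k * sqrt (17 * (K * L)))\<^sup>2"
    proof -
      have "k\<^sup>2 * (5 / 2 + 16 * ln (1 / (\<alpha> / (7 * real q)))) \<le> k\<^sup>2 * (17 * (K * L))"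
        using ln7q L by (intro mult_left_mono) auto
      then show ?thesis using L K by (simp add: power_mult_distrib)
    qed
    moreover have "0 \<le> k * sqrt (17 * (K * L))" using k L K by simp
    ultimately show ?thesis
      by (elim with_prob_ge_mono) (auto simp: seminorm2_eq W_def intro!: real_le_lsqrt intro: order_trans)
  qed
  have E4: "with_prob_ge M (1 - \<alpha> / 7) (\<lambda>\<omega>. seminorm2 n (proj_on W e d (z \<omega>)) \<le> sqrt (3 * real s + 16 * (K * L)))"
  proof -
    have "with_prob_ge M (1 - \<alpha> / 7) (\<lambda>\<omega>. norm2_on W (proj_on W e d (z \<omega>)) \<le> 5 / 2 * real d + 16 * ln (1 / (\<alpha> / 7)))"
      unfolding z_def using \<alpha> mn by (intro complex_gaussian_proj_on_tail[OF _ _ WI iid e]) auto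
    moreover have "5 / 2 * real d + 16 * ln (1 / (\<alpha> / 7)) \<le> 3 * real s + 16 * (K * L)"
    proof -
      have "K * l \<le> K * L" using lL K by simp
      then have "ln (1 / (\<alpha> / 7)) \<le> K * L" using ln7 by simp
      moreover have "real d \<le> real s" using d by simp
      ultimately show ?thesis by linarith
    qed
    ultimately show ?thesis
      by (elim with_prob_ge_mono) (auto simp: seminorm2_eq W_def)
  qed
  define v where "v t = x t - seq_conv \<phi> x t" for t
  \<comment> \<open>One event for a whole deterministic family, hence \<open>l\<close> and not
    \<open>L\<close> on the right, whatever the size of \<open>R\<close>.\<close>
  have fam: "with_prob_ge M (1 - \<alpha> / 7) (\<lambda>\<omega>. \<forall>r\<in>R. cmod (inner_on W (z \<omega>) (w r)) \<le> B * sqrt (17 * (K * l)))"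
    if R: "finite R" and B: "B \<ge> 0" "(\<Sum>r\<in>R. norm2_on W (w r)) \<le> B\<^sup>2" for R :: "nat set" and w B
  proof -
    have tail: "with_prob_ge M (1 - \<alpha> / 7) (\<lambda>\<omega>. (\<Sum>r\<in>R. (cmod (inner_on W (z \<omega>) (w r)))\<^sup>2) \<le> B\<^sup>2 * (5 / 2 + 16 * ln (1 / (\<alpha> / 7))))"
      unfolding z_def using \<alpha> by (intro complex_gaussian_inner_on_family_tail[OF _ _ WI R iid B(2)]) auto
    have B2: "B\<^sup>2 * (5 / 2 + 16 * ln (1 / (\<alpha> / 7))) \<le> (B * sqrt (17 * (K * l)))\<^sup>2"
    proof -
      have "B\<^sup>2 * (5 / 2 + 16 * ln (1 / (\<alpha> / 7))) \<le> B\<^sup>2 * (17 * (K * l))"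
        using ln7 l by (intro mult_left_mono) auto
      then show ?thesis using l K by (simp add: power_mult_distrib)
    qed
    show ?thesis
    proof (rule with_prob_ge_mono[OF tail order_refl], rule ballI)
      fix \<omega> r
      assume "(\<Sum>r\<in>R. (cmod (inner_on W (z \<omega>) (w r)))\<^sup>2) \<le> B\<^sup>2 * (5 / 2 + 16 * ln (1 / (\<alpha> / 7)))" and r: "r \<in> R"
      moreover note B2
      moreover have "(cmod (inner_on W (z \<omega>) (w r)))\<^sup>2 \<le> (\<Sum>r\<in>R. (cmod (inner_on W (z \<omega>) (w r)))\<^sup>2)"
        using R r by (intro member_le_sum) auto
      ultimately have "(cmod (inner_on W (z \<omega>) (w r)))\<^sup>2 \<le> (B * sqrt (17 * (K * l)))\<^sup>2" by linarith
      then show "cmod (inner_on W (z \<omega>) (w r)) \<le> B * sqrt (17 * (K * l))"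
        by (rule power2_le_imp_le) (use B l K in auto)
    qed
  qed
  have E5: "with_prob_ge M (1 - \<alpha> / 7) (\<lambda>\<omega>. \<forall>r\<in>{0::nat}. cmod (inner_on W (z \<omega>) v) \<le> seminorm2 n v * sqrt (17 * (K * l)))"
    by (rule fam) (auto simp: seminorm2_nonneg seminorm2_power2 W_def)
  \<comment> \<open>In \<open>E6\<close> and \<open>E7\<close> the complementary projection
    \<open>res\<close> is moved from the noise to \<epsilon> and its averages. These are
    deterministic, and \<open>res\<close> does not increase their norms, so \<open>fam\<close>
    applies.\<close>
  have E6: "with_prob_ge M (1 - \<alpha> / 7) (\<lambda>\<omega>. \<forall>r\<in>{0::nat}. cmod (inner_on W (z \<omega>) (res \<epsilon>)) \<le> (\<kappa> * \<sigma>) * sqrt (17 * (K * l)))"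
  proof (rule fam)
    have "(seminorm2 n (seq_shift (- 0) \<epsilon>))\<^sup>2 \<le> (\<kappa> * \<sigma>)\<^sup>2"
      by (intro power_mono \<epsilon> seminorm2_nonneg) simp
    then have "norm2_on W \<epsilon> \<le> (\<kappa> * \<sigma>)\<^sup>2" by (simp add: seminorm2_power2 W_def seq_shift_def)
    then show "(\<Sum>r\<in>{0::nat}. norm2_on W (res \<epsilon>)) \<le> (\<kappa> * \<sigma>)\<^sup>2"
      using res_le[of \<epsilon>] by simp
  qed (use \<kappa> \<sigma> in auto)
  have E7: "with_prob_ge M (1 - \<alpha> / 7) (\<lambda>\<omega>. \<forall>j\<in>{1..q}. cmod (inner_on W (z \<omega>) (res (modavg m j \<epsilon>))) \<le> (\<kappa> * \<sigma>) * sqrt (17 * (K * l)))"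
  proof (rule fam)
    have "(\<Sum>j\<in>{1..q}. norm2_on W (res (modavg m j \<epsilon>))) \<le> (\<Sum>j = 1..q. norm2_on W (modavg m j \<epsilon>))"
      by (intro sum_mono res_le)
    also have "\<dots> \<le> (\<kappa> * \<sigma>)\<^sup>2" unfolding q_def W_def by (rule sum_norm2_on_modavg_le[OF \<epsilon>])
    finally show "(\<Sum>j\<in>{1..q}. norm2_on W (res (modavg m j \<epsilon>))) \<le> (\<kappa> * \<sigma>)\<^sup>2" .
  qed (use \<kappa> \<sigma> in auto)
  note all = with_prob_ge_conj[OF E1 with_prob_ge_conj[OF E2 with_prob_ge_conj[OF E3
    with_prob_ge_conj[OF E4 with_prob_ge_conj[OF E5 with_prob_ge_conj[OF E6 E7]]]]]]
  show ?thesis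
  proof (rule with_prob_ge_mono[OF all], goal_cases)
    case 1
    show ?case by simp
  next
    case (2 \<omega>)
    have \<psi>: "\<psi> \<omega> \<in> filters m"
      using opt[OF 2(1)] by (simp add: con_optimal_def is_arg_min_def con_feasible_def)
    have KlL: "K * l \<le> K * L" using lL K by simp
    have "seminorm2 n (x - seq_conv (\<psi> \<omega>) (y \<omega>)) \<le> seminorm2 n (x - seq_conv \<phi> (y \<omega>))
      + \<sigma> * (sqrt (3 * real s + 16 * (K * L)) + sqrt (17 * (K * L))
        + sqrt ((sqrt (3 * real s + 16 * (K * L)))\<^sup>2 + 2 * \<rho> * sqrt (17 * (K * L)) * (k * sqrt (17 * (K * L)))
        + 6 * \<rho> * (41 * (k\<^sup>2 + 1) * (K * L)) + 2 * (1 + \<rho>) * (\<kappa> * sqrt (17 * (K * l)))))"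
    proof (rule oracle_inequality_deterministic[where z = "z \<omega>" and d = d and e = e and u = u and \<epsilon> = \<epsilon>])
      show "cmod (inner_on (window n) (z \<omega>) (\<lambda>t. x t - seq_conv \<phi> x t))
        \<le> seminorm2 n (\<lambda>t. x t - seq_conv \<phi> x t) * sqrt (17 * (K * L))"
      proof -
        have "cmod (inner_on W (z \<omega>) v) \<le> seminorm2 n v * sqrt (17 * (K * l))" using 2(2) by simp
        also have "\<dots> \<le> seminorm2 n v * sqrt (17 * (K * L))"
          using KlL by (intro mult_left_mono seminorm2_nonneg) simp
        finally show ?thesis by (simp add: v_def[abs_def] W_def)
      qed
      show "cmod (inner_on (window n) (\<lambda>t. z \<omega> t - proj_on (window n) e d (z \<omega>) t) \<epsilon>) \<le> \<sigma> * (\<kappa> * sqrt (17 * (K * l)))"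
        using 2(2) unfolding res by (simp add: res_def[abs_def] W_def mult_ac)
      show "cmod (inner_on (window n) (\<lambda>t. z \<omega> t - proj_on (window n) e d (z \<omega>) t) (modavg m j \<epsilon>)) \<le> \<sigma> * (\<kappa> * sqrt (17 * (K * l)))"
        if "j \<in> {1..2 * m + 1}" for j
        using 2(2) that unfolding res q_def[symmetric] by (auto simp: res_def[abs_def] W_def mult_ac)
      show "proj_on (window n) e d (\<lambda>t. u t - seq_conv (\<psi> \<omega>) u t) t = u t - seq_conv (\<psi> \<omega>) u t" if "t \<in> window n" for t
        using P[OF \<psi>] that by (simp add: W_def)
      show "con_optimal m n \<rho> (y \<omega>) (\<psi> \<omega>)" by (rule opt[OF 2(1)])
      show "y \<omega> t = x t + complex_of_real \<sigma> * z \<omega> t" if "t \<in> window (m + n)" for t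
        using y[OF 2(1) that] by (simp add: z_def)
      show "0 \<le> sqrt (17 * (K * L))" using K L by simp
    qed (use 2(2) \<sigma> \<rho> xu \<phi> in \<open>simp_all add: W_def q_def\<close>)
    also have "\<dots> \<le> seminorm2 n (x - seq_conv \<phi> (y \<omega>)) + \<sigma> * (30 * K * sqrt (\<rho> * (k\<^sup>2 + 1) * L + \<rho> * \<kappa> * sqrt l + real s))"
      using \<sigma> K L l k \<rho> \<kappa> by (intro add_left_mono mult_left_mono remainder_le) auto
    finally show ?case by (simp add: K_def k_def L_def l_def mult_ac)
  qed
qed

theorem theorem3p1:
  "\<forall>\<alpha>0::real. 0 < \<alpha>0 \<and> \<alpha>0 < 1 \<longrightarrow>
   (\<exists>C::real.
     \<forall>(s::nat) (m::nat) (n::nat) (\<kappa>::real) (\<rho>::real) (\<sigma>::real)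
      (x :: int \<Rightarrow> complex) (\<phi> :: int \<Rightarrow> complex)
      (M :: 'w measure) (\<zeta> :: int \<Rightarrow> 'w \<Rightarrow> complex)
      (y :: 'w \<Rightarrow> int \<Rightarrow> complex) (\<phi>con :: 'w \<Rightarrow> int \<Rightarrow> complex) (\<alpha>::real).
       m + n > 0 \<longrightarrow> \<kappa> \<ge> 0 \<longrightarrow> \<rho> > 1 \<longrightarrow> \<sigma> > 0 \<longrightarrow>
       x \<in> signal_class m n \<sigma> s \<kappa> \<longrightarrow>
       \<phi> \<in> filters m \<longrightarrow> dft_norm1 m \<phi> \<le> \<rho> / sqrt (2 * real m + 1) \<longrightarrow>
       prob_space M \<longrightarrow>
       iid_std_complex_gaussian M {- int (m + n)..int (m + n)} \<zeta> \<longrightarrow>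
       (\<forall>\<omega>\<in>space M. \<forall>\<tau>\<in>{- int (m + n)..int (m + n)}. y \<omega> \<tau> = x \<tau> + complex_of_real \<sigma> * \<zeta> \<tau> \<omega>) \<longrightarrow>
       (\<forall>\<omega>\<in>space M. con_optimal m n \<rho> (y \<omega>) (\<phi>con \<omega>)) \<longrightarrow>
       0 < \<alpha> \<longrightarrow> \<alpha> \<le> \<alpha>0 \<longrightarrow>
       with_prob_ge M (1 - \<alpha>) (\<lambda>\<omega>.
         seminorm2 n (x - seq_conv (\<phi>con \<omega>) (y \<omega>))
           \<le> seminorm2 n (x - seq_conv \<phi> (y \<omega>))
             + C * \<sigma> * sqrt (\<rho> * ((kappa_ratio m n)\<^sup>2 + 1) * ln (real (m + n) / \<alpha>)
                             + \<rho> * \<kappa> * sqrt (ln (1 / \<alpha>)) + real s)))"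
proof (intro allI impI, goal_cases)
  case (1 \<alpha>0)
  then have l0: "0 < ln (1 / \<alpha>0)" by (simp add: ln_div)
  show ?case
  proof (intro exI[of _ "30 * (1 + 7 / ln (1 / \<alpha>0))"] allI impI, goal_cases)
    case (1 s m n \<kappa> \<rho> \<sigma> x \<phi> M \<zeta> y \<phi>con \<alpha>)
    then interpret prob_space M by simp
    \<comment> \<open>The logarithm is smallest at the right end of the range of \<alpha>, so its
      value at \<alpha>0 serves as \<open>l0\<close> for all smaller \<alpha>.\<close>
    have "ln (1 / \<alpha>0) \<le> ln (1 / \<alpha>)" using 1 l0 by (intro ln_mono divide_left_mono) auto
    then show ?case using 1 l0 by (intro oracle_inequality) (auto simp: con_feasible_def)
  qed
qed

end
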